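(* Let $\mathscr Z=\sum_{n\ge1}\widetilde W_{C_n}(b,w_-,w_+)/|\operatorname{Aut}C_n|$, regarded as a formal power series in $b,w_-,w_+$ (each $\widetilde W_{C_n}$ is homogeneous of degree $n$). Substitute $$b\gets\mathscr T_b,\qquad w_+\gets\mathscr T_w^++\mathscr T_w^-,\qquad w_-\gets t^{-1}\mathscr T_w^++t\,\mathscr T_w^-.$$ The result is the series $\mathscr W_1(x)$.
   Context: Graphs may have loops and parallel edges. A coloring is $c\colon V\to\{0,1\}$ ($0$ white, $1$ black). For a vertex $v$, its black-neighbor count is the number of edges joining $v$ to black vertices, with multiplicity, loops not counted. Full $W$-polynomial: $\widetilde W_K=\sum_c b^{\#\text{black}}w_+^{\#\text{white with even count}}w_-^{\#\text{white with odd count}}$; black-white polynomial $W_K(t)=\sum_c t^{\#\text{white vertices with even count}}$. $C_n$ is the $n$-cycle, where $C_1$ is a vertex with a loop and $C_2$ is two vertices joined by two parallel edges; $|\operatorname{Aut}C_n|=2n$. $\operatorname{Aut}$ includes permutations of vertices and parallel edges and flips/permutations of loops. $\Gamma(g)$ is the set of isomorphism classes of connected graphs with first Betti number $g$ ($=1-|V|+|E|$), and $\mathscr W_g(x)=\sum_{G\in\Gamma(g)}W_G(t)x^{v(G)}/|\operatorname{Aut}G|$, $v(G)$ the number of vertices. Rooted tree series: with sums over isomorphism classes of rooted trees $T$ (root-preserving automorphisms) and colorings $c$, $\mathscr T_w^+$ (resp. $\mathscr T_w^-$, $\mathscr T_b$) is $\sum t^{\#\{\text{white vertices with even count}\}}x^{v(T)}/|\operatorname{Aut}T|$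 over pairs $(T,c)$ whose root is white with an even number of black children (resp. white with an odd number of black children; black). *)

theory Defs
  imports
    "Graph_Theory.Digraph_Component"
    "Graph_Theory.Bidirected_Digraph"
    "HOL-Library.Poly_Mapping"
    "HOL-Computational_Algebra.Computational_Algebra"
    "HOL-Analysis.Infinite_Sum"
begin

section \<open>Graphs with loops and parallel edges\<close>

text \<open>
  A graph is a finite digraph together with a fixed-point free involution of its arcs that
  exchanges tail and head. The arcs are the half-edges (oriented edges), an edge is an orbit
  of the involution, and a loop consists of two distinct arcs with the same tail and head.
\<close>

type_synonym ('v, 'a) mgraph = "('v, 'a) pre_digraph \<times> ('a \<Rightarrow> 'a)"

abbreviation mverts :: "('v, 'a) mgraph \<Rightarrow> 'v set" where
  "mverts K \<equiv> verts (fst K)"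

abbreviation marcs :: "('v, 'a) mgraph \<Rightarrow> 'a set" where
  "marcs K \<equiv> arcs (fst K)"

definition multigraph :: "('v, 'a) mgraph \<Rightarrow> bool" where
  "multigraph K \<longleftrightarrow> fin_digraph (fst K) \<and> bidirected_digraph (fst K) (snd K)"

definition medges :: "('v, 'a) mgraph \<Rightarrow> 'a set set" where
  "medges K = (\<lambda>a. {a, snd K a}) ` marcs K"

definition betti :: "('v, 'a) mgraph \<Rightarrow> int" where
  "betti K = 1 - int (card (mverts K)) + int (card (medges K))"

definition is_iso ::
    "('v, 'a) mgraph \<Rightarrow> ('w, 'b) mgraph \<Rightarrow> ('v \<Rightarrow> 'w) \<Rightarrow> ('a \<Rightarrow> 'b) \<Rightarrow> bool" where
  "is_iso K L f g \<longleftrightarrow>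
     bij_betw f (mverts K) (mverts L) \<and> bij_betw g (marcs K) (marcs L) \<and>
     (\<forall>a\<in>marcs K. tail (fst L) (g a) = f (tail (fst K) a) \<and>
                 head (fst L) (g a) = f (head (fst K) a) \<and>
                 snd L (g a) = g (snd K a))"

text \<open>
  Automorphisms act on vertices and on half-edges; thus flipping a loop, permuting loops at a
  vertex and permuting parallel edges all give nontrivial automorphisms. Requiring
  \<open>permutes\<close> fixes the values outside the carriers, so that each automorphism is
  counted once.
\<close>

definition Aut :: "('v, 'a) mgraph \<Rightarrow> (('v \<Rightarrow> 'v) \<times> ('a \<Rightarrow> 'a)) set" where
  "Aut K = {(f, g). f permutes mverts K \<and> g permutes marcs K \<and> is_iso K K f g}"

text \<open>Every finite graph is isomorphic to one whose vertices and arcs are natural numbers.\<close>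

definition connected_graphs :: "nat \<Rightarrow> (nat, nat) mgraph set" where
  "connected_graphs g =
     {K. multigraph K \<and> Digraph_Component.connected (fst K) \<and> betti K = int g}"

definition graph_iso_rel :: "((nat, nat) mgraph \<times> (nat, nat) mgraph) set" where
  "graph_iso_rel = {(K, L). \<exists>f g. is_iso K L f g}"

definition Gamma :: "nat \<Rightarrow> (nat, nat) mgraph set set" where
  "Gamma g = connected_graphs g // (graph_iso_rel \<inter> connected_graphs g \<times> connected_graphs g)"

definition representative :: "'c set \<Rightarrow> 'c" where
  "representative C = (SOME K. K \<in> C)"

text \<open>For \<open>n = 1\<close> this is a vertex with a loop, for \<open>n = 2\<close> two parallel edges.\<close>

definition cycle_graph :: "nat \<Rightarrow> (nat, nat \<times> bool) mgraph" where
  "cycle_graph n =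
     (\<lparr> verts = {0..<n},
        arcs = {0..<n} \<times> UNIV,
        tail = (\<lambda>(i, d). if d then i else Suc i mod n),
        head = (\<lambda>(i, d). if d then Suc i mod n else i) \<rparr>,
      (\<lambda>(i, d). if i < n then (i, \<not> d) else (i, d)))"


section \<open>Colorings\<close>

definition colorings :: "('v, 'a) mgraph \<Rightarrow> ('v \<Rightarrow> nat) set" where
  "colorings K = mverts K \<rightarrow>\<^sub>E {0, 1}"

text \<open>
  A non-loop edge at \<open>v\<close> contributes exactly one arc with tail \<open>v\<close>.
\<close>

definition black_count :: "('v, 'a) mgraph \<Rightarrow> ('v \<Rightarrow> nat) \<Rightarrow> 'v \<Rightarrow> nat" where
  "black_count K c v =
     card {a \<in> marcs K. tail (fst K) a = v \<and> head (fst K) a \<noteq> v \<and> c (head (fst K) a) = 1}"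

definition black :: "('v, 'a) mgraph \<Rightarrow> ('v \<Rightarrow> nat) \<Rightarrow> 'v set" where
  "black K c = {v \<in> mverts K. c v = 1}"

definition white_even :: "('v, 'a) mgraph \<Rightarrow> ('v \<Rightarrow> nat) \<Rightarrow> 'v set" where
  "white_even K c = {v \<in> mverts K. c v = 0 \<and> even (black_count K c v)}"

definition white_odd :: "('v, 'a) mgraph \<Rightarrow> ('v \<Rightarrow> nat) \<Rightarrow> 'v set" where
  "white_odd K c = {v \<in> mverts K. c v = 0 \<and> odd (black_count K c v)}"


section \<open>The W-polynomials and their generating series\<close>

datatype wvar = Var_b | Var_wplus | Var_wminus

text \<open>
  Polynomials over \<open>rat\<close> in variables \<open>'x\<close> are elements of the monoid ring of the
  monomials \<open>'x \<Rightarrow>\<^sub>0 nat\<close>; power series are arbitrary coefficient functions on monomials.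
\<close>

type_synonym 'x mpolynomial = "('x \<Rightarrow>\<^sub>0 nat) \<Rightarrow>\<^sub>0 rat"
type_synonym 'x mpower_series = "('x \<Rightarrow>\<^sub>0 nat) \<Rightarrow> rat"

definition mvar :: "'x \<Rightarrow> 'x mpolynomial" where
  "mvar v = Poly_Mapping.single (Poly_Mapping.single v 1) 1"

definition full_W :: "('v, 'a) mgraph \<Rightarrow> wvar mpolynomial" where
  "full_W K = (\<Sum>c\<in>colorings K.
     mvar Var_b ^ card (black K c) *
     mvar Var_wplus ^ card (white_even K c) *
     mvar Var_wminus ^ card (white_odd K c))"

text \<open>
  The coefficient ring of the series in \<open>x\<close> has to contain the Laurent polynomials in \<open>t\<close>;
  we use the field of formal Laurent series in \<open>t\<close>.
\<close>

type_synonym t_laurent = "rat fls"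

abbreviation tvar :: t_laurent where
  "tvar \<equiv> fls_X"

definition black_white_W :: "('v, 'a) mgraph \<Rightarrow> t_laurent" where
  "black_white_W K = (\<Sum>c\<in>colorings K. tvar ^ card (white_even K c))"

text \<open>
  The coefficient of \<open>x ^ n\<close> is the sum over the finitely many classes with \<open>n\<close> vertices;
  the summand does not depend on the representative.
\<close>

definition W_series :: "nat \<Rightarrow> t_laurent fps" where
  "W_series g = Abs_fps (\<lambda>n.
     \<Sum>K \<in> representative ` {C \<in> Gamma g. card (mverts (representative C)) = n}.
       black_white_W K / of_nat (card (Aut K)))"


section \<open>Rooted trees\<close>

definition rooted_trees :: "((nat, nat) mgraph \<times> nat) set" where
  "rooted_trees = {(K, r). K \<in> connected_graphs 0 \<and> r \<in> mverts K}"

definition rooted_iso_rel :: "(((nat, nat) mgraph \<times> nat) \<times> ((nat, nat) mgraph \<times> nat)) set" where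
  "rooted_iso_rel = {((K, r), (L, s)). \<exists>f g. is_iso K L f g \<and> f r = s}"

definition rooted_tree_classes :: "((nat, nat) mgraph \<times> nat) set set" where
  "rooted_tree_classes = rooted_trees // (rooted_iso_rel \<inter> rooted_trees \<times> rooted_trees)"

definition rooted_Aut :: "('v, 'a) mgraph \<times> 'v \<Rightarrow> (('v \<Rightarrow> 'v) \<times> ('a \<Rightarrow> 'a)) set" where
  "rooted_Aut = (\<lambda>(K, r). {(f, g) \<in> Aut K. f r = r})"

text \<open>
  The predicate \<open>P\<close> selects the pairs of a rooted tree and a coloring by the color of the
  root and its number of black children. The children of the root are all its neighbors,
  so the latter number is the \<open>black_count\<close> of the root; for every other vertex
  \<open>black_count\<close> also takes the parent into account.
\<close>

definition tree_series :: "(nat \<Rightarrow> nat \<Rightarrow> bool) \<Rightarrow> t_laurent fps" where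
  "tree_series P = Abs_fps (\<lambda>n.
     \<Sum>(K, r) \<in> representative ` {C \<in> rooted_tree_classes.
                                   card (mverts (fst (representative C))) = n}.
       (\<Sum>c \<in> {c \<in> colorings K. P (c r) (black_count K c r)}.
          tvar ^ card (white_even K c) / of_nat (card (rooted_Aut (K, r)))))"

definition T_wplus :: "t_laurent fps" where
  "T_wplus = tree_series (\<lambda>color children. color = 0 \<and> even children)"

definition T_wminus :: "t_laurent fps" where
  "T_wminus = tree_series (\<lambda>color children. color = 0 \<and> odd children)"

definition T_b :: "t_laurent fps" where
  "T_b = tree_series (\<lambda>color children. color = 1)"


section \<open>The cycle series and substitution\<close>

text \<open>
  The sum over \<open>n \<ge> 1\<close> is taken coefficientwise: as the polynomial of the \<open>n\<close>-cycle is
  homogeneous of degree \<open>n\<close>, a given monomial occurs for at most one \<open>n\<close>.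
\<close>

definition cycle_series :: "wvar mpower_series" where
  "cycle_series m =
     (\<Sum>n | 1 \<le> n \<and> Poly_Mapping.lookup (full_W (cycle_graph n)) m \<noteq> 0.
        Poly_Mapping.lookup (full_W (cycle_graph n)) m / of_nat (card (Aut (cycle_graph n))))"

text \<open>
  Substituting \<open>s v\<close> for each variable \<open>v\<close> in the power series \<open>F\<close> is possible with
  result \<open>R\<close>: the sum over all monomials converges unconditionally to \<open>R\<close> in the
  \<open>x\<close>-adic topology, which is the topology of type \<open>fps\<close>.
\<close>

definition has_substitution ::
    "'x mpower_series \<Rightarrow> ('x \<Rightarrow> t_laurent fps) \<Rightarrow> t_laurent fps \<Rightarrow> bool" where
  "has_substitution F s R \<longleftrightarrow>
     ((\<lambda>m. fps_const (of_rat (F m)) *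
           (\<Prod>v\<in>Poly_Mapping.keys m. s v ^ Poly_Mapping.lookup m v)) has_sum R) UNIV"

end

theory Submission
  imports Defs
begin

text \<open>
  Orienting the edges of a connected graph with first Betti number 1 so that every vertex has
  out-degree 1 is possible in exactly two ways, and the oriented graphs are the functional graphs
  of the self-maps with a weakly connected functional graph; similarly a tree with root \<open>r\<close> has exactly
  one orientation towards \<open>r\<close>. This removes the arc labels, and a weighted sum over isomorphism
  classes with weights \<open>1 / |Aut|\<close> becomes a sum over maps of a labelled set, divided by \<open>N!\<close>, and
  also by 2 in the unicyclic case. A connected self-map with a chosen starting point on its cycle,
  which has length \<open>n\<close>, is a rooted forest with an ordered list of \<open>n\<close> roots; dividing by the \<open>n\<close>
  starting points and the 2 orientations gives the factor \<open>1 / |Aut C\<^sub>n|\<close>. Splitting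
  the forest into its trees turns the sum into a product of exponential generating functions.
  The neighbours on the cycle influence a tree only through the parity of the black ones among
  them, added to the count of its root, which yields the three substituted series.
\<close>


section \<open>Connectedness and isomorphisms\<close>

text \<open>An orientation with out-degree 1 names each edge by its tail, so an isomorphism of
  oriented graphs is determined by its action on the vertices. The number of orientations rests on
  one fact: two of them differ exactly on a vertex set that the oriented map permutes. In a rooted
  tree no nonempty set of this kind avoids the root; a connected self-map has only one, its cycle,
  which can be kept or reversed. As arcs are half-edges, reversing a loop or a pair of parallel
  edges changes the orientation although the map on vertices stays the same, so cycles of length 1
  and 2 are no exception.

  The substitution comes from parity. A white root with an even number of black neighbours on the
  cycle keeps the power of \<open>t\<close> that it has in its own tree. If that number is odd, the
  parity of its count flips: a root with an even number of black children loses a factor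
  \<open>t\<close>, and one with an odd number gains it.\<close>

abbreviation mtail :: "('v, 'a) mgraph \<Rightarrow> 'a \<Rightarrow> 'v" where
  "mtail K \<equiv> tail (fst K)"

abbreviation mhead :: "('v, 'a) mgraph \<Rightarrow> 'a \<Rightarrow> 'v" where
  "mhead K \<equiv> head (fst K)"

lemma multigraph_iff:
  "multigraph K \<longleftrightarrow> finite (mverts K) \<and> finite (marcs K) \<and>
     (\<forall>a\<in>marcs K. mtail K a \<in> mverts K \<and> mhead K a \<in> mverts K \<and> snd K a \<in> marcs K \<and> snd K a \<noteq> a \<and>
        snd K (snd K a) = a \<and> mtail K (snd K a) = mhead K a \<and> mhead K (snd K a) = mtail K a) \<and>
     (\<forall>a. a \<notin> marcs K \<longrightarrow> snd K a = a)" (is "_ \<longleftrightarrow> ?R")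
proof
  assume "multigraph K"
  then interpret G: bidirected_digraph "fst K" "snd K" + F: fin_digraph "fst K"
    by (auto simp: multigraph_def)
  show ?R
    by (auto simp: G.arev_neq G.arev_eq)
next
  assume R: ?R
  then interpret F: fin_digraph "fst K"
    by unfold_locales auto
  have "bidirected_digraph (fst K) (snd K)"
    using R by (intro F.bidirected_digraphI) auto
  then show "multigraph K"
    using F.fin_digraph_axioms by (auto simp: multigraph_def)
qed

lemma multigraphD:
  assumes "multigraph K"
  shows "finite (mverts K)" "finite (marcs K)"
    "a \<in> marcs K \<Longrightarrow> mtail K a \<in> mverts K" "a \<in> marcs K \<Longrightarrow> mhead K a \<in> mverts K"
    "a \<in> marcs K \<Longrightarrow> snd K a \<in> marcs K" "a \<in> marcs K \<Longrightarrow> snd K a \<noteq> a"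
    "snd K (snd K a) = a"
    "a \<in> marcs K \<Longrightarrow> mtail K (snd K a) = mhead K a"
    "a \<in> marcs K \<Longrightarrow> mhead K (snd K a) = mtail K a"
    "a \<notin> marcs K \<Longrightarrow> snd K a = a"
  using assms unfolding multigraph_iff by (blast, blast, blast, blast, blast, blast, metis, blast, blast, blast)

text \<open>Walks are replaced by closed vertex sets: the vertices reachable from a given one form a
  closed set, and reversal of arcs makes reachability symmetric. Later connectivity proofs only have
  to name a suitable set.\<close>

lemma connected_iff_closed:
  assumes "multigraph K"
  shows "Digraph_Component.connected (fst K) \<longleftrightarrow> mverts K \<noteq> {} \<and>
    (\<forall>A\<subseteq>mverts K. A \<noteq> {} \<longrightarrow> (\<forall>a\<in>marcs K. mtail K a \<in> A \<longrightarrow> mhead K a \<in> A) \<longrightarrow> A = mverts K)"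
    (is "_ \<longleftrightarrow> ?R")
proof -
  interpret G: bidirected_digraph "fst K" "snd K"
    using assms by (auto simp: multigraph_def)
  have sym: "symmetric (fst K)"
    unfolding symmetric_def arcs_ends_def arc_to_ends_def
  proof (rule symI)
    fix x y assume "(x, y) \<in> (\<lambda>e. (mtail K e, mhead K e)) ` marcs K"
    then obtain a where "a \<in> marcs K" "x = mtail K a" "y = mhead K a" by blast
    then show "(y, x) \<in> (\<lambda>e. (mtail K e, mhead K e)) ` marcs K"
      by (intro image_eqI[of _ _ "snd K a"]) simp_all
  qed
  have reach: "Digraph_Component.connected (fst K) \<longleftrightarrow>
      mverts K \<noteq> {} \<and> (\<forall>u\<in>mverts K. \<forall>v\<in>mverts K. u \<rightarrow>\<^sup>*\<^bsub>fst K\<^esub> v)"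
    using G.reachable_mk_symmetric_eq[OF sym]
    by (auto simp: Digraph_Component.connected_def strongly_connected_def)
  show ?thesis
  proof
    assume c: "Digraph_Component.connected (fst K)"
    have "A = mverts K" if A: "A \<subseteq> mverts K" "A \<noteq> {}"
      and cl: "\<forall>a\<in>marcs K. mtail K a \<in> A \<longrightarrow> mhead K a \<in> A" for A
    proof -
      obtain u where u: "u \<in> A" using A by auto
      have "v \<in> A" if "v \<in> mverts K" for v
      proof -
        have "u \<rightarrow>\<^sup>*\<^bsub>fst K\<^esub> v" using c that u A by (auto simp: reach)
        then show "v \<in> A"
          by (induction rule: G.reachable_induct) (use u cl in \<open>auto\<close>)
      qed
      then show ?thesis using A by blast
    qed
    then show ?R using c by (auto simp: reach)
  next
    assume R: ?R
    have "u \<rightarrow>\<^sup>*\<^bsub>fst K\<^esub> v" if "u \<in> mverts K" "v \<in> mverts K" for u v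
    proof -
      define A where "A = {w \<in> mverts K. u \<rightarrow>\<^sup>*\<^bsub>fst K\<^esub> w}"
      have "u \<in> A" using that by (auto simp: A_def)
      moreover have "\<forall>a\<in>marcs K. mtail K a \<in> A \<longrightarrow> mhead K a \<in> A"
        by (auto simp: A_def intro: G.reachable_adj_trans G.in_arcs_imp_in_arcs_ends)
      moreover have "A \<subseteq> mverts K" by (auto simp: A_def)
      ultimately have "A = mverts K" using R by blast
      then show ?thesis using that by (auto simp: A_def)
    qed
    then show "Digraph_Component.connected (fst K)" using R by (auto simp: reach)
  qed
qed

lemma connected_closedD:
  assumes "multigraph K" "Digraph_Component.connected (fst K)" "A \<subseteq> mverts K" "A \<noteq> {}"
    and "\<And>a. a \<in> marcs K \<Longrightarrow> mtail K a \<in> A \<Longrightarrow> mhead K a \<in> A"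
  shows "A = mverts K"
  using assms(2-) unfolding connected_iff_closed[OF assms(1)] by simp

lemma connected_nonempty:
  assumes "multigraph K" "Digraph_Component.connected (fst K)"
  shows "mverts K \<noteq> {}"
  using assms by (simp add: connected_iff_closed)

lemma connected_closedI:
  assumes "multigraph K" "mverts K \<noteq> {}"
    and "\<And>A. A \<subseteq> mverts K \<Longrightarrow> A \<noteq> {} \<Longrightarrow>
      (\<And>a. a \<in> marcs K \<Longrightarrow> mtail K a \<in> A \<Longrightarrow> mhead K a \<in> A) \<Longrightarrow> A = mverts K"
  shows "Digraph_Component.connected (fst K)"
  unfolding connected_iff_closed[OF assms(1)] using assms(2,3) by simp

lemma is_isoD:
  assumes "is_iso K L f g"
  shows "bij_betw f (mverts K) (mverts L)" "bij_betw g (marcs K) (marcs L)"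
    "a \<in> marcs K \<Longrightarrow> mtail L (g a) = f (mtail K a)"
    "a \<in> marcs K \<Longrightarrow> mhead L (g a) = f (mhead K a)"
    "a \<in> marcs K \<Longrightarrow> snd L (g a) = g (snd K a)"
    "v \<in> mverts K \<Longrightarrow> f v \<in> mverts L" "a \<in> marcs K \<Longrightarrow> g a \<in> marcs L"
  using assms bij_betw_apply[of f "mverts K" "mverts L"] bij_betw_apply[of g "marcs K" "marcs L"]
  by (simp_all add: is_iso_def)

lemma is_iso_refl: "is_iso K K id id"
  by (simp add: is_iso_def)

lemma is_iso_trans:
  assumes "is_iso K L f g" "is_iso L M f' g'"
  shows "is_iso K M (f' \<circ> f) (g' \<circ> g)"
  using is_isoD[OF assms(1)] is_isoD[OF assms(2)] bij_betw_trans[of f "mverts K" "mverts L" f']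
    bij_betw_trans[of g "marcs K" "marcs L" g']
  by (simp add: is_iso_def)

lemma is_iso_sym:
  assumes K: "multigraph K" and iso: "is_iso K L f g"
  shows "is_iso L K (inv_into (mverts K) f) (inv_into (marcs K) g)"
proof -
  note iso' = is_isoD[OF iso]
  have "mtail K (inv_into (marcs K) g b) = inv_into (mverts K) f (mtail L b)
      \<and> mhead K (inv_into (marcs K) g b) = inv_into (mverts K) f (mhead L b)
      \<and> snd K (inv_into (marcs K) g b) = inv_into (marcs K) g (snd L b)" if b: "b \<in> marcs L" for b
  proof -
    obtain a where a: "a \<in> marcs K" "b = g a"
      using b bij_betw_imp_surj_on[OF iso'(2)] by blast
    then show ?thesis
      using iso'(3-5)[OF a(1)] multigraphD(3-5)[OF K a(1)] iso'(1,2)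
      by (simp add: bij_betw_inv_into_left)
  qed
  then show ?thesis
    using iso'(1,2) by (auto simp: is_iso_def bij_betw_inv_into)
qed

lemma card_marcs:
  assumes "multigraph K"
  shows "card (marcs K) = 2 * card (medges K)"
proof -
  note K = multigraphD[OF assms]
  have "2 * card (medges K) = card (\<Union>(medges K))"
  proof (rule card_partition)
    show "finite (medges K)" using K by (auto simp: medges_def)
    show "finite (\<Union>(medges K))" using K by (auto simp: medges_def)
    show "card c = 2" if "c \<in> medges K" for c
      using that using K(6) by (fastforce simp: medges_def card_insert_if)
    show "c1 \<inter> c2 = {}" if c12: "c1 \<in> medges K" "c2 \<in> medges K" "c1 \<noteq> c2" for c1 c2
    proof -
      obtain a b where ab: "c1 = {a, snd K a}" "c2 = {b, snd K b}"
        using c12 by (auto simp: medges_def)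
      have "c1 = c2" if "a = b \<or> a = snd K b \<or> snd K a = b \<or> snd K a = snd K b"
        using that ab K(7)[of a] K(7)[of b] by (metis insert_commute)
      then show ?thesis using c12 ab by blast
    qed
  qed
  moreover have "\<Union>(medges K) = marcs K"
    using K(5) by (auto simp: medges_def)
  ultimately show ?thesis by simp
qed

text \<open>Counting half-edges, two per edge, clears the subtraction in
  \<open>betti\<close>.\<close>

lemma betti_eq_iff:
  assumes "multigraph K"
  shows "betti K = int g \<longleftrightarrow> card (marcs K) + 2 = 2 * (card (mverts K) + g)"
  using card_marcs[OF assms] by (auto simp: betti_def)

lemma is_iso_card:
  assumes "is_iso K L f g"
  shows "card (mverts K) = card (mverts L)" "card (marcs K) = card (marcs L)"
  using is_isoD(1,2)[OF assms] by (simp_all add: bij_betw_same_card)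

lemma is_iso_connected:
  assumes K: "multigraph K" and L: "multigraph L" and iso: "is_iso K L f g"
    and conn: "Digraph_Component.connected (fst K)"
  shows "Digraph_Component.connected (fst L)"
proof (rule connected_closedI[OF L])
  note iso' = is_isoD[OF iso]
  have img: "f ` mverts K = mverts L" using iso'(1) by (simp add: bij_betw_def)
  show "mverts L \<noteq> {}" using connected_nonempty[OF K conn] img by blast
  fix A assume A: "A \<subseteq> mverts L" "A \<noteq> {}"
    and cl: "\<And>a. a \<in> marcs L \<Longrightarrow> mtail L a \<in> A \<Longrightarrow> mhead L a \<in> A"
  define B where "B = {v \<in> mverts K. f v \<in> A}"
  have "B = mverts K"
  proof (rule connected_closedD[OF K conn])
    show "B \<subseteq> mverts K" by (auto simp: B_def)
    obtain x where "x \<in> A" using A(2) by blast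
    moreover from this have "x \<in> f ` mverts K" using A(1) img by auto
    ultimately show "B \<noteq> {}" by (auto simp: B_def)
    fix a assume "a \<in> marcs K" "mtail K a \<in> B"
    then show "mhead K a \<in> B"
      using cl[of "g a"] iso'(3,4,7)[of a] multigraphD(4)[OF K, of a] by (simp add: B_def)
  qed
  then have "\<forall>v\<in>mverts K. f v \<in> A" by (auto simp: B_def)
  then have "mverts L \<subseteq> A" unfolding img[symmetric] by auto
  then show "A = mverts L" using A(1) by simp
qed

text \<open>Only the names of arcs change. This moves \<open>fgraph\<close>, whose arcs are pairs,
  into the type of graphs from which isomorphism classes are formed.\<close>

lemma is_iso_multigraph_image:
  fixes L :: "('v, 'a) mgraph" and \<beta> :: "'a \<Rightarrow> 'b"
  assumes L: "multigraph L" and inj: "inj_on \<beta> (marcs L)"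
  obtains K :: "('v, 'b) mgraph" where "multigraph K" "mverts K = mverts L" "is_iso L K id \<beta>"
proof -
  define i where "i = inv_into (marcs L) \<beta>"
  define K :: "('v, 'b) mgraph" where "K =
    (\<lparr>verts = mverts L, arcs = \<beta> ` marcs L, tail = mtail L \<circ> i, head = mhead L \<circ> i\<rparr>,
     (\<lambda>b. if b \<in> \<beta> ` marcs L then \<beta> (snd L (i b)) else b))"
  have i: "i (\<beta> a) = a" if "a \<in> marcs L" for a
    using that inj by (simp add: i_def)
  note L' = multigraphD[OF L]
  have "multigraph K"
    unfolding multigraph_iff using L' inj i
    by (auto simp: K_def inj_on_eq_iff)
  moreover have "is_iso L K id \<beta>"
    using inj L' i by (auto simp: is_iso_def K_def inj_on_imp_bij_betw)
  ultimately show ?thesis using that[of K] by (simp add: K_def)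
qed

section \<open>Invariance of black counts and colorings under isomorphism\<close>

lemma black_count_iso:
  assumes K: "multigraph K" and iso: "is_iso K L f g" and v: "v \<in> mverts K"
    and c: "\<And>u. u \<in> mverts K \<Longrightarrow> c u = c' (f u)"
  shows "black_count K c v = black_count L c' (f v)"
proof -
  note iso' = is_isoD[OF iso] and K' = multigraphD[OF K]
  have inj: "inj_on f (mverts K)" using iso'(1) by (simp add: bij_betw_def)
  let ?A = "{a \<in> marcs K. mtail K a = v \<and> mhead K a \<noteq> v \<and> c (mhead K a) = 1}"
  let ?B = "{a \<in> marcs L. mtail L a = f v \<and> mhead L a \<noteq> f v \<and> c' (mhead L a) = 1}"
  have "bij_betw g ?A ?B"
  proof (rule bij_betw_subset[OF iso'(2), of ?A ?B])
    show "g ` ?A = ?B"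
    proof (intro equalityI subsetI)
      fix b assume "b \<in> g ` ?A"
      then obtain a where a: "a \<in> ?A" "b = g a" by blast
      then show "b \<in> ?B"
        using iso'(3,4,7)[of a] K'(4)[of a] c[of "mhead K a"] inj_on_eq_iff[OF inj _ v] by simp
    next
      fix b assume b: "b \<in> ?B"
      then obtain a where a: "a \<in> marcs K" "b = g a"
        using bij_betw_imp_surj_on[OF iso'(2)] by blast
      have "a \<in> ?A"
        using a b iso'(3,4)[OF a(1)] K'(3,4)[OF a(1)] c[of "mhead K a"] inj_on_eq_iff[OF inj _ v] by auto
      then show "b \<in> g ` ?A"
        using a by blast
    qed
  qed auto
  then show ?thesis
    unfolding black_count_def by (rule bij_betw_same_card)
qed

text \<open>Numerator of the summands in \<open>tree_series\<close>; with the trivial predicate it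
  is \<open>black_white_W\<close>, so one invariance lemma serves both series.\<close>

definition colored_sum :: "(nat \<Rightarrow> nat \<Rightarrow> bool) \<Rightarrow> ('v, 'a) mgraph \<Rightarrow> 'v \<Rightarrow> t_laurent" where
  "colored_sum P K r =
     (\<Sum>c \<in> {c \<in> colorings K. P (c r) (black_count K c r)}. tvar ^ card (white_even K c))"

text \<open>Colorings are transported by composition with \<open>f\<close> and its inverse, cut back
  to the vertex sets to stay extensional. Black counts agree at corresponding vertices, so
  \<open>f\<close> maps one \<open>white_even\<close> set onto the other.\<close>

lemma colored_sum_iso:
  assumes K: "multigraph K" and iso: "is_iso K L f g" and r: "r \<in> mverts K"
  shows "colored_sum P K r = colored_sum P L (f r)"
proof -
  note iso' = is_isoD[OF iso] and K' = multigraphD[OF K]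
  define i where "i = inv_into (mverts K) f"
  have i: "i (f v) = v" if "v \<in> mverts K" for v
    using that iso'(1) by (simp add: i_def bij_betw_inv_into_left)
  have i': "f (i v) = v" "i v \<in> mverts K" if "v \<in> mverts L" for v
    using that iso'(1) by (auto simp: i_def bij_betw_inv_into_right bij_betw_def inv_into_into)
  define F where "F = (\<lambda>c. restrict (c \<circ> f) (mverts K) :: 'a \<Rightarrow> nat)"
  define G where "G = (\<lambda>c. restrict (c \<circ> i) (mverts L) :: 'c \<Rightarrow> nat)"
  have bc: "black_count K (F c) v = black_count L c (f v)" if "v \<in> mverts K" for c v
    by (rule black_count_iso[OF K iso that]) (simp add: F_def)
  have we: "card (white_even K (F c)) = card (white_even L c)" for c
  proof -
    have "bij_betw f (white_even K (F c)) (white_even L c)"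
    proof (rule bij_betw_subset[OF iso'(1)])
      show "f ` white_even K (F c) = white_even L c"
      proof (intro equalityI subsetI)
        fix w assume "w \<in> f ` white_even K (F c)"
        then show "w \<in> white_even L c"
          using iso'(6) bc by (auto simp: white_even_def F_def)
      next
        fix w assume w: "w \<in> white_even L c"
        then have "i w \<in> white_even K (F c)"
          using bc[of "i w" c] i'[of w] by (simp add: white_even_def F_def)
        moreover have "w = f (i w)"
          using w i'[of w] by (simp add: white_even_def)
        ultimately show "w \<in> f ` white_even K (F c)" by blast
      qed
    qed (auto simp: white_even_def)
    then show ?thesis by (rule bij_betw_same_card)
  qed
  have GF: "F (G c) = c" if "c \<in> colorings K" for c
  proof (rule ext)
    show "F (G c) v = c v" for v
      using that iso'(6)[of v] i[of v]
      by (cases "v \<in> mverts K") (simp_all add: F_def G_def colorings_def PiE_arb[of c "mverts K"])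
  qed
  have FG: "G (F c) = c" if "c \<in> colorings L" for c
  proof (rule ext)
    show "G (F c) v = c v" for v
      using that i'[of v]
      by (cases "v \<in> mverts L") (simp_all add: F_def G_def colorings_def PiE_arb[of c "mverts L"])
  qed
  show ?thesis
    unfolding colored_sum_def
  proof (rule sum.reindex_bij_witness[where i = F and j = G])
    fix c assume c: "c \<in> {c \<in> colorings K. P (c r) (black_count K c r)}"
    show eq: "F (G c) = c" using c GF by auto
    have "c u \<in> {0, 1}" if "u \<in> mverts K" for u
      using c that by (intro PiE_mem[of c "mverts K"]) (simp_all add: colorings_def)
    then have "G c \<in> colorings L"
      unfolding G_def colorings_def restrict_PiE_iff comp_def using i' by blast
    moreover have "G c (f r) = c r"
      using r iso'(6) by (simp add: G_def i)
    ultimately show "G c \<in> {c \<in> colorings L. P (c (f r)) (black_count L c (f r))}"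
      using c bc[OF r, of "G c"] by (simp add: eq)
    show "tvar ^ card (white_even L (G c)) = tvar ^ card (white_even K c)"
      using we[of "G c"] eq by simp
  next
    fix c assume c: "c \<in> {c \<in> colorings L. P (c (f r)) (black_count L c (f r))}"
    show "G (F c) = c"
      using c FG by auto
    have "c u \<in> {0, 1}" if "u \<in> mverts L" for u
      using c that by (intro PiE_mem[of c "mverts L"]) (simp_all add: colorings_def)
    then have "F c \<in> colorings K"
      unfolding F_def colorings_def restrict_PiE_iff comp_def using iso'(6) by blast
    moreover have "F c r = c (f r)"
      using r by (simp add: F_def)
    ultimately show "F c \<in> {c \<in> colorings K. P (c r) (black_count K c r)}"
      using c bc[OF r, of c] by simp
  qed
qed


section \<open>Labelled graphs and orientations\<close>

text \<open>
  Only the values of \<open>g\<close> on \<open>S - Q\<close> matter: the arc \<open>(v, True)\<close> leads from \<open>v\<close> to \<open>g v\<close>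
  and \<open>(v, False)\<close> is its reverse.
\<close>

definition fgraph :: "'v set \<Rightarrow> 'v set \<Rightarrow> ('v \<Rightarrow> 'v) \<Rightarrow> ('v, 'v \<times> bool) mgraph" where
  "fgraph S Q g =
     (\<lparr> verts = S,
        arcs = (S - Q) \<times> UNIV,
        tail = (\<lambda>(v, d). if d then v else g v),
        head = (\<lambda>(v, d). if d then g v else v) \<rparr>,
      (\<lambda>(v, d). if v \<in> S - Q then (v, \<not> d) else (v, d)))"

lemma fgraph_simps [simp]:
  "mverts (fgraph S Q g) = S"
  "marcs (fgraph S Q g) = (S - Q) \<times> UNIV"
  "mtail (fgraph S Q g) (v, d) = (if d then v else g v)"
  "mhead (fgraph S Q g) (v, d) = (if d then g v else v)"
  "v \<in> S \<Longrightarrow> v \<notin> Q \<Longrightarrow> snd (fgraph S Q g) (v, d) = (v, \<not> d)"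
  by (simp_all add: fgraph_def)

lemma multigraph_fgraph:
  assumes "finite S" "g \<in> S - Q \<rightarrow> S"
  shows "multigraph (fgraph S Q g)"
  unfolding multigraph_iff using assms by (auto simp: fgraph_def split: if_splits)

lemma cycle_graph_eq_fgraph: "cycle_graph n = fgraph {0..<n} {} (\<lambda>i. Suc i mod n)"
  by (auto simp: cycle_graph_def fgraph_def fun_eq_iff)

lemma card_marcs_fgraph: "finite S \<Longrightarrow> card (marcs (fgraph S Q g)) = 2 * card (S - Q)"
  by (simp add: card_cartesian_product)

text \<open>Between different carriers a map cannot be normalized to be the identity outside, so
  extensionality takes the place of \<open>permutes\<close>. The sets \<open>Q\<close> and
  \<open>R\<close> hold the roots: empty for unicyclic graphs, singletons for rooted trees.\<close>

definition isos_on :: "('v, 'a) mgraph \<Rightarrow> 'v set \<Rightarrow> ('w, 'b) mgraph \<Rightarrow> 'w set \<Rightarrow>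
    (('v \<Rightarrow> 'w) \<times> ('a \<Rightarrow> 'b)) set" where
  "isos_on L Q K R = {(f, k). f \<in> extensional (mverts L) \<and> k \<in> extensional (marcs L) \<and>
     is_iso L K f k \<and> f ` Q = R}"

definition Aut_on :: "('v, 'a) mgraph \<Rightarrow> 'v set \<Rightarrow> (('v \<Rightarrow> 'v) \<times> ('a \<Rightarrow> 'a)) set" where
  "Aut_on K R = {(f, k) \<in> Aut K. f ` R = R}"

lemma is_iso_cong:
  assumes K: "multigraph K"
    and "\<And>v. v \<in> mverts K \<Longrightarrow> f v = f' v" "\<And>a. a \<in> marcs K \<Longrightarrow> g a = g' a"
  shows "is_iso K L f g \<longleftrightarrow> is_iso K L f' g'"
proof -
  have "bij_betw f (mverts K) (mverts L) = bij_betw f' (mverts K) (mverts L)"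
    "bij_betw g (marcs K) (marcs L) = bij_betw g' (marcs K) (marcs L)"
    using assms by (auto intro!: bij_betw_cong)
  then show ?thesis
    using assms(2,3) multigraphD(3-5)[OF K] by (simp add: is_iso_def)
qed

text \<open>Composition with one fixed isomorphism \<open>f0\<close>, \<open>k0\<close> identifies
  the automorphisms of \<open>K\<close> with the isomorphisms from \<open>L\<close> to
  \<open>K\<close>; what remains is to convert the conventions for values outside the
  carriers.\<close>

lemma card_isos_on:
  fixes K :: "('v, 'a) mgraph" and L :: "('w, 'b) mgraph"
  assumes K: "multigraph K" and L: "multigraph L" and sub: "Q \<subseteq> mverts L" "R \<subseteq> mverts K"
    and ne: "isos_on L Q K R \<noteq> {}"
  shows "card (isos_on L Q K R) = card (Aut_on K R)"
proof -
  obtain f0 k0 where iso0: "is_iso L K f0 k0" and Q0: "f0 ` Q = R"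
    using ne by (auto simp: isos_on_def)
  note iso' = is_isoD[OF iso0]
  define fi where "fi = inv_into (mverts L) f0"
  define ki where "ki = inv_into (marcs L) k0"
  have isoi: "is_iso K L fi ki"
    unfolding fi_def ki_def by (rule is_iso_sym[OF L iso0])
  note isoi' = is_isoD[OF isoi]
  have fi: "f0 (fi v) = v" if "v \<in> mverts K" for v
    using that iso'(1) by (simp add: fi_def bij_betw_inv_into_right)
  have fi2: "fi (f0 v) = v" if "v \<in> mverts L" for v
    using that iso'(1) by (simp add: fi_def bij_betw_inv_into_left)
  have ki: "k0 (ki a) = a" if "a \<in> marcs K" for a
    using that iso'(2) by (simp add: ki_def bij_betw_inv_into_right)
  have ki2: "ki (k0 a) = a" if "a \<in> marcs L" for a
    using that iso'(2) by (simp add: ki_def bij_betw_inv_into_left)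
  have QR: "fi ` R = Q"
    unfolding Q0[symmetric] image_image using sub(1) fi2 by (auto simp: image_iff subset_iff)
  define F :: "('v \<Rightarrow> 'v) \<times> ('a \<Rightarrow> 'a) \<Rightarrow> ('w \<Rightarrow> 'v) \<times> ('b \<Rightarrow> 'a)"
    where "F = (\<lambda>(a, b). (restrict (a \<circ> f0) (mverts L), restrict (b \<circ> k0) (marcs L)))"
  define G where "G = (\<lambda>(f, k). (\<lambda>v. if v \<in> mverts K then f (fi v) else v, \<lambda>a. if a \<in> marcs K then k (ki a) else a))"
  have GF: "G (F (a, b)) = (a, b)" and Fin: "F (a, b) \<in> isos_on L Q K R" if "(a, b) \<in> Aut_on K R" for a b
  proof -
    have perm: "a permutes mverts K" "b permutes marcs K" and iso: "is_iso K K a b" and aR: "a ` R = R"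
      using that by (auto simp: Aut_on_def Aut_def)
    show "G (F (a, b)) = (a, b)"
      using fi ki isoi'(6,7) permutes_not_in[OF perm(1)] permutes_not_in[OF perm(2)]
      by (simp add: F_def G_def fun_eq_iff)
    have "is_iso L K (restrict (a \<circ> f0) (mverts L)) (restrict (b \<circ> k0) (marcs L))"
      using is_iso_trans[OF iso0 iso] by (subst is_iso_cong[OF L]) auto
    moreover have "restrict (a \<circ> f0) (mverts L) ` Q = (a \<circ> f0) ` Q"
      using sub(1) by (intro image_cong) auto
    then have "restrict (a \<circ> f0) (mverts L) ` Q = R"
      unfolding image_comp[symmetric] Q0 aR .
    ultimately show "F (a, b) \<in> isos_on L Q K R"
      by (simp add: isos_on_def F_def)
  qed
  have FG: "F (G (f, k)) = (f, k)" and Gin: "G (f, k) \<in> Aut_on K R" if "(f, k) \<in> isos_on L Q K R" for f k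
  proof -
    have iso: "is_iso L K f k" and fQ: "f ` Q = R" and ext: "f \<in> extensional (mverts L)" "k \<in> extensional (marcs L)"
      using that by (auto simp: isos_on_def)
    show "F (G (f, k)) = (f, k)"
      using fi2 ki2 iso'(6,7) extensional_arb[OF ext(1)] extensional_arb[OF ext(2)]
      by (simp add: F_def G_def fun_eq_iff)
    obtain a b where ab: "G (f, k) = (a, b)" by fastforce
    have eq: "a v = f (fi v)" if "v \<in> mverts K" for v
      using that ab by (auto simp: G_def)
    have eq': "b e = k (ki e)" if "e \<in> marcs K" for e
      using that ab by (auto simp: G_def)
    have iso2: "is_iso K K a b"
      using is_iso_trans[OF isoi iso] eq eq' by (subst is_iso_cong[OF K]) auto
    have "a permutes mverts K" "b permutes marcs K"
      using is_isoD(1,2)[OF iso2] ab by (auto intro!: bij_imp_permutes simp: G_def)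
    moreover have "a ` R = f ` fi ` R"
      unfolding image_image using sub(2) eq by (intro image_cong) auto
    then have "a ` R = R" using QR fQ by simp
    ultimately show "G (f, k) \<in> Aut_on K R"
      using iso2 ab by (simp add: Aut_on_def Aut_def)
  qed
  have "bij_betw F (Aut_on K R) (isos_on L Q K R)"
  proof (rule bij_betwI[where g = G])
    show "F \<in> Aut_on K R \<rightarrow> isos_on L Q K R" using Fin by (intro Pi_I) (metis surj_pair)
    show "G \<in> isos_on L Q K R \<rightarrow> Aut_on K R" using Gin by (intro Pi_I) (metis surj_pair)
    show "G (F x) = x" if "x \<in> Aut_on K R" for x using that GF by (metis surj_pair)
    show "F (G x) = x" if "x \<in> isos_on L Q K R" for x using that FG by (metis surj_pair)
  qed
  then show ?thesis by (metis bij_betw_same_card)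
qed

lemma card_bij_PiE:
  assumes "finite S" "finite V" "card S = card V"
  shows "card {f \<in> S \<rightarrow>\<^sub>E V. bij_betw f S V} = fact (card S)"
proof -
  have "{f \<in> S \<rightarrow>\<^sub>E V. bij_betw f S V} = {f \<in> S \<rightarrow>\<^sub>E V. inj_on f S}"
  proof (intro Collect_cong conj_cong refl iffI)
    fix f assume "f \<in> S \<rightarrow>\<^sub>E V" "inj_on f S"
    then show "bij_betw f S V"
      using assms by (intro bij_betw_imageI card_subset_eq) (auto simp: card_image)
  qed (auto simp: bij_betw_def)
  then show ?thesis
    using card_inj_on_subset_funcset[of S V S] assms by (simp add: fact_prod_rev)
qed

text \<open>Outside \<open>R\<close> every vertex has out-degree 1, inside \<open>R\<close> it has out-degree 0.\<close>

definition orientations :: "('v, 'a) mgraph \<Rightarrow> 'v set \<Rightarrow> ('v \<Rightarrow> 'a) set" where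
  "orientations K R = {h \<in> (mverts K - R) \<rightarrow>\<^sub>E marcs K.
     (\<forall>v \<in> mverts K - R. mtail K (h v) = v) \<and>
     h ` (mverts K - R) \<union> snd K ` h ` (mverts K - R) = marcs K \<and>
     h ` (mverts K - R) \<inter> snd K ` h ` (mverts K - R) = {}}"

lemma card_Aut_on_pos:
  assumes "multigraph K"
  shows "card (Aut_on K R) > 0"
proof -
  have "Aut_on K R \<subseteq> {f. f permutes mverts K} \<times> {k. k permutes marcs K}"
    by (auto simp: Aut_on_def Aut_def)
  then have "finite (Aut_on K R)"
    using multigraphD(1,2)[OF assms] by (elim finite_subset) (intro finite_cartesian_product finite_permutations)
  moreover have "(id, id) \<in> Aut_on K R"
    using is_iso_refl by (simp add: Aut_on_def Aut_def permutes_id)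
  ultimately show ?thesis by (auto simp: card_gt_0_iff)
qed

text \<open>
  Double counting: a bijection from \<open>S\<close> to the vertices of \<open>K\<close> together with an orientation of \<open>K\<close>
  is the same as a map on \<open>S\<close> together with an isomorphism from its graph to \<open>K\<close>.
\<close>

lemma card_labelled:
  fixes K :: "('v, 'a) mgraph" and S :: "'w set"
  assumes K: "multigraph K" and R: "R \<subseteq> mverts K" and S: "finite S" "card S = card (mverts K)"
  shows "card {(Q, g). Q \<subseteq> S \<and> g \<in> (S - Q) \<rightarrow>\<^sub>E S \<and> isos_on (fgraph S Q g) Q K R \<noteq> {}} * card (Aut_on K R)
    = fact (card S) * card (orientations K R)"
proof -
  note K' = multigraphD[OF K]
  let ?V = "mverts K"
  define X where "X = {(Q, g). Q \<subseteq> S \<and> g \<in> (S - Q) \<rightarrow>\<^sub>E S}"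
  define I where "I = (\<lambda>(Q, g). isos_on (fgraph S Q g) Q K R)"
  define B where "B = {f \<in> S \<rightarrow>\<^sub>E ?V. bij_betw f S ?V}"
  \<comment> \<open>The orientation sends \<open>v\<close> to the image of the \<open>True\<close>
    arc at the preimage of \<open>v\<close>. Conversely, \<open>\<Psi>\<close> recovers
    \<open>Q\<close> as the preimage of \<open>R\<close>, and the map by pulling back the head of
    the chosen arc.\<close>
  define \<Phi> :: "('w set \<times> ('w \<Rightarrow> 'w)) \<times> ('w \<Rightarrow> 'v) \<times> ('w \<times> bool \<Rightarrow> 'a) \<Rightarrow> ('w \<Rightarrow> 'v) \<times> ('v \<Rightarrow> 'a)"
    where "\<Phi> = (\<lambda>((Q, g), (f, k)). (f, \<lambda>v\<in>?V - R. k (inv_into S f v, True)))"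
  define \<Psi> :: "('w \<Rightarrow> 'v) \<times> ('v \<Rightarrow> 'a) \<Rightarrow> ('w set \<times> ('w \<Rightarrow> 'w)) \<times> ('w \<Rightarrow> 'v) \<times> ('w \<times> bool \<Rightarrow> 'a)"
    where "\<Psi> = (\<lambda>(f, h). (({s\<in>S. f s \<in> R}, \<lambda>s\<in>S - {s\<in>S. f s \<in> R}. inv_into S f (mhead K (h (f s)))),
      (f, \<lambda>(s, d)\<in>(S - {s\<in>S. f s \<in> R}) \<times> UNIV. if d then h (f s) else snd K (h (f s)))))"
  have finX: "finite X"
  proof -
    have "X = (SIGMA Q : Pow S. (S - Q) \<rightarrow>\<^sub>E S)" by (auto simp: X_def)
    then show ?thesis using S by (auto intro!: finite_SigmaI finite_PiE)
  qed
  have fwd: "\<Phi> ((Q, g), (f, k)) \<in> B \<times> orientations K R \<and> \<Psi> (\<Phi> ((Q, g), (f, k))) = ((Q, g), (f, k))"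
    if "(Q, g) \<in> X" "(f, k) \<in> I (Q, g)" for Q g f k
  proof -
    have Q: "Q \<subseteq> S" and g: "g \<in> (S - Q) \<rightarrow>\<^sub>E S" using that by (auto simp: X_def)
    have iso: "is_iso (fgraph S Q g) K f k" and fQ: "f ` Q = R"
      and extn: "f \<in> extensional S" "k \<in> extensional ((S - Q) \<times> UNIV)"
      using that by (auto simp: I_def isos_on_def)
    note iso' = is_isoD[OF iso, simplified]
    define i where "i = inv_into S f"
    have i: "i (f s) = s" if "s \<in> S" for s
      using that iso'(1) by (simp add: i_def bij_betw_inv_into_left)
    have i': "f (i v) = v" "i v \<in> S" if "v \<in> ?V" for v
      using that iso'(1) bij_betw_imp_surj_on[OF iso'(1)]
      by (auto simp: i_def bij_betw_inv_into_right inv_into_into)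
    have fR: "f s \<in> R \<longleftrightarrow> s \<in> Q" if "s \<in> S" for s
      using that Q i fQ by (metis image_iff subsetD)
    have Q_eq: "{s\<in>S. f s \<in> R} = Q" using fR Q by auto
    have gS: "g s \<in> S" if "s \<in> S" "s \<notin> Q" for s using g that by auto
    have k1: "mtail K (k (s, True)) = f s" "mhead K (k (s, True)) = f (g s)"
      "snd K (k (s, d)) = k (s, \<not> d)" "k (s, d) \<in> marcs K" if "s \<in> S" "s \<notin> Q" for s d
      using iso'(3-5,7)[of "(s, True)"] iso'(5,7)[of "(s, d)"] that by auto
    define h where "h = (\<lambda>v\<in>?V - R. k (i v, True))"
    have iQ: "i v \<notin> Q" if "v \<in> ?V" "v \<notin> R" for v
      using fR[of "i v"] i'[of v] that by simp
    have h: "h \<in> (?V - R) \<rightarrow>\<^sub>E marcs K"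
      using k1(4) i' iQ by (auto simp: h_def)
    have "mtail K (h v) = v" if "v \<in> ?V - R" for v
      using that k1(1)[of "i v"] i' iQ by (auto simp: h_def)
    moreover have hT: "h ` (?V - R) = k ` ((S - Q) \<times> {True})"
    proof (intro equalityI subsetI)
      fix a assume "a \<in> h ` (?V - R)"
      then show "a \<in> k ` ((S - Q) \<times> {True})" using i' iQ by (auto simp: h_def)
    next
      fix a assume "a \<in> k ` ((S - Q) \<times> {True})"
      then obtain s where s: "s \<in> S" "s \<notin> Q" "a = k (s, True)" by auto
      then have "a = h (f s)" "f s \<in> ?V - R" using i fR iso'(6) by (auto simp: h_def)
      then show "a \<in> h ` (?V - R)" by blast
    qed
    moreover have hF: "snd K ` h ` (?V - R) = k ` ((S - Q) \<times> {False})"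
    proof -
      have "snd K ` k ` ((S - Q) \<times> {True}) = (\<lambda>s. snd K (k (s, True))) ` (S - Q)" by (auto simp: image_iff)
      also have "\<dots> = (\<lambda>s. k (s, False)) ` (S - Q)" using k1(3) by (intro image_cong) auto
      also have "\<dots> = k ` ((S - Q) \<times> {False})" by (auto simp: image_iff)
      finally show ?thesis using hT by simp
    qed
    moreover have "k ` ((S - Q) \<times> {True}) \<union> k ` ((S - Q) \<times> {False}) = marcs K"
    proof -
      have "k ` ((S - Q) \<times> {True}) \<union> k ` ((S - Q) \<times> {False}) = k ` ((S - Q) \<times> UNIV)"
        unfolding image_Un[symmetric] by (intro arg_cong[where f = "image k"]) auto
      then show ?thesis using bij_betw_imp_surj_on[OF iso'(2)] by simp
    qed
    moreover have "k ` ((S - Q) \<times> {True}) \<inter> k ` ((S - Q) \<times> {False}) = {}"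
      by (subst inj_on_image_Int[OF bij_betw_imp_inj_on[OF iso'(2)], symmetric]) auto
    ultimately have "h \<in> orientations K R"
      using h by (simp add: orientations_def)
    moreover have "f \<in> B"
      using iso'(1,6) extn by (auto simp: B_def PiE_def)
    moreover have "\<Phi> ((Q, g), (f, k)) = (f, h)"
      by (simp add: \<Phi>_def h_def i_def)
    moreover have "\<Psi> (f, h) = ((Q, g), (f, k))"
    proof -
      have hf: "h (f s) = k (s, True)" if "s \<in> S" "s \<notin> Q" for s
        using that i fR iso'(6) by (auto simp: h_def)
      have "(\<lambda>s\<in>S - Q. i (mhead K (h (f s)))) = g"
      proof (rule ext)
        show "(\<lambda>s\<in>S - Q. i (mhead K (h (f s)))) s = g s" for s
          using g hf[of s] k1(2)[of s] i[OF gS, of s] PiE_arb[OF g, of s] by auto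
      qed
      moreover have "(\<lambda>(s, d)\<in>(S - Q) \<times> UNIV. if d then h (f s) else snd K (h (f s))) = k"
      proof (rule ext)
        show "(\<lambda>(s, d)\<in>(S - Q) \<times> UNIV. if d then h (f s) else snd K (h (f s))) p = k p" for p
          using hf k1(3) extensional_arb[OF extn(2), of p] by (cases p) auto
      qed
      ultimately show ?thesis
        by (simp add: \<Psi>_def Q_eq i_def)
    qed
    ultimately show ?thesis by simp
  qed
  have bwd: "\<Psi> (f, h) \<in> Sigma X I \<and> \<Phi> (\<Psi> (f, h)) = (f, h)"
    if "f \<in> B" and "h \<in> orientations K R" for f h
  proof -
    have f: "bij_betw f S ?V" "f \<in> extensional S" and fV: "\<And>s. s \<in> S \<Longrightarrow> f s \<in> ?V"
      using that by (auto simp: B_def PiE_def)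
    have hE: "h \<in> (?V - R) \<rightarrow>\<^sub>E marcs K" and htail: "\<And>v. v \<in> ?V \<Longrightarrow> v \<notin> R \<Longrightarrow> mtail K (h v) = v"
      and hcov: "h ` (?V - R) \<union> snd K ` h ` (?V - R) = marcs K"
      and hdis: "h ` (?V - R) \<inter> snd K ` h ` (?V - R) = {}"
      using that by (auto simp: orientations_def)
    have harc: "h v \<in> marcs K" if "v \<in> ?V" "v \<notin> R" for v using hE that by auto
    define i where "i = inv_into S f"
    have i: "i (f s) = s" if "s \<in> S" for s
      using that f(1) by (simp add: i_def bij_betw_inv_into_left)
    have i': "f (i v) = v" "i v \<in> S" if "v \<in> ?V" for v
      using that f(1) bij_betw_imp_surj_on[OF f(1)]
      by (auto simp: i_def bij_betw_inv_into_right inv_into_into)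
    define Q where "Q = {s\<in>S. f s \<in> R}"
    define g where "g = (\<lambda>s\<in>S - Q. i (mhead K (h (f s))))"
    define k where "k = (\<lambda>(s, d)\<in>(S - Q) \<times> UNIV. if d then h (f s) else snd K (h (f s)))"
    have \<Psi>: "\<Psi> (f, h) = ((Q, g), (f, k))"
      by (simp add: \<Psi>_def Q_def g_def k_def i_def)
    have hf: "h (f s) \<in> marcs K" "mtail K (h (f s)) = f s" if "s \<in> S" "s \<notin> Q" for s
      using that harc htail fV by (auto simp: Q_def)
    have "(Q, g) \<in> X"
      using i' K'(4) hf by (auto simp: X_def Q_def g_def)
    have k: "k (s, True) = h (f s)" "k (s, False) = snd K (h (f s))" if "s \<in> S" "s \<notin> Q" for s
      using that by (auto simp: k_def)
    have hinj: "s = s'" if "h (f s) = h (f s')" "s \<in> S" "s \<notin> Q" "s' \<in> S" "s' \<notin> Q" for s s'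
      using that hf(2) i by metis
    have VR: "f ` (S - Q) = ?V - R"
    proof (intro equalityI subsetI)
      fix v assume "v \<in> ?V - R"
      then have "i v \<in> S - Q" "v = f (i v)" using i' by (auto simp: Q_def)
      then show "v \<in> f ` (S - Q)" by blast
    qed (use fV in \<open>auto simp: Q_def\<close>)
    \<comment> \<open>Disjointness of the chosen arcs from their reversals keeps \<open>k\<close>
      injective across the two directions.\<close>
    have hdis': "h (f s) \<noteq> snd K (h (f s'))" if "s \<in> S" "s \<notin> Q" "s' \<in> S" "s' \<notin> Q" for s s'
    proof -
      have "h (f s) \<in> h ` f ` (S - Q)" "snd K (h (f s')) \<in> snd K ` h ` f ` (S - Q)"
        using that by blast+
      then show ?thesis using hdis unfolding VR disjoint_iff by metis
    qed
    have "inj_on k ((S - Q) \<times> UNIV)"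
    proof (rule inj_onI)
      fix p q assume "p \<in> (S - Q) \<times> (UNIV :: bool set)" "q \<in> (S - Q) \<times> (UNIV :: bool set)" and eq: "k p = k q"
      then obtain s d s' d' where p: "p = (s, d)" "s \<in> S" "s \<notin> Q" and q: "q = (s', d')" "s' \<in> S" "s' \<notin> Q"
        by (cases p, cases q) auto
      have *: "h (f s) = h (f s')" if "snd K (h (f s)) = snd K (h (f s'))"
        using arg_cong[OF that, of "snd K"] by (simp only: K'(7))
      show "p = q"
      proof (cases d; cases d')
        assume "d" "d'"
        then show ?thesis using eq p q hinj[of s s'] by (simp add: k)
      next
        assume "\<not> d" "\<not> d'"
        then show ?thesis using eq p q hinj[of s s'] * by (simp add: k)
      next
        assume "d" "\<not> d'"
        then show ?thesis using eq p q hdis'[of s s'] by (simp add: k)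
      next
        assume "\<not> d" "d'"
        then show ?thesis using eq p q hdis'[of s' s] by (simp add: k)
      qed
    qed
    moreover have "k ` ((S - Q) \<times> UNIV) = marcs K"
    proof -
      have "k ` ((S - Q) \<times> UNIV) = k ` ((S - Q) \<times> {True}) \<union> k ` ((S - Q) \<times> {False})"
        unfolding image_Un[symmetric] by (intro arg_cong[where f = "image k"]) auto
      also have "k ` ((S - Q) \<times> {True}) = (\<lambda>s. k (s, True)) ` (S - Q)" by (auto simp: image_iff)
      also have "\<dots> = h ` f ` (S - Q)"
        unfolding image_image using k by (intro image_cong) auto
      also have "k ` ((S - Q) \<times> {False}) = (\<lambda>s. k (s, False)) ` (S - Q)" by (auto simp: image_iff)
      also have "\<dots> = snd K ` h ` f ` (S - Q)"
        unfolding image_image using k by (intro image_cong) auto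
      finally show ?thesis unfolding VR hcov .
    qed
    ultimately have "bij_betw k ((S - Q) \<times> UNIV) (marcs K)"
      by (simp add: bij_betw_def)
    moreover have "mtail K (k (s, d)) = f (if d then s else g s) \<and> mhead K (k (s, d)) = f (if d then g s else s) \<and>
       snd K (k (s, d)) = k (s, \<not> d)" if "s \<in> S" "s \<notin> Q" for s d
    proof -
      have "g s = i (mhead K (h (f s)))" using that by (simp add: g_def)
      then have "f (g s) = mhead K (h (f s))" using i'(1)[OF K'(4)[OF hf(1)[OF that]]] by simp
      then show ?thesis
        using k[OF that] hf[OF that] K'(7-9)[of "h (f s)"] by (cases d) auto
    qed
    ultimately have "is_iso (fgraph S Q g) K f k"
      using f by (auto simp: is_iso_def)
    moreover have "f ` Q = R"
    proof (intro equalityI subsetI)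
      fix v assume "v \<in> R"
      then have "i v \<in> Q" "v = f (i v)" using R i' by (auto simp: Q_def)
      then show "v \<in> f ` Q" by blast
    qed (auto simp: Q_def)
    moreover have "k \<in> extensional ((S - Q) \<times> UNIV)" by (simp add: k_def)
    ultimately have "(f, k) \<in> I (Q, g)"
      using f by (auto simp: I_def isos_on_def)
    moreover have "\<Phi> ((Q, g), (f, k)) = (f, h)"
    proof -
      have "(\<lambda>v\<in>?V - R. k (i v, True)) v = h v" for v
        using i'[of v] k(1)[of "i v"] PiE_arb[OF hE, of v] by (auto simp: Q_def)
      then show ?thesis by (auto simp: \<Phi>_def i_def)
    qed
    ultimately show ?thesis using \<open>(Q, g) \<in> X\<close> by (simp add: \<Psi>)
  qed
  have "bij_betw \<Phi> (Sigma X I) (B \<times> orientations K R)"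
  proof (rule bij_betwI[where g = \<Psi>])
    show "\<Phi> \<in> Sigma X I \<rightarrow> B \<times> orientations K R"
      by (intro Pi_I) (use fwd in \<open>auto simp del: split_paired_All\<close>)
    show "\<Psi> \<in> B \<times> orientations K R \<rightarrow> Sigma X I"
      by (intro Pi_I) (use bwd in \<open>auto simp del: split_paired_All\<close>)
    show "\<Psi> (\<Phi> x) = x" if "x \<in> Sigma X I" for x
      using that fwd by auto
    show "\<Phi> (\<Psi> x) = x" if "x \<in> B \<times> orientations K R" for x
      using that bwd by auto
  qed
  then have card_eq: "card (Sigma X I) = fact (card S) * card (orientations K R)"
    using card_bij_PiE[OF S(1) K'(1) S(2)]
    by (simp add: bij_betw_same_card card_cartesian_product B_def)
  \<comment> \<open>Pairs with an empty fibre drop out; every other fibre has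
    \<open>card (Aut_on K R)\<close> elements.\<close>
  define X' where "X' = {p \<in> X. I p \<noteq> {}}"
  have card_I: "card (I p) = card (Aut_on K R)" if "p \<in> X'" for p
  proof -
    obtain Q g where p: "p = (Q, g)" by (cases p)
    have "Q \<subseteq> S" "g \<in> (S - Q) \<rightarrow>\<^sub>E S" "I (Q, g) \<noteq> {}"
      using that by (auto simp: X'_def X_def p)
    then show ?thesis
      using card_isos_on[OF K multigraph_fgraph[OF S(1)], of g Q Q R] R
      by (auto simp: p I_def PiE_def)
  qed
  have "card (Sigma X I) = card (Sigma X' I)"
    by (rule arg_cong[where f = card]) (auto simp: X'_def)
  also have "\<dots> = card X' * card (Aut_on K R)"
  proof -
    have "finite (I p)" if "p \<in> X'" for p
      using card_I[OF that] card_Aut_on_pos[OF K] card_ge_0_finite by metis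
    then have "card (Sigma X' I) = (\<Sum>p\<in>X'. card (I p))"
      using finX by (intro card_SigmaI) (auto simp: X'_def)
    then show ?thesis using card_I by simp
  qed
  also have "X' = {(Q, g). Q \<subseteq> S \<and> g \<in> (S - Q) \<rightarrow>\<^sub>E S \<and> isos_on (fgraph S Q g) Q K R \<noteq> {}}"
    by (auto simp: X'_def X_def I_def)
  finally show ?thesis using card_eq by simp
qed


section \<open>Counting orientations\<close>

text \<open>Equivalently, every forward orbit of \<open>f\<close> that starts in \<open>D\<close>
  leaves \<open>D\<close>. The formulation by invariant sets avoids iterates.\<close>

definition acyclic_on :: "'v set \<Rightarrow> ('v \<Rightarrow> 'v) \<Rightarrow> bool" where
  "acyclic_on D f \<longleftrightarrow> (\<forall>A\<subseteq>D. f ` A \<subseteq> A \<longrightarrow> A = {})"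

text \<open>Connectivity of the undirected graph with an edge from each \<open>v\<close> outside
  \<open>R\<close> to \<open>f v\<close>, expressed through unions of components.\<close>

definition weakly_connected :: "'v set \<Rightarrow> 'v set \<Rightarrow> ('v \<Rightarrow> 'v) \<Rightarrow> bool" where
  "weakly_connected V R f \<longleftrightarrow> (\<forall>A\<subseteq>V. A \<noteq> {} \<longrightarrow> (\<forall>v\<in>V - R. v \<in> A \<longleftrightarrow> f v \<in> A) \<longrightarrow> A = V)"

lemma acyclic_onD: "acyclic_on D f \<Longrightarrow> A \<subseteq> D \<Longrightarrow> (\<And>v. v \<in> A \<Longrightarrow> f v \<in> A) \<Longrightarrow> A = {}"
  unfolding acyclic_on_def by (meson image_subsetI)

lemma weakly_connectedD:
  "weakly_connected V R f \<Longrightarrow> A \<subseteq> V \<Longrightarrow> A \<noteq> {} \<Longrightarrow>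
    (\<And>v. v \<in> V \<Longrightarrow> v \<notin> R \<Longrightarrow> v \<in> A \<longleftrightarrow> f v \<in> A) \<Longrightarrow> A = V"
  unfolding weakly_connected_def by (metis DiffE)

text \<open>The vertices whose forward orbit avoids \<open>C\<close> form a union of components.\<close>

lemma weakly_connected_imp_acyclic_on:
  assumes conn: "weakly_connected V R f" and C: "C \<subseteq> V" "C \<noteq> {}" "R \<subseteq> C"
    and closed: "\<And>v. v \<in> C \<Longrightarrow> v \<notin> R \<Longrightarrow> f v \<in> C"
  shows "acyclic_on (V - C) f"
proof -
  \<comment> \<open>The greatest invariant subset of \<open>V - C\<close>. Its maximality supplies
    closure under preimages, so that weak connectedness applies to it.\<close>
  define B where "B = \<Union>{A. A \<subseteq> V - C \<and> f ` A \<subseteq> A}"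
  have sub: "B \<subseteq> V - C" unfolding B_def by blast
  have fB: "f v \<in> B" if "v \<in> B" for v
    using that unfolding B_def by blast
  have bwd: "v \<in> B" if v: "v \<in> V" "v \<notin> R" "f v \<in> B" for v
  proof -
    have "v \<notin> C" using closed v sub by blast
    then have "insert v B \<in> {A. A \<subseteq> V - C \<and> f ` A \<subseteq> A}"
    proof (intro CollectI conjI)
      show "insert v B \<subseteq> V - C" using sub v(1) \<open>v \<notin> C\<close> by blast
      show "f ` insert v B \<subseteq> insert v B" using fB v(3) by blast
    qed
    then show ?thesis unfolding B_def by (rule UnionI) simp
  qed
  have "B = {}"
  proof (rule ccontr)
    assume "B \<noteq> {}"
    then have "B = V"
      using sub fB bwd
      by (intro weakly_connectedD[OF conn]) auto
    then show False using sub C(1,2) by blast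
  qed
  then show ?thesis
    unfolding acyclic_on_def B_def by blast
qed

lemma orientationsD:
  assumes "h \<in> orientations K R"
  shows "v \<in> mverts K \<Longrightarrow> v \<notin> R \<Longrightarrow> h v \<in> marcs K"
    "v \<in> mverts K \<Longrightarrow> v \<notin> R \<Longrightarrow> mtail K (h v) = v"
    "a \<in> marcs K \<Longrightarrow> \<exists>v\<in>mverts K - R. a = h v \<or> a = snd K (h v)"
    "v \<in> mverts K - R \<Longrightarrow> w \<in> mverts K - R \<Longrightarrow> h v \<noteq> snd K (h w)"
    "v \<notin> mverts K - R \<Longrightarrow> h v = undefined"
proof -
  show "\<exists>v\<in>mverts K - R. a = h v \<or> a = snd K (h v)" if "a \<in> marcs K"
  proof -
    have "a \<in> h ` (mverts K - R) \<union> snd K ` h ` (mverts K - R)"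
      using that assms by (simp add: orientations_def)
    then show ?thesis by blast
  qed
  show "h v \<noteq> snd K (h w)" if "v \<in> mverts K - R" "w \<in> mverts K - R"
  proof
    assume "h v = snd K (h w)"
    then have "h ` (mverts K - R) \<inter> snd K ` h ` (mverts K - R) \<noteq> {}" using that by blast
    then show False using assms by (simp add: orientations_def)
  qed
qed (use assms in \<open>auto simp: orientations_def\<close>)

text \<open>Every arc is a chosen one or the reversal of a chosen one, so closure under arcs amounts
  to closure along the map in both directions.\<close>

lemma orientation_weakly_connected:
  assumes K: "multigraph K" and conn: "Digraph_Component.connected (fst K)" and h: "h \<in> orientations K R"
  shows "weakly_connected (mverts K) R (\<lambda>v. mhead K (h v))"
  unfolding weakly_connected_def
proof (intro allI impI)
  fix A assume A: "A \<subseteq> mverts K" "A \<noteq> {}" and cl: "\<forall>v\<in>mverts K - R. v \<in> A \<longleftrightarrow> mhead K (h v) \<in> A"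
  note h' = orientationsD[OF h]
  show "A = mverts K"
  proof (rule connected_closedD[OF K conn A])
    fix a assume a: "a \<in> marcs K" "mtail K a \<in> A"
    obtain v where v: "v \<in> mverts K - R" "a = h v \<or> a = snd K (h v)"
      using h'(3)[OF a(1)] by blast
    then show "mhead K a \<in> A"
      using bspec[OF cl v(1)] a h'(1,2)[of v] multigraphD(8,9)[OF K, of "h v"] by auto
  qed
qed

text \<open>Two orientations differ by the reversal of disjoint directed cycles.\<close>

lemma orientations_differ:
  assumes K: "multigraph K" and h: "h \<in> orientations K R" and h': "h' \<in> orientations K R"
    and D: "D = {v \<in> mverts K - R. h v \<noteq> h' v}" and f: "f = (\<lambda>v. mhead K (h v))"
  shows "f ` D = D" "inj_on f D" "u \<in> D \<Longrightarrow> h' (f u) = snd K (h u)"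
proof -
  note h1 = orientationsD[OF h] and h2 = orientationsD[OF h']
  \<comment> \<open>\<open>h' v\<close> is not of the form \<open>h u\<close>, since equal tails
    would force \<open>u = v\<close>; so it reverses an arc \<open>h u\<close> with
    \<open>f u = v\<close>. Thus \<open>D\<close> lies in its own image, and finiteness makes
    \<open>f\<close> a permutation of \<open>D\<close>.\<close>
  have ex: "\<exists>u\<in>D. f u = v \<and> h' v = snd K (h u)" if "v \<in> D" for v
  proof -
    have v: "v \<in> mverts K" "v \<notin> R" "h v \<noteq> h' v" using that D by auto
    obtain u where u: "u \<in> mverts K - R" "h' v = h u \<or> h' v = snd K (h u)"
      using h1(3)[OF h2(1)[OF v(1,2)]] by blast
    have "h' v \<noteq> h u"
      using h1(2)[of u] h2(2)[of v] u v by auto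
    then have eq: "h' v = snd K (h u)" using u by blast
    moreover have "f u = v"
      using arg_cong[OF eq, of "mtail K"] h1(1)[of u] h2(2)[of v] u v multigraphD(8)[OF K] by (simp add: f)
    moreover have "u \<in> D"
      using eq h2(4)[of v u] u v by (auto simp: D)
    ultimately show ?thesis by blast
  qed
  have fin: "finite D" using multigraphD(1)[OF K] D by auto
  have sub: "D \<subseteq> f ` D" using ex by blast
  have "card (f ` D) = card D"
    using card_mono[OF _ sub] fin card_image_le[OF fin, of f] by simp
  then show eq: "f ` D = D" and inj: "inj_on f D"
    using card_subset_eq[OF _ sub] fin by (auto intro: eq_card_imp_inj_on)
  show "h' (f u) = snd K (h u)" if "u \<in> D"
  proof -
    have "f u \<in> D" using eq that by blast
    then obtain w where "w \<in> D" "f w = f u" "h' (f u) = snd K (h w)" using ex by blast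
    then show ?thesis using inj that by (auto simp: inj_on_eq_iff)
  qed
qed

text \<open>\<open>h v\<close> is the first arc of a shortest path from \<open>v\<close> to
  \<open>r\<close> inside \<open>A\<close>, and \<open>d\<close> is the distance. The arc set
  \<open>A\<close> is a parameter so that the edges of one tree can be directed anew towards another
  root.\<close>

lemma spanning_tree:
  assumes K: "multigraph K" and A: "A \<subseteq> marcs K" "snd K ` A \<subseteq> A" and r: "r \<in> mverts K"
    and conn: "\<And>B. B \<subseteq> mverts K \<Longrightarrow> r \<in> B \<Longrightarrow> (\<And>a. a \<in> A \<Longrightarrow> mtail K a \<in> B \<Longrightarrow> mhead K a \<in> B) \<Longrightarrow> B = mverts K"
  obtains h and d :: "'v \<Rightarrow> nat" where
    "\<And>v. v \<in> mverts K \<Longrightarrow> v \<noteq> r \<Longrightarrow> h v \<in> A \<and> mtail K (h v) = v \<and> d (mhead K (h v)) < d v"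
proof -
  note K' = multigraphD[OF K]
  define E where "E = (\<lambda>a. (mtail K a, mhead K a)) ` A"
  define B where "B = {v \<in> mverts K. \<exists>n. (v, r) \<in> E ^^ n}"
  define d where "d = (\<lambda>v. LEAST n. (v, r) \<in> E ^^ n)"
  have "B = mverts K"
  proof (rule conn)
    show "r \<in> B" using r by (auto simp: B_def intro!: exI[of _ 0])
    fix a assume a: "a \<in> A" "mtail K a \<in> B"
    then obtain n where n: "(mtail K a, r) \<in> E ^^ n" by (auto simp: B_def)
    have "snd K a \<in> A" using a A by blast
    then have "(mhead K a, mtail K a) \<in> E"
      using a A K'(8,9)[of a] by (force simp: E_def)
    then have "(mhead K a, r) \<in> E ^^ Suc n" using n by (rule relpow_Suc_I2)
    then show "mhead K a \<in> B" using a A K'(4) unfolding B_def by blast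
  qed (auto simp: B_def)
  have ex: "\<exists>a. a \<in> A \<and> mtail K a = v \<and> d (mhead K a) < d v" if v: "v \<in> mverts K" "v \<noteq> r" for v
  proof -
    have "\<exists>n. (v, r) \<in> E ^^ n" using v \<open>B = mverts K\<close> by (auto simp: B_def)
    then have dv: "(v, r) \<in> E ^^ d v" unfolding d_def by (rule LeastI_ex)
    obtain m where m: "d v = Suc m" using dv v by (cases "d v") auto
    obtain w where w: "(v, w) \<in> E" "(w, r) \<in> E ^^ m"
      using dv unfolding m by (meson relpow_Suc_E2)
    have "d w \<le> m" unfolding d_def using w(2) by (rule Least_le)
    then show ?thesis using w(1) m by (auto simp: E_def)
  qed
  then obtain h where "\<And>v. v \<in> mverts K \<Longrightarrow> v \<noteq> r \<Longrightarrow> h v \<in> A \<and> mtail K (h v) = v \<and> d (mhead K (h v)) < d v"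
    by metis
  then show ?thesis using that by blast
qed

text \<open>If \<open>h v\<close> were the reversal of \<open>h w\<close>, each of \<open>v\<close>
  and \<open>w\<close> would be closer to the root than the other. Hence the tree occupies two
  half-edges for every vertex other than \<open>r\<close>.\<close>

lemma spanning_tree_arcs:
  fixes d :: "'v \<Rightarrow> nat"
  assumes K: "multigraph K" and r: "r \<in> mverts K"
    and h: "\<And>v. v \<in> mverts K \<Longrightarrow> v \<noteq> r \<Longrightarrow> h v \<in> marcs K \<and> mtail K (h v) = v \<and> d (mhead K (h v)) < d v"
  shows "h ` (mverts K - {r}) \<inter> snd K ` h ` (mverts K - {r}) = {}"
    and "card (h ` (mverts K - {r}) \<union> snd K ` h ` (mverts K - {r})) = 2 * (card (mverts K) - 1)"
proof -
  note K' = multigraphD[OF K]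
  let ?V = "mverts K - {r}"
  have ne: "h v \<noteq> snd K (h w)" if "v \<in> ?V" "w \<in> ?V" for v w
  proof
    assume eq: "h v = snd K (h w)"
    have "v = mhead K (h w)" "mhead K (h v) = w"
      using arg_cong[OF eq, of "mtail K"] arg_cong[OF eq, of "mhead K"] h[of v] h[of w] that K'(8,9)[of "h w"]
      by auto
    then show False using h[of v] h[of w] that by auto
  qed
  show dis: "h ` ?V \<inter> snd K ` h ` ?V = {}"
  proof (rule equals0I)
    fix x assume "x \<in> h ` ?V \<inter> snd K ` h ` ?V"
    then obtain v w where "v \<in> ?V" "w \<in> ?V" "x = h v" "x = snd K (h w)" by blast
    then show False using ne[of v w] by simp
  qed
  have inj: "inj_on h ?V"
  proof (rule inj_onI)
    fix v w assume vw: "v \<in> ?V" "w \<in> ?V" and eq: "h v = h w"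
    have "mtail K (h v) = v" "mtail K (h w) = w" using h[of v] h[of w] vw by auto
    then show "v = w" using eq by metis
  qed
  have "inj_on (snd K) X" for X
    by (rule inj_on_inverseI[where g = "snd K"]) (rule K'(7))
  then have "card (snd K ` h ` ?V) = card ?V" "card (h ` ?V) = card ?V"
    using inj by (simp_all add: card_image)
  then show "card (h ` ?V \<union> snd K ` h ` ?V) = 2 * (card (mverts K) - 1)"
    using card_Un_disjoint[OF _ _ dis] K'(1) r by simp
qed

text \<open>With Betti number 0 a spanning tree directed towards \<open>r\<close> uses up all arcs,
  which gives existence. The set on which another orientation differs is invariant and avoids
  \<open>r\<close>, so acyclicity makes it empty.\<close>

lemma card_orientations_tree:
  assumes K: "K \<in> connected_graphs 0" and r: "r \<in> mverts K"
  shows "card (orientations K {r}) = 1"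
proof -
  have mK: "multigraph K" and conn: "Digraph_Component.connected (fst K)" and betti: "betti K = int 0"
    using K by (auto simp: connected_graphs_def)
  note K' = multigraphD[OF mK]
  obtain h and d :: "_ \<Rightarrow> nat" where h: "\<And>v. v \<in> mverts K \<Longrightarrow> v \<noteq> r \<Longrightarrow>
      h v \<in> marcs K \<and> mtail K (h v) = v \<and> d (mhead K (h v)) < d v"
  proof (rule spanning_tree[OF mK order.refl _ r])
    show "snd K ` marcs K \<subseteq> marcs K" using K'(5) by blast
    show "B = mverts K" if "B \<subseteq> mverts K" "r \<in> B"
        "\<And>a. a \<in> marcs K \<Longrightarrow> mtail K a \<in> B \<Longrightarrow> mhead K a \<in> B" for B
      using that by (intro connected_closedD[OF mK conn]) auto
  qed blast
  note tree = spanning_tree_arcs[OF mK r h]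
  define h0 where "h0 = restrict h (mverts K - {r})"
  have img: "h0 ` (mverts K - {r}) = h ` (mverts K - {r})" by (auto simp: h0_def)
  have "h ` (mverts K - {r}) \<union> snd K ` h ` (mverts K - {r}) = marcs K"
  proof (rule card_subset_eq)
    show "finite (marcs K)" by (rule K')
    show "h ` (mverts K - {r}) \<union> snd K ` h ` (mverts K - {r}) \<subseteq> marcs K"
      using h K'(5) by auto
    show "card (h ` (mverts K - {r}) \<union> snd K ` h ` (mverts K - {r})) = card (marcs K)"
      using betti tree(2) r K'(1) unfolding betti_eq_iff[OF mK]
      by simp
  qed
  then have h0: "h0 \<in> orientations K {r}"
    using h tree(1) unfolding orientations_def img by (auto simp: h0_def)
  have "h' = h0" if h': "h' \<in> orientations K {r}" for h'
  proof -
    define D where "D = {v \<in> mverts K - {r}. h0 v \<noteq> h' v}"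
    note dif = orientations_differ[OF mK h0 h' D_def refl]
    have "acyclic_on (mverts K - {r}) (\<lambda>v. mhead K (h0 v))"
      using r by (intro weakly_connected_imp_acyclic_on[OF orientation_weakly_connected[OF mK conn h0]]) auto
    then have "D = {}"
      by (rule acyclic_onD) (use dif(1) in \<open>auto simp: D_def\<close>)
    then have "h' v = h0 v" for v
      using orientationsD(5)[OF h0, of v] orientationsD(5)[OF h', of v]
      by (cases "v \<in> mverts K - {r}") (auto simp: D_def)
    then show ?thesis by blast
  qed
  then have "orientations K {r} = {h0}" using h0 by blast
  then show ?thesis by simp
qed


text \<open>For a smallest nonempty invariant set \<open>C\<close>, the image of \<open>C\<close> is
  again invariant, so it cannot be smaller, and \<open>f\<close> permutes \<open>C\<close>.\<close>

lemma ex_invariant_subset: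
  assumes V: "finite V" "V \<noteq> {}" "f ` V \<subseteq> V"
  obtains C where "C \<subseteq> V" "C \<noteq> {}" "f ` C = C" "inj_on f C"
proof -
  let ?P = "\<lambda>C. C \<subseteq> V \<and> C \<noteq> {} \<and> f ` C \<subseteq> C"
  obtain C where C: "?P C" and min: "\<And>C'. ?P C' \<Longrightarrow> card C \<le> card C'"
    using ex_has_least_nat[of ?P V card] V by auto
  have fin: "finite C" using C V finite_subset by blast
  have "card (f ` C) = card C"
    using min[of "f ` C"] C card_image_le[OF fin, of f] by fastforce
  moreover from this have "f ` C = C"
    using card_subset_eq[OF fin] C by blast
  ultimately show ?thesis
    using that[of C] C fin by (simp add: eq_card_imp_inj_on)
qed

text \<open>Betti number 1 leaves one edge outside a spanning tree. With the tree directed towards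
  an end \<open>s\<close> of that edge, \<open>s\<close> can leave along it and every vertex has one
  outgoing arc. Since \<open>s\<close> is known only after a tree has been chosen, the tree is built
  with an arbitrary root \<open>r\<close> and rooted anew at \<open>s\<close>.\<close>

lemma ex_unicyclic_orientation:
  assumes K: "K \<in> connected_graphs 1"
  shows "orientations K {} \<noteq> {}"
proof -
  have mK: "multigraph K" and conn: "Digraph_Component.connected (fst K)" and betti: "betti K = int 1"
    using K by (auto simp: connected_graphs_def)
  note K' = multigraphD[OF mK]
  let ?V = "mverts K"
  have card: "card (marcs K) = 2 * card ?V"
    using betti unfolding betti_eq_iff[OF mK] by simp
  obtain r where r: "r \<in> ?V" using connected_nonempty[OF mK conn] by blast
  obtain h and d :: "_ \<Rightarrow> nat" where h: "\<And>v. v \<in> ?V \<Longrightarrow> v \<noteq> r \<Longrightarrow>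
      h v \<in> marcs K \<and> mtail K (h v) = v \<and> d (mhead K (h v)) < d v"
  proof (rule spanning_tree[OF mK order.refl _ r])
    show "snd K ` marcs K \<subseteq> marcs K" using K'(5) by blast
    show "B = mverts K" if "B \<subseteq> mverts K" "r \<in> B"
        "\<And>a. a \<in> marcs K \<Longrightarrow> mtail K a \<in> B \<Longrightarrow> mhead K a \<in> B" for B
      using that by (intro connected_closedD[OF mK conn]) auto
  qed blast
  note tree = spanning_tree_arcs[OF mK r h]
  define A where "A = h ` (?V - {r}) \<union> snd K ` h ` (?V - {r})"
  have A: "A \<subseteq> marcs K" using h K'(5) by (auto simp: A_def)
  have rev: "snd K a \<in> A \<longleftrightarrow> a \<in> A" for a
  proof -
    have "snd K a \<in> A" if "a \<in> A" for a
      using that K'(7) by (auto simp: A_def)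
    from this[of a] this[of "snd K a"] show ?thesis by (auto simp: K'(7))
  qed
  have "card ?V > 0" using r K'(1) by (auto simp: card_gt_0_iff)
  then have "A \<noteq> marcs K" using tree(2) card by (auto simp: A_def)
  then obtain a where a: "a \<in> marcs K" "a \<notin> A" using A by blast
  define s where "s = mtail K a"
  have s: "s \<in> ?V" using a K'(3) by (simp add: s_def)
  \<comment> \<open>\<open>A\<close> contains reversals, so the two ends of a tree arc are both in
    \<open>B\<close> or both outside; by induction on the distance \<open>d\<close> every vertex
    agrees with \<open>r\<close>.\<close>
  have path: "v \<in> B" if B: "B \<subseteq> ?V" "s \<in> B" and cl: "\<And>a. a \<in> A \<Longrightarrow> mtail K a \<in> B \<Longrightarrow> mhead K a \<in> B"
    and v: "v \<in> ?V" for B v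
  proof -
    have step: "mhead K (h v) \<in> B \<longleftrightarrow> v \<in> B" if "v \<in> ?V" "v \<noteq> r" for v
    proof -
      have "h v \<in> A" "snd K (h v) \<in> A" using that by (auto simp: A_def)
      then show ?thesis
        using cl[of "h v"] cl[of "snd K (h v)"] h[OF that] K'(8,9)[of "h v"] by auto
    qed
    have "v \<in> B \<longleftrightarrow> r \<in> B" if "v \<in> ?V" for v
      using that
    proof (induction "d v" arbitrary: v rule: less_induct)
      case less
      show ?case
      proof (cases "v = r")
        case False
        then show ?thesis
          using less h[of v] step[of v] K'(4) by blast
      qed simp
    qed
    from this[OF s] this[OF v] B(2) show ?thesis by blast
  qed
  \<comment> \<open>The tree arcs are directed anew towards \<open>s\<close>, which leaves
    \<open>s\<close> free to take \<open>a\<close>.\<close>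
  obtain h1 and d1 :: "_ \<Rightarrow> nat" where h1: "\<And>v. v \<in> ?V \<Longrightarrow> v \<noteq> s \<Longrightarrow>
      h1 v \<in> A \<and> mtail K (h1 v) = v \<and> d1 (mhead K (h1 v)) < d1 v"
  proof (rule spanning_tree[OF mK A _ s])
    show "snd K ` A \<subseteq> A" using rev by blast
    show "B = mverts K" if "B \<subseteq> mverts K" "s \<in> B"
        "\<And>a. a \<in> A \<Longrightarrow> mtail K a \<in> B \<Longrightarrow> mhead K a \<in> B" for B
      using path[OF that] that(1) by blast
  qed blast
  have h1': "h1 v \<in> marcs K \<and> mtail K (h1 v) = v \<and> d1 (mhead K (h1 v)) < d1 v" if "v \<in> ?V" "v \<noteq> s" for v
    using h1[OF that] A by blast
  note tree1 = spanning_tree_arcs[OF mK s h1']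
  define A1 where "A1 = h1 ` (?V - {s}) \<union> snd K ` h1 ` (?V - {s})"
  have A1: "A1 \<subseteq> A" using h1 rev by (auto simp: A1_def)
  have na: "snd K a \<noteq> a" "snd K a \<notin> A" "snd K a \<in> marcs K" using a rev K'(5,6) by auto
  define h2 where "h2 = (\<lambda>v\<in>?V. if v = s then a else h1 v)"
  have img: "h2 ` ?V = insert a (h1 ` (?V - {s}))"
    using s by (auto simp: h2_def image_iff)
  \<comment> \<open>The tree has \<open>2 * (card ?V - 1)\<close> half-edges; \<open>a\<close> and
    its reversal bring the number to \<open>2 * card ?V\<close>, which is all of
    \<open>marcs K\<close>.\<close>
  have "insert a (insert (snd K a) A1) = marcs K"
  proof (rule card_subset_eq)
    show "finite (marcs K)" by (rule K')
    show "insert a (insert (snd K a) A1) \<subseteq> marcs K" using a na A A1 by blast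
    have "finite A1" by (rule finite_subset[OF subset_trans[OF A1 A] K'(2)])
    moreover have "a \<notin> A1" "snd K a \<notin> A1" using a na A1 by auto
    ultimately have "card (insert a (insert (snd K a) A1)) = Suc (Suc (card A1))"
      using na by simp
    then show "card (insert a (insert (snd K a) A1)) = card (marcs K)"
      using tree1(2) card \<open>card ?V > 0\<close> by (simp add: A1_def)
  qed
  moreover have "h2 ` ?V \<union> snd K ` h2 ` ?V = insert a (insert (snd K a) A1)"
    unfolding img A1_def by auto
  moreover have "h2 ` ?V \<inter> snd K ` h2 ` ?V = {}"
  proof -
    have "a \<notin> A1" "snd K a \<notin> A1" using a na A1 by auto
    then show ?thesis unfolding img using tree1(1) na(1) unfolding A1_def by auto
  qed
  moreover have "h2 \<in> ?V \<rightarrow>\<^sub>E marcs K" using h1' a by (auto simp: h2_def)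
  moreover have "\<forall>v\<in>?V. mtail K (h2 v) = v" using h1' by (auto simp: h2_def s_def)
  ultimately have "h2 \<in> orientations K {}"
    by (simp add: orientations_def)
  then show ?thesis by blast
qed

text \<open>Reversing the cycle \<open>C\<close> of one orientation gives a second. There is no
  third: the sets on which orientations differ from \<open>h\<close> are nonempty and permuted by
  \<open>f\<close>, any two such sets are equal, and on them the new arcs are forced.\<close>

lemma card_orientations_unicyclic:
  assumes K: "K \<in> connected_graphs 1"
  shows "card (orientations K {}) = 2"
proof -
  have mK: "multigraph K" and conn: "Digraph_Component.connected (fst K)"
    using K by (auto simp: connected_graphs_def)
  note K' = multigraphD[OF mK]
  let ?V = "mverts K"
  obtain h where h: "h \<in> orientations K {}" using ex_unicyclic_orientation[OF K] by blast
  note h' = orientationsD[OF h, simplified]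
  define f where "f = (\<lambda>v. mhead K (h v))"
  have fV: "f ` ?V \<subseteq> ?V" using h'(1) K'(4) by (auto simp: f_def)
  have wc: "weakly_connected ?V {} f"
    unfolding f_def by (rule orientation_weakly_connected[OF mK conn h])
  obtain C where C: "C \<subseteq> ?V" "C \<noteq> {}" "f ` C = C" "inj_on f C"
    using ex_invariant_subset[OF K'(1) connected_nonempty[OF mK conn] fV] .
  define i where "i = inv_into C f"
  have i: "i v \<in> C" "f (i v) = v" if "v \<in> C" for v
    using that C(3) by (auto simp: i_def inv_into_into f_inv_into_f)
  have i': "i (f v) = v" if "v \<in> C" for v
    using that C(4) by (simp add: i_def)
  \<comment> \<open>On the cycle, \<open>v\<close> now takes the reversal of the arc that enters it
    from its predecessor \<open>i v\<close>.\<close>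
  define k where "k = (\<lambda>v\<in>?V. if v \<in> C then snd K (h (i v)) else h v)"
  have iV: "i v \<in> ?V" if "v \<in> C" for v using i that C(1) by blast
  have kC: "k ` C = snd K ` h ` C"
  proof -
    have "k ` C = (\<lambda>v. snd K (h v)) ` i ` C"
      unfolding image_image using C(1) by (intro image_cong) (auto simp: k_def)
    also have "i ` C = C" using i i' C(3) by (metis (no_types, lifting) image_subset_iff subsetI subset_antisym image_eqI)
    finally show ?thesis by (simp add: image_image)
  qed
  have kV: "k ` (?V - C) = h ` (?V - C)" by (auto simp: k_def)
  have split: "g ` ?V = g ` C \<union> g ` (?V - C)" for g :: "_ \<Rightarrow> 'b"
    using C(1) by blast
  have rr: "snd K ` snd K ` X = X" for X by (auto simp: image_image K'(7))
  have hdis: "h ` X \<inter> snd K ` h ` Y = {}" if "X \<subseteq> ?V" "Y \<subseteq> ?V" for X Y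
    using h'(4) that by blast
  have hdis2: "h ` C \<inter> h ` (?V - C) = {}"
  proof (rule equals0I)
    fix x assume "x \<in> h ` C \<inter> h ` (?V - C)"
    then obtain v w where vw: "v \<in> C" "w \<in> ?V - C" and eq: "x = h v" "x = h w" by blast
    have "mtail K (h v) = v" "mtail K (h w) = w" using h'(2) vw C(1) by auto
    then show False using eq vw by auto
  qed
  have "k ` ?V \<union> snd K ` k ` ?V = h ` ?V \<union> snd K ` h ` ?V"
    unfolding split[of k] split[of h] image_Un kC kV rr by blast
  also have "\<dots> = marcs K" using h by (simp add: orientations_def)
  finally have kcov: "k ` ?V \<union> snd K ` k ` ?V = marcs K" .
  have inj: "inj_on (snd K) X" for X
    by (rule inj_on_inverseI[where g = "snd K"]) (rule K'(7))
  have "snd K ` h ` C \<inter> snd K ` h ` (?V - C) = {}"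
    using image_Int[OF inj[of UNIV], of "h ` C" "h ` (?V - C)"] hdis2 by simp
  then have "k ` ?V \<inter> snd K ` k ` ?V = {}"
    unfolding split[of k] image_Un kC kV rr
    using hdis[OF C(1) C(1)] hdis[of "?V - C" "?V - C"] hdis2
    by (simp add: Int_Un_distrib Int_Un_distrib2 Int_commute)
  moreover have "k \<in> ?V \<rightarrow>\<^sub>E marcs K" using h'(1) iV K'(5) by (auto simp: k_def)
  moreover have "\<forall>v\<in>?V. mtail K (k v) = v"
  proof
    fix v assume v: "v \<in> ?V"
    show "mtail K (k v) = v"
    proof (cases "v \<in> C")
      case True
      then have "mtail K (snd K (h (i v))) = f (i v)"
        using K'(8)[OF h'(1)[OF iV[OF True]]] by (simp add: f_def)
      then show ?thesis using True v i by (simp add: k_def)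
    qed (use v h'(2) in \<open>simp add: k_def\<close>)
  qed
  ultimately have k: "k \<in> orientations K {}"
    using kcov by (simp add: orientations_def)
  have "k \<noteq> h"
  proof -
    obtain v where v: "v \<in> C" using C(2) by blast
    then have "k v = snd K (h (i v))" using C(1) by (auto simp: k_def)
    then show ?thesis using h'(4)[of v "i v"] v C(1) iV[OF v] by auto
  qed
  have uniq: "k' = k" if k': "k' \<in> orientations K {}" "k' \<noteq> h" for k'
  proof -
    define D where "D = {v \<in> ?V - {}. h v \<noteq> k' v}"
    define E where "E = {v \<in> ?V - {}. h v \<noteq> k v}"
    note D = orientations_differ[OF mK h k'(1) D_def f_def]
    note E = orientations_differ[OF mK h k E_def f_def]
    have ne': "{v \<in> ?V - {}. h v \<noteq> g v} \<noteq> {}" if g: "g \<in> orientations K {}" "g \<noteq> h" for g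
    proof -
      obtain v where v: "g v \<noteq> h v" using g(2) by (metis ext)
      then have "v \<in> ?V" using h'(5)[of v] orientationsD(5)[OF g(1), of v] by (cases "v \<in> ?V") auto
      then show ?thesis using v[symmetric] by blast
    qed
    have ne: "D \<noteq> {}" "E \<noteq> {}"
      unfolding D_def E_def using ne'[OF k'] ne'[OF k \<open>k \<noteq> h\<close>] by blast+
    \<comment> \<open>\<open>f\<close> is injective on \<open>X\<close> and permutes
      \<open>X \<inter> Y\<close>, so \<open>X - Y\<close> is invariant. Every orbit enters
      \<open>Y\<close>, hence \<open>X - Y\<close> is empty.\<close>
    have sub: "X \<subseteq> Y" if X: "X \<subseteq> ?V" "f ` X = X" "inj_on f X" and Y: "Y \<subseteq> ?V" "Y \<noteq> {}" "f ` Y = Y" "inj_on f Y" for X Y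
    proof -
      have "acyclic_on (?V - Y) f"
        using Y by (intro weakly_connected_imp_acyclic_on[OF wc]) auto
      moreover have "f v \<in> X - Y" if v: "v \<in> X - Y" for v
      proof -
        have fin: "finite (X \<inter> Y)" using X K'(1) finite_subset by blast
        have "f ` (X \<inter> Y) \<subseteq> X \<inter> Y" using X(2) Y(3) by blast
        then have eq: "f ` (X \<inter> Y) = X \<inter> Y"
          using fin X(3) by (metis card_image card_subset_eq inf_le1 inj_on_subset)
        have "f v \<notin> f ` (X \<inter> Y)"
          using v X(3) by (auto simp: inj_on_eq_iff)
        moreover have "f v \<in> X" using v X(2) by blast
        ultimately show ?thesis using eq by blast
      qed
      ultimately have "X - Y = {}"
        using X(1) by (intro acyclic_onD[of "?V - Y" f "X - Y"]) auto
      then show ?thesis by blast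
    qed
    have "D \<subseteq> ?V" "E \<subseteq> ?V" by (auto simp: D_def E_def)
    then have "D = E"
      using sub[OF _ D(1,2) _ ne(2) E(1,2)] sub[OF _ E(1,2) _ ne(1) D(1,2)] by (intro equalityI)
    have "k' v = k v" for v
    proof (cases "v \<in> D")
      case True
      then have "v \<in> f ` D" by (simp only: D(1))
      then obtain u where u: "u \<in> D" "v = f u" by blast
      then have "u \<in> E" by (simp only: \<open>D = E\<close>)
      show ?thesis unfolding u(2) D(3)[OF u(1)] E(3)[OF \<open>u \<in> E\<close>] ..
    next
      case False
      then have "v \<notin> E" using \<open>D = E\<close> by simp
      with False show ?thesis
        using orientationsD(5)[OF k, of v] orientationsD(5)[OF k'(1), of v]
        by (cases "v \<in> ?V") (auto simp: D_def E_def)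
    qed
    then show ?thesis by blast
  qed
  have "orientations K {} = {h, k}" using h k uniq by blast
  then show ?thesis using \<open>k \<noteq> h\<close> by simp
qed


section \<open>Isomorphism classes versus labelled structures\<close>

text \<open>\<open>X\<close> consists of labelled structures, and \<open>I x K\<close> says that
  \<open>x\<close> is a labelling of \<open>K\<close>. A representative \<open>K\<close> has
  \<open>C / aut K\<close> labellings, so the sum over \<open>X\<close> is \<open>C\<close> times
  the sum weighted by \<open>1 / aut K\<close>.\<close>

lemma sum_representatives:
  fixes w :: "'k \<Rightarrow> 'r :: field_char_0" and I :: "'x \<Rightarrow> 'k \<Rightarrow> bool"
  assumes eq: "equiv Ob r" and X: "finite X" and C: "C > 0"
    and cover: "\<And>x. x \<in> X \<Longrightarrow> \<exists>K\<in>Ob. P K \<and> I x K"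
    and compat: "\<And>x K L. x \<in> X \<Longrightarrow> I x K \<Longrightarrow> K \<in> Ob \<Longrightarrow> L \<in> Ob \<Longrightarrow> I x L \<longleftrightarrow> (K, L) \<in> r"
    and Pinv: "\<And>K L. (K, L) \<in> r \<Longrightarrow> P K \<Longrightarrow> P L"
    and count: "\<And>K. K \<in> Ob \<Longrightarrow> P K \<Longrightarrow> card {x \<in> X. I x K} * aut K = C"
    and weight: "\<And>x K. x \<in> X \<Longrightarrow> I x K \<Longrightarrow> K \<in> Ob \<Longrightarrow> w' x = w K"
  shows "(\<Sum>K \<in> representative ` {c \<in> Ob // r. P (representative c)}. w K / of_nat (aut K))
    = (\<Sum>x\<in>X. w' x) / of_nat C"
proof -
  define D where "D = representative ` {c \<in> Ob // r. P (representative c)}"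
  have rep: "representative c \<in> c" if "c \<in> Ob // r" for c
    using in_quotient_imp_non_empty[OF eq that] unfolding representative_def by (simp add: some_in_eq)
  have DOb: "K \<in> Ob" "P K" if "K \<in> D" for K
    using that rep in_quotient_imp_subset[OF eq] by (auto simp: D_def)
  have Deq: "K = L" if K: "K \<in> D" and L: "L \<in> D" and KL: "(K, L) \<in> r" for K L
  proof -
    obtain c c' where c: "c \<in> Ob // r" "K = representative c" "c' \<in> Ob // r" "L = representative c'"
      using K L by (auto simp: D_def)
    have "c = c'"
      using quotient_eqI[OF eq c(1,3)] rep[OF c(1)] rep[OF c(3)] KL c(2,4) by blast
    then show ?thesis using c by simp
  qed
  have ex: "\<exists>K\<in>D. I x K" if x: "x \<in> X" for x
  proof -
    obtain K where K: "K \<in> Ob" "P K" "I x K" using cover[OF x] by blast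
    define c where "c = r `` {K}"
    have c: "c \<in> Ob // r" unfolding c_def by (rule quotientI[OF K(1)])
    have "(K, representative c) \<in> r" using rep[OF c] by (simp add: c_def)
    moreover have "representative c \<in> Ob" using rep[OF c] in_quotient_imp_subset[OF eq c] by blast
    ultimately have "I x (representative c)" "P (representative c)"
      using compat[OF x K(3,1)] Pinv K(2) by blast+
    then show ?thesis using c by (auto simp: D_def)
  qed
  \<comment> \<open>\<open>g x\<close> is the chosen representative of the class of
    \<open>x\<close>. Distinct classes have distinct representatives, so the fibres of
    \<open>g\<close> are the sets whose size is given by \<open>count\<close>.\<close>
  then obtain g where g: "\<And>x. x \<in> X \<Longrightarrow> g x \<in> D \<and> I x (g x)" by metis
  have g_iff: "I x K \<longleftrightarrow> g x = K" if "x \<in> X" "K \<in> D" for x K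
    using that g[of x] compat[of x "g x" K] DOb Deq by metis
  have pos: "card {x \<in> X. I x K} > 0" "aut K > 0" if "K \<in> D" for K
    using count[OF DOb[OF that]] C by (metis gr0I mult_0 mult_0_right less_irrefl)+
  have "D \<subseteq> g ` X"
  proof
    fix K assume K: "K \<in> D"
    then obtain x where "x \<in> X" "I x K" using pos(1) by (metis (mono_tags, lifting) card.empty empty_Collect_eq less_irrefl)
    then show "K \<in> g ` X" using g_iff K by blast
  qed
  then have fD: "finite D" using X finite_surj by blast
  have "(\<Sum>x\<in>X. w' x) = (\<Sum>K\<in>D. \<Sum>x\<in>{x \<in> X. g x = K}. w' x)"
    using g by (intro sum.group[symmetric] X fD) auto
  also have "\<dots> = (\<Sum>K\<in>D. of_nat C * (w K / of_nat (aut K)))"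
  proof (rule sum.cong[OF refl])
    fix K assume K: "K \<in> D"
    have "(\<Sum>x\<in>{x \<in> X. g x = K}. w' x) = (\<Sum>x\<in>{x \<in> X. I x K}. w K)"
      using g_iff K weight DOb(1)[OF K] by (intro sum.cong) auto
    also have "\<dots> = of_nat C * (w K / of_nat (aut K))"
      using pos(2)[OF K] unfolding count[OF DOb[OF K], symmetric] by simp
    finally show "(\<Sum>x\<in>{x \<in> X. g x = K}. w' x) = of_nat C * (w K / of_nat (aut K))" .
  qed
  finally show ?thesis
    using C unfolding D_def[symmetric] sum_distrib_left[symmetric] by simp
qed

lemma isos_on_nonempty_iff:
  assumes "multigraph L" "Q \<subseteq> mverts L"
  shows "isos_on L Q K R \<noteq> {} \<longleftrightarrow> (\<exists>f k. is_iso L K f k \<and> f ` Q = R)"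
proof
  assume "\<exists>f k. is_iso L K f k \<and> f ` Q = R"
  then obtain f k where fk: "is_iso L K f k" "f ` Q = R" by blast
  have "is_iso L K (restrict f (mverts L)) (restrict k (marcs L))"
    using fk(1) by (subst is_iso_cong[OF assms(1), of _ f _ k]) auto
  moreover have "restrict f (mverts L) ` Q = R"
    using fk(2) assms(2) by (auto simp: image_iff)
  ultimately have "(restrict f (mverts L), restrict k (marcs L)) \<in> isos_on L Q K R"
    by (simp add: isos_on_def)
  then show "isos_on L Q K R \<noteq> {}" by blast
qed (auto simp: isos_on_def)

text \<open>\<open>card (S - Q)\<close> is the number of edges, so \<open>b\<close> is 0 for one
  root and 1 for none. The arcs are encoded by \<open>to_nat\<close>, while the vertices stay as
  they are.\<close>

lemma ex_nat_graph_iso_fgraph: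
  fixes S :: "nat set"
  assumes S: "finite S" and g: "g \<in> S - Q \<rightarrow> S" and conn: "Digraph_Component.connected (fst (fgraph S Q g))"
    and card: "card (S - Q) + 1 = card S + b"
  obtains K :: "(nat, nat) mgraph" and k where "K \<in> connected_graphs b" "mverts K = S" "is_iso (fgraph S Q g) K id k"
proof -
  note m = multigraph_fgraph[OF S g]
  obtain K :: "(nat, nat) mgraph" where K: "multigraph K" "mverts K = mverts (fgraph S Q g)"
      "is_iso (fgraph S Q g) K id (to_nat :: nat \<times> bool \<Rightarrow> nat)"
    using is_iso_multigraph_image[OF m, of "to_nat :: nat \<times> bool \<Rightarrow> nat"] inj_on_subset[OF inj_to_nat] by blast
  have "betti (fgraph S Q g) = int b"
    unfolding betti_eq_iff[OF m] card_marcs_fgraph[OF S] using card by simp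
  then have "K \<in> connected_graphs b"
    using is_iso_card[OF K(3)] is_iso_connected[OF m K(1,3) conn] K(1)
    by (simp add: connected_graphs_def betti_eq_iff[OF K(1)] betti_eq_iff[OF m])
  then show ?thesis using that K by simp
qed

section \<open>Labelled connected self-maps and labelled rooted trees\<close>

definition connected_maps :: "'v set \<Rightarrow> ('v \<Rightarrow> 'v) set" where
  "connected_maps S = {g \<in> S \<rightarrow>\<^sub>E S. Digraph_Component.connected (fst (fgraph S {} g))}"

definition rooted_maps :: "'v set \<Rightarrow> ('v \<times> ('v \<Rightarrow> 'v)) set" where
  "rooted_maps S = {(s, g). s \<in> S \<and> g \<in> (S - {s}) \<rightarrow>\<^sub>E S \<and> Digraph_Component.connected (fst (fgraph S {s} g))}"

lemma finite_connected_maps: "finite S \<Longrightarrow> finite (connected_maps S)"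
  unfolding connected_maps_def by (auto intro!: finite_PiE)

lemma finite_rooted_maps:
  assumes "finite S"
  shows "finite (rooted_maps S)"
proof -
  have "rooted_maps S \<subseteq> (SIGMA s : S. (S - {s}) \<rightarrow>\<^sub>E S)" by (auto simp: rooted_maps_def)
  moreover have "finite (SIGMA s : S. (S - {s}) \<rightarrow>\<^sub>E S)"
    using assms by (intro finite_SigmaI finite_PiE) auto
  ultimately show ?thesis by (rule finite_subset)
qed

lemma equiv_connected_graphs:
  "equiv (connected_graphs b) (graph_iso_rel \<inter> connected_graphs b \<times> connected_graphs b)"
proof (rule equivI)
  show "graph_iso_rel \<inter> connected_graphs b \<times> connected_graphs b \<subseteq> connected_graphs b \<times> connected_graphs b" by blast
  show "refl_on (connected_graphs b) (graph_iso_rel \<inter> connected_graphs b \<times> connected_graphs b)"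
    using is_iso_refl by (fastforce simp: refl_on_def graph_iso_rel_def)
  show "sym (graph_iso_rel \<inter> connected_graphs b \<times> connected_graphs b)"
    by (rule symI) (auto simp: graph_iso_rel_def connected_graphs_def dest: is_iso_sym)
  show "trans (graph_iso_rel \<inter> connected_graphs b \<times> connected_graphs b)"
    by (rule transI) (auto simp: graph_iso_rel_def dest: is_iso_trans)
qed

lemma equiv_rooted_trees:
  "equiv rooted_trees (rooted_iso_rel \<inter> rooted_trees \<times> rooted_trees)"
proof (rule equivI)
  show "rooted_iso_rel \<inter> rooted_trees \<times> rooted_trees \<subseteq> rooted_trees \<times> rooted_trees" by blast
  show "refl_on rooted_trees (rooted_iso_rel \<inter> rooted_trees \<times> rooted_trees)"
    using is_iso_refl by (fastforce simp: refl_on_def rooted_iso_rel_def)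
  show "sym (rooted_iso_rel \<inter> rooted_trees \<times> rooted_trees)"
  proof (rule symI)
    fix x y assume "(x, y) \<in> rooted_iso_rel \<inter> rooted_trees \<times> rooted_trees"
    then obtain K r L f g where *: "x = (K, r)" "y = (L, f r)" "is_iso K L f g" "x \<in> rooted_trees" "y \<in> rooted_trees"
      by (auto simp: rooted_iso_rel_def)
    then have K: "multigraph K" "r \<in> mverts K" by (auto simp: rooted_trees_def connected_graphs_def)
    have "inv_into (mverts K) f (f r) = r"
      using is_isoD(1)[OF *(3)] K(2) by (simp add: bij_betw_inv_into_left)
    then show "(y, x) \<in> rooted_iso_rel \<inter> rooted_trees \<times> rooted_trees"
      using is_iso_sym[OF K(1) *(3)] * by (auto simp: rooted_iso_rel_def)
  qed
  show "trans (rooted_iso_rel \<inter> rooted_trees \<times> rooted_trees)"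
  proof (rule transI)
    fix x y z assume "(x, y) \<in> rooted_iso_rel \<inter> rooted_trees \<times> rooted_trees"
      "(y, z) \<in> rooted_iso_rel \<inter> rooted_trees \<times> rooted_trees"
    then obtain K r L f g M f' g' where *: "x = (K, r)" "y = (L, f r)" "is_iso K L f g"
        "z = (M, f' (f r))" "is_iso L M f' g'" "x \<in> rooted_trees" "z \<in> rooted_trees"
      by (auto simp: rooted_iso_rel_def)
    then show "(x, z) \<in> rooted_iso_rel \<inter> rooted_trees \<times> rooted_trees"
      using is_iso_trans[OF *(3,5)] by (auto simp: rooted_iso_rel_def)
  qed
qed

text \<open>Provides the compatibility condition of \<open>sum_representatives\<close> for rooted
  structures, by composing with \<open>f\<close> or its inverse.\<close>

lemma is_iso_iff_iso_rel:
  assumes L: "multigraph L" and K: "multigraph K" and iso: "is_iso L K f k" and fr: "f ` Q = {r}" and Q: "Q \<subseteq> mverts L"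
  shows "(\<exists>f k. is_iso L M f k \<and> f ` Q = {s}) \<longleftrightarrow> (\<exists>f k. is_iso K M f k \<and> f r = s)"
proof
  assume "\<exists>f k. is_iso K M f k \<and> f r = s"
  then obtain f' k' where *: "is_iso K M f' k'" "f' r = s" by blast
  have "(f' \<circ> f) ` Q = {s}" unfolding image_comp[symmetric] fr using * by simp
  then show "\<exists>f k. is_iso L M f k \<and> f ` Q = {s}"
    using is_iso_trans[OF iso *(1)] by blast
next
  assume "\<exists>f k. is_iso L M f k \<and> f ` Q = {s}"
  then obtain f' k' where *: "is_iso L M f' k'" "f' ` Q = {s}" by blast
  have "inv_into (mverts L) f ` f ` Q = Q"
    using is_isoD(1)[OF iso] Q by (simp add: bij_betw_def image_inv_into_cancel inv_into_image_cancel)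
  then have "(f' \<circ> inv_into (mverts L) f) ` {r} = {s}"
    using * fr by (simp only: image_comp[symmetric])
  then have "(f' \<circ> inv_into (mverts L) f) r = s" by simp
  then show "\<exists>f k. is_iso K M f k \<and> f r = s"
    using is_iso_trans[OF is_iso_sym[OF L iso] *(1)] by blast
qed

lemma black_white_W_eq_colored_sum: "black_white_W K = colored_sum (\<lambda>_ _. True) K r"
  by (simp add: black_white_W_def colored_sum_def)

text \<open>By \<open>card_labelled\<close> without roots and the two orientations of a unicyclic
  graph, an isomorphism class has \<open>2 * fact (card S) / card (Aut K)\<close> labellings by
  self-maps. This is the origin of the factor 2.\<close>

lemma W_series_1_nth:
  fixes S :: "nat set"
  assumes S: "finite S"
  shows "fps_nth (W_series 1) (card S) =
    (\<Sum>g\<in>connected_maps S. black_white_W (fgraph S {} g)) / of_nat (2 * fact (card S))"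
proof -
  let ?r = "graph_iso_rel \<inter> connected_graphs 1 \<times> connected_graphs 1"
  have mg: "multigraph (fgraph S {} g)" if "g \<in> connected_maps S" for g
    using that S by (intro multigraph_fgraph) (auto simp: connected_maps_def)
  have "fps_nth (W_series 1) (card S) =
    (\<Sum>K \<in> representative ` {C \<in> connected_graphs 1 // ?r. card (mverts (representative C)) = card S}.
       black_white_W K / of_nat (card (Aut K)))"
    by (simp add: W_series_def Gamma_def)
  also have "\<dots> = (\<Sum>g\<in>connected_maps S. black_white_W (fgraph S {} g)) / of_nat (2 * fact (card S))"
  proof (rule sum_representatives[where I = "\<lambda>g K. \<exists>f k. is_iso (fgraph S {} g) K f k", OF equiv_connected_graphs finite_connected_maps[OF S]])
    show "\<exists>K\<in>connected_graphs 1. card (mverts K) = card S \<and> (\<exists>f k. is_iso (fgraph S {} g) K f k)"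
      if "g \<in> connected_maps S" for g
    proof -
      have "g \<in> S - {} \<rightarrow> S" "Digraph_Component.connected (fst (fgraph S {} g))" "card (S - {}) + 1 = card S + 1"
        using that by (auto simp: connected_maps_def)
      then obtain K k where "K \<in> connected_graphs 1" "mverts K = S" "is_iso (fgraph S {} g) K id k"
        using ex_nat_graph_iso_fgraph[OF S] by blast
      then show ?thesis by (intro bexI[of _ K]) auto
    qed
    show "(\<exists>f k. is_iso (fgraph S {} g) L f k) \<longleftrightarrow> (K, L) \<in> ?r"
      if g: "g \<in> connected_maps S" and K: "\<exists>f k. is_iso (fgraph S {} g) K f k" and KL: "K \<in> connected_graphs 1" "L \<in> connected_graphs 1" for g K L
    proof -
      obtain f k where iso: "is_iso (fgraph S {} g) K f k" using K by blast
      have "(\<exists>f k. is_iso (fgraph S {} g) L f k) \<longleftrightarrow> (\<exists>f k. is_iso K L f k)"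
        using is_iso_trans[OF iso, of L] is_iso_trans[OF is_iso_sym[OF mg[OF g] iso], of L] by blast
      then show ?thesis using KL by (simp add: graph_iso_rel_def)
    qed
    show "card (mverts L) = card S" if "(K, L) \<in> ?r" "card (mverts K) = card S" for K L
      using that by (auto simp: graph_iso_rel_def dest!: is_iso_card(1))
    show "black_white_W (fgraph S {} g) = black_white_W K"
      if g: "g \<in> connected_maps S" and K: "\<exists>f k. is_iso (fgraph S {} g) K f k" for g K
    proof -
      obtain f k where iso: "is_iso (fgraph S {} g) K f k" using K by blast
      obtain v where "v \<in> S" using connected_nonempty[OF mg[OF g]] g by (auto simp: connected_maps_def)
      then show ?thesis
        using colored_sum_iso[OF mg[OF g] iso, of v "\<lambda>_ _. True"]
        by (simp add: black_white_W_eq_colored_sum[of _ v] black_white_W_eq_colored_sum[of _ "f v"])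
    qed
    show "card {g \<in> connected_maps S. \<exists>f k. is_iso (fgraph S {} g) K f k} * card (Aut K) = 2 * fact (card S)"
      if K: "K \<in> connected_graphs 1" and cK: "card (mverts K) = card S" for K
    proof -
      have mK: "multigraph K" using K by (simp add: connected_graphs_def)
      \<comment> \<open>Being mapped onto the empty set forces \<open>Q = {}\<close>, so the pairs
        in \<open>card_labelled\<close> carry no more information than the map.\<close>
      have "bij_betw (Pair {}) {g \<in> connected_maps S. \<exists>f k. is_iso (fgraph S {} g) K f k}
          {(Q, g). Q \<subseteq> S \<and> g \<in> (S - Q) \<rightarrow>\<^sub>E S \<and> isos_on (fgraph S Q g) Q K {} \<noteq> {}}"
      proof (rule bij_betw_imageI)
        show "Pair {} ` {g \<in> connected_maps S. \<exists>f k. is_iso (fgraph S {} g) K f k} =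
            {(Q, g). Q \<subseteq> S \<and> g \<in> (S - Q) \<rightarrow>\<^sub>E S \<and> isos_on (fgraph S Q g) Q K {} \<noteq> {}}" (is "?A = ?B")
        proof (intro equalityI subsetI)
          fix p assume "p \<in> ?A"
          then obtain g where g: "p = ({}, g)" "g \<in> connected_maps S" "\<exists>f k. is_iso (fgraph S {} g) K f k" by blast
          then show "p \<in> ?B"
            using isos_on_nonempty_iff[OF mg[OF g(2)], of "{}" K "{}"] by (simp add: connected_maps_def)
        next
          fix p assume "p \<in> ?B"
          then obtain Q g where g: "p = (Q, g)" "Q \<subseteq> S" "g \<in> (S - Q) \<rightarrow>\<^sub>E S" "isos_on (fgraph S Q g) Q K {} \<noteq> {}" by blast
          have m: "multigraph (fgraph S Q g)" using g S by (intro multigraph_fgraph) auto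
          obtain f k where iso: "is_iso (fgraph S Q g) K f k" "f ` Q = {}"
            using g(4) by (auto simp: isos_on_def)
          have "Digraph_Component.connected (fst (fgraph S Q g))"
            using is_iso_connected[OF mK m is_iso_sym[OF m iso(1)]] K by (simp add: connected_graphs_def)
          then show "p \<in> ?A" using g iso by (auto simp: connected_maps_def)
        qed
      qed (simp add: inj_on_def)
      moreover have "Aut_on K {} = Aut K" by (auto simp: Aut_on_def)
      ultimately show ?thesis
        using card_labelled[OF mK _ S cK[symmetric], of "{}"] card_orientations_unicyclic[OF K]
        by (simp add: bij_betw_same_card)
    qed
  qed simp
  finally show ?thesis .
qed

text \<open>The same count with root set \<open>{q}\<close>: a rooted tree has a single orientation,
  so \<open>fact (card S)\<close> alone is the normalization.\<close>

lemma tree_series_nth: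
  fixes S :: "nat set"
  assumes S: "finite S"
  shows "fps_nth (tree_series P) (card S) =
    (\<Sum>(s, g)\<in>rooted_maps S. colored_sum P (fgraph S {s} g) s) / of_nat (fact (card S))"
proof -
  let ?r = "rooted_iso_rel \<inter> rooted_trees \<times> rooted_trees"
  let ?I = "\<lambda>(s, g) (K, q). \<exists>f k. is_iso (fgraph S {s} g) K f k \<and> f ` {s} = {q}"
  have mg: "multigraph (fgraph S {s} g)" if "(s, g) \<in> rooted_maps S" for s g
    using that S by (intro multigraph_fgraph) (auto simp: rooted_maps_def)
  have "fps_nth (tree_series P) (card S) =
    (\<Sum>p \<in> representative ` {C \<in> rooted_trees // ?r. card (mverts (fst (representative C))) = card S}.
       (case p of (K, r) \<Rightarrow> colored_sum P K r) / of_nat (case p of (K, r) \<Rightarrow> card (rooted_Aut (K, r))))"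
    unfolding tree_series_def rooted_tree_classes_def
    by (simp add: case_prod_unfold colored_sum_def sum_divide_distrib)
  also have "\<dots> = (\<Sum>x\<in>rooted_maps S. case x of (s, g) \<Rightarrow> colored_sum P (fgraph S {s} g) s) / of_nat (fact (card S))"
  proof (rule sum_representatives[where I = ?I, OF equiv_rooted_trees finite_rooted_maps[OF S]])
    show "\<exists>K\<in>rooted_trees. card (mverts (fst K)) = card S \<and> ?I x K" if x: "x \<in> rooted_maps S" for x
    proof -
      obtain s g where sg: "x = (s, g)" by (cases x)
      have s: "s \<in> S" "g \<in> S - {s} \<rightarrow> S" "Digraph_Component.connected (fst (fgraph S {s} g))"
        using x by (auto simp: sg rooted_maps_def)
      have "card (S - {s}) + 1 = card S + 0" using card.remove[OF S s(1)] by linarith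
      then obtain K k where K: "K \<in> connected_graphs 0" "mverts K = S" "is_iso (fgraph S {s} g) K id k"
        using ex_nat_graph_iso_fgraph[OF S s(2,3)] by blast
      then show ?thesis
        using s(1) by (intro bexI[of _ "(K, s)"]) (auto simp: sg rooted_trees_def intro!: exI[of _ id])
    qed
    show "?I x L \<longleftrightarrow> (K, L) \<in> ?r"
      if x: "x \<in> rooted_maps S" and I: "?I x K" and KL: "K \<in> rooted_trees" "L \<in> rooted_trees" for x K L
    proof -
      obtain s g K' q L' q' where *: "x = (s, g)" "K = (K', q)" "L = (L', q')" by (metis surj_pair)
      have s: "s \<in> S" "(s, g) \<in> rooted_maps S" "multigraph K'" using x KL by (auto simp: * rooted_maps_def rooted_trees_def connected_graphs_def)
      obtain f k where fk: "is_iso (fgraph S {s} g) K' f k" "f ` {s} = {q}" using I by (auto simp: *)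
      show ?thesis
        using is_iso_iff_iso_rel[OF mg[OF s(2)] s(3) fk, of L' q'] s(1) KL
        by (simp add: * rooted_iso_rel_def)
    qed
    show "card (mverts (fst L)) = card S" if "(K, L) \<in> ?r" "card (mverts (fst K)) = card S" for K L
      using that by (auto simp: rooted_iso_rel_def dest!: is_iso_card(1))
    show "(case x of (s, g) \<Rightarrow> colored_sum P (fgraph S {s} g) s) = (case K of (K, r) \<Rightarrow> colored_sum P K r)"
      if x: "x \<in> rooted_maps S" and I: "?I x K" for x K
    proof -
      obtain s g K' q where *: "x = (s, g)" "K = (K', q)" by (metis surj_pair)
      obtain f k where fk: "is_iso (fgraph S {s} g) K' f k" "f s = q" using I by (auto simp: *)
      have "s \<in> S" "(s, g) \<in> rooted_maps S" using x by (auto simp: * rooted_maps_def)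
      then show ?thesis
        using colored_sum_iso[OF mg fk(1), of s P] fk(2) by (simp add: *)
    qed
    show "card {x \<in> rooted_maps S. ?I x p} * (case p of (K, r) \<Rightarrow> card (rooted_Aut (K, r))) = fact (card S)"
      if p: "p \<in> rooted_trees" and cK: "card (mverts (fst p)) = card S" for p
    proof -
      obtain K q where Kq: "p = (K, q)" by (cases p)
      have K: "K \<in> connected_graphs 0" "q \<in> mverts K" "card S = card (mverts K)" using p cK by (auto simp: Kq rooted_trees_def)
      have mK: "multigraph K" using K by (simp add: connected_graphs_def)
      have "bij_betw (\<lambda>(s, g). ({s}, g)) {x \<in> rooted_maps S. ?I x (K, q)}
          {(Q, g). Q \<subseteq> S \<and> g \<in> (S - Q) \<rightarrow>\<^sub>E S \<and> isos_on (fgraph S Q g) Q K {q} \<noteq> {}}"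
      proof (rule bij_betw_imageI)
        show "(\<lambda>(s, g). ({s}, g)) ` {x \<in> rooted_maps S. ?I x (K, q)} =
            {(Q, g). Q \<subseteq> S \<and> g \<in> (S - Q) \<rightarrow>\<^sub>E S \<and> isos_on (fgraph S Q g) Q K {q} \<noteq> {}}" (is "?A = ?B")
        proof (intro equalityI subsetI)
          fix p assume "p \<in> ?A"
          then obtain x where x: "p = (\<lambda>(s, g). ({s}, g)) x" "x \<in> rooted_maps S" "?I x (K, q)" by blast
          obtain s g where "x = (s, g)" by (cases x)
          then have g: "p = ({s}, g)" "(s, g) \<in> rooted_maps S" "?I (s, g) (K, q)" using x by auto
          then show "p \<in> ?B"
            using isos_on_nonempty_iff[OF mg[OF g(2)], of "{s}" K "{q}"] by (simp add: rooted_maps_def)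
        next
          fix p assume "p \<in> ?B"
          then obtain Q g where g: "p = (Q, g)" "Q \<subseteq> S" "g \<in> (S - Q) \<rightarrow>\<^sub>E S" "isos_on (fgraph S Q g) Q K {q} \<noteq> {}" by blast
          have m: "multigraph (fgraph S Q g)" using g S by (intro multigraph_fgraph) auto
          obtain f k where iso: "is_iso (fgraph S Q g) K f k" "f ` Q = {q}"
            using g(4) by (auto simp: isos_on_def)
          have "Digraph_Component.connected (fst (fgraph S Q g))"
            using is_iso_connected[OF mK m is_iso_sym[OF m iso(1)]] K by (simp add: connected_graphs_def)
          \<comment> \<open>A set mapped injectively onto a singleton is a singleton; its element is
            the root of the labelled tree.\<close>
          moreover have "inj_on f Q"
            using is_isoD(1)[OF iso(1)] g(2) by (auto simp: bij_betw_def intro: inj_on_subset)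
          then have "card Q = 1" using card_image[of f Q] iso(2) by simp
          then obtain s where "Q = {s}" by (rule card_1_singletonE)
          ultimately show "p \<in> ?A" using g iso by (force simp: rooted_maps_def image_iff)
        qed
      qed (auto simp: inj_on_def)
      moreover have "Aut_on K {q} = rooted_Aut (K, q)" by (auto simp: Aut_on_def rooted_Aut_def)
      ultimately show ?thesis
        using card_labelled[OF mK _ S K(3), of "{q}"] card_orientations_tree[OF K(1,2)] K(2)
        by (simp add: bij_betw_same_card Kq)
    qed
  qed simp
  finally show ?thesis .
qed


section \<open>Rooted forests\<close>

lemma connected_fgraph_iff:
  assumes S: "finite S" and g: "g \<in> S - Q \<rightarrow> S"
  shows "Digraph_Component.connected (fst (fgraph S Q g)) \<longleftrightarrow> S \<noteq> {} \<and> weakly_connected S Q g"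
proof -
  have "(\<forall>a\<in>(S - Q) \<times> UNIV. mtail (fgraph S Q g) a \<in> A \<longrightarrow> mhead (fgraph S Q g) a \<in> A) \<longleftrightarrow>
      (\<forall>v\<in>S - Q. v \<in> A \<longleftrightarrow> g v \<in> A)" for A
    by (auto split: if_splits)
  then show ?thesis
    unfolding connected_iff_closed[OF multigraph_fgraph[OF assms]] weakly_connected_def by simp
qed

text \<open>Every orbit enters \<open>C\<close>, so a nonempty union of components meets
  \<open>C\<close> and contains it by \<open>core\<close>. Its complement is then an invariant set
  avoiding \<open>C\<close>, hence empty.\<close>

lemma acyclic_on_imp_weakly_connected:
  assumes acyc: "acyclic_on (V - C) f" and C: "R \<subseteq> C" "f \<in> V - R \<rightarrow> V"
    and core: "\<And>A. A \<subseteq> V \<Longrightarrow> A \<inter> C \<noteq> {} \<Longrightarrow> (\<And>v. v \<in> V \<Longrightarrow> v \<notin> R \<Longrightarrow> v \<in> A \<longleftrightarrow> f v \<in> A) \<Longrightarrow> C \<subseteq> A"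
  shows "weakly_connected V R f"
  unfolding weakly_connected_def
proof (intro allI impI)
  fix A assume A: "A \<subseteq> V" "A \<noteq> {}" and bi: "\<forall>v\<in>V - R. v \<in> A \<longleftrightarrow> f v \<in> A"
  have "A \<inter> C \<noteq> {}"
  proof
    assume "A \<inter> C = {}"
    then have "A = {}"
      using A bi C(1) by (intro acyclic_onD[OF acyc]) auto
    then show False using A by simp
  qed
  then have CA: "C \<subseteq> A" using core[OF A(1)] bi by auto
  have "V - A = {}"
  proof (rule acyclic_onD[OF acyc])
    show "V - A \<subseteq> V - C" using CA by blast
    fix v assume v: "v \<in> V - A"
    then have "v \<in> V - R" using CA C(1) by blast
    then show "f v \<in> V - A" using v bi C(2) by auto
  qed
  then show "A = V" using A by blast
qed

text \<open>\<open>g\<close> is a parent map; acyclicity says that every path of parents reaches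
  \<open>R\<close>, so the components are trees with one root each.\<close>

definition forests :: "'v set \<Rightarrow> 'v set \<Rightarrow> ('v \<Rightarrow> 'v) set" where
  "forests S R = {g \<in> (S - R) \<rightarrow>\<^sub>E S. acyclic_on (S - R) g}"

lemma finite_forests: "finite S \<Longrightarrow> finite (forests S R)"
  unfolding forests_def by (rule finite_subset[of _ "(S - R) \<rightarrow>\<^sub>E S"]) (auto intro!: finite_PiE)

lemma rooted_maps_eq_forests:
  assumes "finite S"
  shows "rooted_maps S = (SIGMA s : S. forests S {s})"
proof -
  have "Digraph_Component.connected (fst (fgraph S {s} g)) \<longleftrightarrow> acyclic_on (S - {s}) g"
    if s: "s \<in> S" and g: "g \<in> (S - {s}) \<rightarrow>\<^sub>E S" for s g
  proof -
    have g': "g \<in> S - {s} \<rightarrow> S" using g by auto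
    have "weakly_connected S {s} g \<longleftrightarrow> acyclic_on (S - {s}) g"
    proof
      assume "weakly_connected S {s} g"
      then show "acyclic_on (S - {s}) g"
        using s by (intro weakly_connected_imp_acyclic_on[of S "{s}"]) auto
    next
      assume "acyclic_on (S - {s}) g"
      then show "weakly_connected S {s} g"
        using g' by (intro acyclic_on_imp_weakly_connected[of S "{s}" g "{s}"]) auto
    qed
    then show ?thesis using s connected_fgraph_iff[OF assms g'] by auto
  qed
  then show ?thesis by (auto simp: rooted_maps_def forests_def)
qed

text \<open>\<open>e v\<close> counts black neighbours of \<open>v\<close> along edges that do not belong to \<open>K\<close>.\<close>

definition weight :: "('v, 'a) mgraph \<Rightarrow> ('v \<Rightarrow> nat) \<Rightarrow> ('v \<Rightarrow> nat) \<Rightarrow> t_laurent" where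
  "weight K e c = (\<Prod>v\<in>mverts K. if c v = 0 \<and> even (black_count K c v + e v) then tvar else 1)"

lemma power_card_white_even:
  assumes "finite (mverts K)"
  shows "tvar ^ card (white_even K c) = weight K (\<lambda>_. 0) c"
proof -
  have "weight K (\<lambda>_. 0) c = (\<Prod>v\<in>white_even K c. tvar)"
    unfolding weight_def white_even_def using assms by (subst prod.inter_filter) auto
  then show ?thesis by simp
qed

text \<open>\<open>U\<close> is a union of components, so the arcs at a vertex of \<open>U\<close>
  stay inside \<open>U\<close>.\<close>

lemma black_count_component:
  assumes U: "U \<subseteq> S" and g: "\<And>v. v \<in> S \<Longrightarrow> v \<notin> R \<Longrightarrow> g v \<in> U \<longleftrightarrow> v \<in> U"
    and R': "R' = R \<inter> U" and g': "\<And>v. v \<in> U \<Longrightarrow> v \<notin> R \<Longrightarrow> g' v = g v" and c': "\<And>v. v \<in> U \<Longrightarrow> c' v = c v"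
    and v: "v \<in> U"
  shows "black_count (fgraph S R g) c v = black_count (fgraph U R' g') c' v"
proof -
  have "{a \<in> marcs (fgraph S R g). mtail (fgraph S R g) a = v \<and> mhead (fgraph S R g) a \<noteq> v \<and> c (mhead (fgraph S R g) a) = 1}
    = {a \<in> marcs (fgraph U R' g'). mtail (fgraph U R' g') a = v \<and> mhead (fgraph U R' g') a \<noteq> v \<and> c' (mhead (fgraph U R' g') a) = 1}"
  proof (rule set_eqI)
    fix a :: "'a \<times> bool"
    obtain w d where a: "a = (w, d)" by (cases a)
    show "a \<in> {a \<in> marcs (fgraph S R g). mtail (fgraph S R g) a = v \<and> mhead (fgraph S R g) a \<noteq> v \<and> c (mhead (fgraph S R g) a) = 1}
      \<longleftrightarrow> a \<in> {a \<in> marcs (fgraph U R' g'). mtail (fgraph U R' g') a = v \<and> mhead (fgraph U R' g') a \<noteq> v \<and> c' (mhead (fgraph U R' g') a) = 1}"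
    proof (cases "w \<in> S \<and> w \<notin> R")
      case True
      then show ?thesis
        using U R' g[of w] g'[of w] c'[of w] c'[of "g w"] v by (cases d) (auto simp: a)
    next
      case False
      then show ?thesis using U R' by (auto simp: a)
    qed
  qed
  then show ?thesis unfolding black_count_def by simp
qed

text \<open>An extensional function on a disjoint union is a pair of extensional functions. Both the
  parent maps and the colorings of a forest are split in this way.\<close>

lemma bij_betw_restrict_split:
  assumes AB: "A \<inter> B = {}" and P: "P \<subseteq> extensional (A \<union> B)" and Q: "Q \<subseteq> extensional A \<times> extensional B"
    and iff: "\<And>h. h \<in> extensional (A \<union> B) \<Longrightarrow> h \<in> P \<longleftrightarrow> (restrict h A, restrict h B) \<in> Q"
  shows "bij_betw (\<lambda>h. (restrict h A, restrict h B)) P Q"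
proof (rule bij_betwI[where g = "\<lambda>(h1, h2). \<lambda>v\<in>A \<union> B. if v \<in> A then h1 v else h2 v"])
  show "(\<lambda>h. (restrict h A, restrict h B)) \<in> P \<rightarrow> Q" using P iff by blast
  have inv: "(restrict (\<lambda>v\<in>A \<union> B. if v \<in> A then h1 v else h2 v) A, restrict (\<lambda>v\<in>A \<union> B. if v \<in> A then h1 v else h2 v) B) = (h1, h2)"
    if "h1 \<in> extensional A" "h2 \<in> extensional B" for h1 h2 :: "'a \<Rightarrow> 'b"
  proof -
    have "restrict (\<lambda>v\<in>A \<union> B. if v \<in> A then h1 v else h2 v) A = h1"
      using that(1) by (auto simp: restrict_def extensional_def fun_eq_iff)
    moreover have "restrict (\<lambda>v\<in>A \<union> B. if v \<in> A then h1 v else h2 v) B = h2"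
    proof (rule ext)
      show "restrict (\<lambda>v\<in>A \<union> B. if v \<in> A then h1 v else h2 v) B v = h2 v" for v
        using AB that(2) by (cases "v \<in> B") (auto simp: extensional_def)
    qed
    ultimately show ?thesis by simp
  qed
  show "(\<lambda>(h1, h2). \<lambda>v\<in>A \<union> B. if v \<in> A then h1 v else h2 v) \<in> Q \<rightarrow> P"
  proof (rule Pi_I)
    fix p assume p: "p \<in> Q"
    obtain h1 h2 where h: "p = (h1, h2)" by (cases p)
    then have "h1 \<in> extensional A" "h2 \<in> extensional B" using p Q by auto
    from inv[OF this] show "(case p of (h1, h2) \<Rightarrow> \<lambda>v\<in>A \<union> B. if v \<in> A then h1 v else h2 v) \<in> P"
      using p by (subst iff) (simp_all add: h)
  qed
  show "(case (restrict h A, restrict h B) of (h1, h2) \<Rightarrow> \<lambda>v\<in>A \<union> B. if v \<in> A then h1 v else h2 v) = h" if "h \<in> P" for h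
  proof -
    have "h \<in> extensional (A \<union> B)" using P that by blast
    then have "(\<lambda>v\<in>A \<union> B. if v \<in> A then restrict h A v else restrict h B v) v = h v" for v
      by (cases "v \<in> A \<union> B") (auto simp: extensional_def)
    then show ?thesis by auto
  qed
  show "(restrict (case p of (h1, h2) \<Rightarrow> \<lambda>v\<in>A \<union> B. if v \<in> A then h1 v else h2 v) A,
      restrict (case p of (h1, h2) \<Rightarrow> \<lambda>v\<in>A \<union> B. if v \<in> A then h1 v else h2 v) B) = p" if "p \<in> Q" for p
  proof -
    obtain h1 h2 where h: "p = (h1, h2)" by (cases p)
    then have "h1 \<in> extensional A" "h2 \<in> extensional B" using that Q by auto
    from inv[OF this] show ?thesis by (simp only: h prod.case)
  qed
qed

text \<open>Roots carry their data by position because they will be listed in cycle order. Vertices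
  that are not roots receive the default 0.\<close>

definition root_extra :: "'v list \<Rightarrow> nat list \<Rightarrow> 'v \<Rightarrow> nat" where
  "root_extra r es v = (case map_of (zip r es) v of None \<Rightarrow> 0 | Some e \<Rightarrow> e)"

lemma root_extra_Cons: "root_extra (x # r) (e # es) v = (if v = x then e else root_extra r es v)"
  by (simp add: root_extra_def)

lemma root_extra_notin: "v \<notin> set r \<Longrightarrow> root_extra r es v = 0"
proof -
  assume "v \<notin> set r"
  then have "map_of (zip r es) v = None"
    by (auto simp: map_of_eq_None_iff dest: set_zip_leftD)
  then show ?thesis by (simp add: root_extra_def)
qed

definition root_colorings :: "'v set \<Rightarrow> 'v list \<Rightarrow> nat list \<Rightarrow> ('v \<Rightarrow> nat) set" where
  "root_colorings S r cs = {c \<in> S \<rightarrow>\<^sub>E {0, 1}. map c r = cs}"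

lemma finite_root_colorings: "finite S \<Longrightarrow> finite (root_colorings S r cs)"
  unfolding root_colorings_def by (rule finite_subset[of _ "S \<rightarrow>\<^sub>E {0, 1}"]) (auto intro!: finite_PiE)

text \<open>
  The list \<open>ps\<close> prescribes for each root in \<open>r\<close> its color and the number of its additional
  black neighbours.
\<close>

definition rooted_forest_sum :: "'v set \<Rightarrow> 'v list \<Rightarrow> (nat \<times> nat) list \<Rightarrow> t_laurent" where
  "rooted_forest_sum S r ps = (\<Sum>g\<in>forests S (set r). \<Sum>c\<in>root_colorings S r (map fst ps).
     weight (fgraph S (set r) g) (root_extra r (map snd ps)) c)"

definition root_lists :: "'v set \<Rightarrow> nat \<Rightarrow> 'v list set" where
  "root_lists S n = {r. length r = n \<and> distinct r \<and> set r \<subseteq> S}"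

definition forest_sum :: "'v set \<Rightarrow> (nat \<times> nat) list \<Rightarrow> t_laurent" where
  "forest_sum S ps = (\<Sum>r\<in>root_lists S (length ps). rooted_forest_sum S r ps)"

lemma finite_root_lists: "finite S \<Longrightarrow> finite (root_lists S n)"
  unfolding root_lists_def by (rule finite_subset[OF _ finite_lists_length_eq[of S n]]) auto

text \<open>The vertices whose path ends in \<open>x\<close>.\<close>

lemma ex1_component:
  assumes g: "g \<in> forests S R" and x: "x \<in> R" "R \<subseteq> S"
  shows "\<exists>!U. x \<in> U \<and> U \<subseteq> S - (R - {x}) \<and> (\<forall>v\<in>S - R. g v \<in> U \<longleftrightarrow> v \<in> U)"
proof -
  have acyc: "acyclic_on (S - R) g" and gS: "\<And>v. v \<in> S \<Longrightarrow> v \<notin> R \<Longrightarrow> g v \<in> S"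
    using g by (auto simp: forests_def)
  \<comment> \<open>\<open>U\<close> will be the least set that contains \<open>x\<close> and is
    closed under preimages.\<close>
  define G where "G = {U. x \<in> U \<and> (\<forall>v\<in>S - R. g v \<in> U \<longrightarrow> v \<in> U)}"
  define U where "U = \<Inter>G"
  have xU: "x \<in> U" by (auto simp: U_def G_def)
  have bwd: "v \<in> U" if "v \<in> S - R" "g v \<in> U" for v
    using that by (auto simp: U_def G_def)
  have least: "U \<subseteq> U'" if "x \<in> U'" "\<And>v. v \<in> S \<Longrightarrow> v \<notin> R \<Longrightarrow> g v \<in> U' \<Longrightarrow> v \<in> U'" for U'
    using that unfolding U_def G_def by blast
  have sub: "U \<subseteq> S - (R - {x})"
    using x by (intro least) auto
  \<comment> \<open>If \<open>g v\<close> were outside \<open>U\<close>, removing \<open>v\<close>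
    would preserve closure under preimages and contradict minimality; \<open>x\<close> survives the
    removal because it is a root and \<open>v\<close> is not.\<close>
  have fwd: "g v \<in> U" if v: "v \<in> S - R" "v \<in> U" for v
  proof (rule ccontr)
    assume n: "g v \<notin> U"
    have "U \<subseteq> U - {v}"
      using xU x(1) v bwd n by (intro least) auto
    then show False using v by blast
  qed
  \<comment> \<open>Two candidates contain the same root \<open>x\<close> and no other, so their
    differences are invariant sets without roots, which acyclicity makes empty.\<close>
  have uniq: "U1 = U2" if U1: "x \<in> U1" "U1 \<subseteq> S - (R - {x})" "\<forall>v\<in>S - R. g v \<in> U1 \<longleftrightarrow> v \<in> U1"
    and U2: "x \<in> U2" "U2 \<subseteq> S - (R - {x})" "\<forall>v\<in>S - R. g v \<in> U2 \<longleftrightarrow> v \<in> U2" for U1 U2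
  proof -
    have "A - B = {}" if A: "x \<in> A" "A \<subseteq> S - (R - {x})" "\<forall>v\<in>S - R. g v \<in> A \<longleftrightarrow> v \<in> A"
      and B: "x \<in> B" "\<forall>v\<in>S - R. g v \<in> B \<longleftrightarrow> v \<in> B" for A B
    proof (rule acyclic_onD[OF acyc])
      show AB: "A - B \<subseteq> S - R" using A(2) B(1) by blast
      show "g v \<in> A - B" if "v \<in> A - B" for v
        using that AB A(3) B(2) by blast
    qed
    from this[OF U1 U2(1,3)] this[OF U2 U1(1,3)] show ?thesis by blast
  qed
  show ?thesis
  proof (rule ex1I[of _ U])
    show "x \<in> U \<and> U \<subseteq> S - (R - {x}) \<and> (\<forall>v\<in>S - R. g v \<in> U \<longleftrightarrow> v \<in> U)"
      using xU sub fwd bwd by blast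
    then show "U' = U" if "x \<in> U' \<and> U' \<subseteq> S - (R - {x}) \<and> (\<forall>v\<in>S - R. g v \<in> U' \<longleftrightarrow> v \<in> U')" for U'
      using uniq that by blast
  qed
qed

text \<open>\<open>U\<close> is the vertex set of the tree at \<open>x\<close>. Cutting it off
  leaves a forest on \<open>S - U\<close> with the other roots, and parent maps, colorings and
  weights all split accordingly.\<close>

lemma rooted_forest_sum_Cons:
  assumes S: "finite S" and x: "x \<in> S" "x \<notin> set r" and r: "set r \<subseteq> S"
  shows "rooted_forest_sum S (x # r) (p # ps) =
    (\<Sum>U\<in>{U \<in> Pow S. x \<in> U \<and> set r \<inter> U = {}}. rooted_forest_sum U [x] [p] * rooted_forest_sum (S - U) r ps)"
proof -
  define R where "R = set (x # r)"
  have R: "R = insert x (set r)" "R - {x} = set r" "R \<subseteq> S" "x \<in> R" using x r by (auto simp: R_def)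
  define bi where "bi = (\<lambda>g U. \<forall>v\<in>S - R. g v \<in> U \<longleftrightarrow> v \<in> U)"
  define \<U> where "\<U> = {U \<in> Pow S. x \<in> U \<and> set r \<inter> U = {}}"
  have \<U>_iff: "U \<in> \<U> \<longleftrightarrow> x \<in> U \<and> U \<subseteq> S - (R - {x})" for U
    unfolding \<U>_def R(2) by auto
  define e where "e = root_extra (x # r) (map snd (p # ps))"
  define C where "C = root_colorings S (x # r) (map fst (p # ps))"
  define W where "W = (\<lambda>g c. weight (fgraph S R g) e c)"
  have "rooted_forest_sum S (x # r) (p # ps) = (\<Sum>g\<in>forests S R. \<Sum>c\<in>C. W g c)"
    by (simp only: rooted_forest_sum_def R_def W_def e_def C_def)
  \<comment> \<open>Each \<open>g\<close> admits exactly one \<open>U\<close>, so the inserted sum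
    has a single term; afterwards the sums over \<open>g\<close> and \<open>U\<close> can be
    exchanged.\<close>
  also have "\<dots> = (\<Sum>g\<in>forests S R. \<Sum>U\<in>{U \<in> \<U>. bi g U}. \<Sum>c\<in>C. W g c)"
  proof (rule sum.cong[OF refl])
    fix g assume "g \<in> forests S R"
    then have "\<exists>!U. U \<in> \<U> \<and> bi g U"
      using ex1_component[OF _ R(4,3), of g] unfolding \<U>_iff bi_def by (simp only: conj_assoc)
    then obtain U where "U \<in> \<U> \<and> bi g U" "\<And>U'. U' \<in> \<U> \<and> bi g U' \<Longrightarrow> U' = U" by (elim ex1E) blast
    then have "{U \<in> \<U>. bi g U} = {U}" by blast
    then show "(\<Sum>c\<in>C. W g c) = (\<Sum>U\<in>{U \<in> \<U>. bi g U}. \<Sum>c\<in>C. W g c)" by simp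
  qed
  also have "\<dots> = (\<Sum>U\<in>\<U>. \<Sum>g\<in>{g \<in> forests S R. bi g U}. \<Sum>c\<in>C. W g c)"
    using S by (intro sum.swap_restrict finite_forests) (auto simp: \<U>_def)
  also have "\<dots> = (\<Sum>U\<in>\<U>. rooted_forest_sum U [x] [p] * rooted_forest_sum (S - U) r ps)"
  proof (rule sum.cong[OF refl])
    fix U assume "U \<in> \<U>"
    then have U: "x \<in> U" "U \<subseteq> S" "set r \<inter> U = {}" by (auto simp: \<U>_def)
    define rG where "rG = (\<lambda>g. (restrict g (U - {x}), restrict g (S - U - set r)) :: ('a \<Rightarrow> 'a) \<times> ('a \<Rightarrow> 'a))"
    define rC where "rC = (\<lambda>c. (restrict c U, restrict c (S - U)) :: ('a \<Rightarrow> nat) \<times> ('a \<Rightarrow> nat))"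
    define w1 where "w1 = (\<lambda>g c. weight (fgraph U {x} g) (root_extra [x] [snd p]) c)"
    define w2 where "w2 = (\<lambda>g c. weight (fgraph (S - U) (set r) g) (root_extra r (map snd ps)) c)"
    have SR: "(U - {x}) \<union> (S - U - set r) = S - R" using U by (auto simp: R)
    have bG: "bij_betw rG {g \<in> forests S R. bi g U} (forests U {x} \<times> forests (S - U) (set r))"
      unfolding rG_def
    proof (rule bij_betw_restrict_split; (unfold SR)?)
      show "(U - {x}) \<inter> (S - U - set r) = {}" by blast
      show "{g \<in> forests S R. bi g U} \<subseteq> extensional (S - R)" by (auto simp: forests_def PiE_def)
      show "forests U {x} \<times> forests (S - U) (set r) \<subseteq> extensional (U - {x}) \<times> extensional (S - U - set r)"
        by (auto simp: forests_def PiE_def)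
      fix g :: "'a \<Rightarrow> 'a" assume g: "g \<in> extensional (S - R)"
      have split: "(\<forall>v\<in>S - R. Q v) \<longleftrightarrow> (\<forall>v\<in>U - {x}. Q v) \<and> (\<forall>v\<in>S - U - set r. Q v)" for Q
        unfolding SR[symmetric] by (rule ball_Un)
      have maps: "(\<forall>v\<in>S - R. g v \<in> S) \<and> bi g U \<longleftrightarrow> (\<forall>v\<in>U - {x}. g v \<in> U) \<and> (\<forall>v\<in>S - U - set r. g v \<in> S - U)"
        unfolding bi_def split using U(2) by auto
      \<comment> \<open>By \<open>bi\<close>, the parts of an invariant set inside and outside
        \<open>U\<close> are again invariant.\<close>
      have acyc: "acyclic_on (S - R) g \<longleftrightarrow> acyclic_on (U - {x}) g \<and> acyclic_on (S - U - set r) g" if "bi g U"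
      proof (intro iffI conjI)
        assume a: "acyclic_on (S - R) g"
        then show "acyclic_on (U - {x}) g" "acyclic_on (S - U - set r) g"
          unfolding SR[symmetric] acyclic_on_def by (meson Un_upper1 Un_upper2 subset_trans)+
      next
        assume a: "acyclic_on (U - {x}) g \<and> acyclic_on (S - U - set r) g"
        show "acyclic_on (S - R) g"
          unfolding acyclic_on_def
        proof (intro allI impI)
          fix A assume A: "A \<subseteq> S - R" "g ` A \<subseteq> A"
          have "A \<inter> U = {}"
            using A that U(1) by (intro acyclic_onD[OF conjunct1[OF a]]) (auto simp: bi_def R)
          moreover have "A - U = {}"
            using A that by (intro acyclic_onD[OF conjunct2[OF a]]) (auto simp: bi_def R)
          ultimately show "A = {}" by blast
        qed
      qed
      have acr: "acyclic_on D (restrict g D) \<longleftrightarrow> acyclic_on D g" for D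
      proof -
        have "restrict g D ` A = g ` A" if "A \<subseteq> D" for A using that by (intro image_cong) auto
        then show ?thesis unfolding acyclic_on_def by simp
      qed
      have "g \<in> {g \<in> forests S R. bi g U} \<longleftrightarrow> ((\<forall>v\<in>S - R. g v \<in> S) \<and> bi g U) \<and> acyclic_on (S - R) g"
        using g by (auto simp: forests_def PiE_def)
      also have "\<dots> \<longleftrightarrow> ((\<forall>v\<in>U - {x}. g v \<in> U) \<and> (\<forall>v\<in>S - U - set r. g v \<in> S - U)) \<and>
          (acyclic_on (U - {x}) g \<and> acyclic_on (S - U - set r) g)"
        using maps acyc by blast
      also have "\<dots> \<longleftrightarrow> (restrict g (U - {x}), restrict g (S - U - set r)) \<in> forests U {x} \<times> forests (S - U) (set r)"
        unfolding forests_def by (auto simp: restrict_PiE_iff acr)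
      finally show "g \<in> {g \<in> forests S R. bi g U} \<longleftrightarrow>
        (restrict g (U - {x}), restrict g (S - U - set r)) \<in> forests U {x} \<times> forests (S - U) (set r)" .
    qed
    have SU: "U \<union> (S - U) = S" using U(2) by blast
    have bC: "bij_betw rC C (root_colorings U [x] [fst p] \<times> root_colorings (S - U) r (map fst ps))"
      unfolding rC_def
    proof (rule bij_betw_restrict_split; (unfold SU)?)
      show "U \<inter> (S - U) = {}" by blast
      show "C \<subseteq> extensional S" by (auto simp: C_def root_colorings_def PiE_def)
      show "root_colorings U [x] [fst p] \<times> root_colorings (S - U) r (map fst ps) \<subseteq> extensional U \<times> extensional (S - U)"
        by (auto simp: root_colorings_def PiE_def)
      fix c :: "'a \<Rightarrow> nat" assume c: "c \<in> extensional S"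
      have eq: "map (restrict c (S - U)) r = map c r"
        using r U(3) by (intro map_cong) auto
      have m: "map c (x # r) = map fst (p # ps) \<longleftrightarrow>
          map (restrict c U) [x] = [fst p] \<and> map (restrict c (S - U)) r = map fst ps"
        using U(1) unfolding eq by simp
      have "c \<in> S \<rightarrow>\<^sub>E {0, 1} \<longleftrightarrow> (\<forall>v\<in>U \<union> (S - U). c v \<in> {0, 1})"
        using c SU by (auto simp: PiE_def)
      then have "c \<in> S \<rightarrow>\<^sub>E {0, 1} \<longleftrightarrow> restrict c U \<in> U \<rightarrow>\<^sub>E {0, 1} \<and> restrict c (S - U) \<in> (S - U) \<rightarrow>\<^sub>E {0, 1}"
        unfolding ball_Un restrict_PiE_iff .
      then show "c \<in> C \<longleftrightarrow> (restrict c U, restrict c (S - U)) \<in> root_colorings U [x] [fst p] \<times> root_colorings (S - U) r (map fst ps)"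
        unfolding C_def root_colorings_def using m by auto
    qed
    \<comment> \<open>No edge joins \<open>U\<close> to \<open>S - U\<close>, so black counts are
      computed within each part and the product over \<open>S\<close> factors.\<close>
    have WW: "W g c = w1 (fst (rG g)) (fst (rC c)) * w2 (snd (rG g)) (snd (rC c))"
      if g: "g \<in> forests S R" "bi g U" for g c
    proof -
      have gS: "g v \<in> S" if "v \<in> S" "v \<notin> R" for v using g(1) that by (auto simp: forests_def)
      define F where "F = (\<lambda>v. if c v = 0 \<and> even (black_count (fgraph S R g) c v + e v) then tvar else 1)"
      have "W g c = prod F S"
        by (simp add: W_def weight_def F_def)
      also have "\<dots> = prod F (S - U) * prod F U"
        using S U(2) by (rule prod.subset_diff[rotated])
      also have "prod F U = w1 (fst (rG g)) (fst (rC c))"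
        unfolding w1_def weight_def fgraph_simps
      proof (rule prod.cong[OF refl])
        fix v assume v: "v \<in> U"
        have "black_count (fgraph S R g) c v = black_count (fgraph U {x} (fst (rG g))) (fst (rC c)) v"
          using U v g(2) by (intro black_count_component) (auto simp: bi_def R rG_def rC_def)
        moreover have "e v = root_extra [x] [snd p] v"
        proof -
          have "v \<notin> set r" using v U(3) by blast
          then have "root_extra r (map snd ps) v = 0" by (rule root_extra_notin)
          moreover have "root_extra [] [] v = 0" by (rule root_extra_notin) simp
          ultimately show ?thesis by (simp add: e_def root_extra_Cons)
        qed
        ultimately show "F v = (if fst (rC c) v = 0 \<and> even (black_count (fgraph U {x} (fst (rG g))) (fst (rC c)) v + root_extra [x] [snd p] v) then tvar else 1)"
          using v by (simp add: F_def rC_def)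
      qed
      also have "prod F (S - U) = w2 (snd (rG g)) (snd (rC c))"
        unfolding w2_def weight_def fgraph_simps
      proof (rule prod.cong[OF refl])
        fix v assume v: "v \<in> S - U"
        have "black_count (fgraph S R g) c v = black_count (fgraph (S - U) (set r) (snd (rG g))) (snd (rC c)) v"
        proof (rule black_count_component)
          show "set r = R \<inter> (S - U)" using U r by (auto simp: R)
          show "g w \<in> S - U \<longleftrightarrow> w \<in> S - U" if "w \<in> S" "w \<notin> R" for w
            using g(2) gS that by (auto simp: bi_def)
        qed (use v U in \<open>auto simp: R rG_def rC_def\<close>)
        moreover have "e v = root_extra r (map snd ps) v"
          using v U(1) by (auto simp: e_def root_extra_Cons)
        ultimately show "F v = (if snd (rC c) v = 0 \<and> even (black_count (fgraph (S - U) (set r) (snd (rG g))) (snd (rC c)) v + root_extra r (map snd ps) v) then tvar else 1)"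
          using v by (simp add: F_def rC_def)
      qed
      finally show ?thesis by (simp only: mult.commute)
    qed
    have "(\<Sum>g\<in>{g \<in> forests S R. bi g U}. \<Sum>c\<in>C. W g c) =
        (\<Sum>g\<in>{g \<in> forests S R. bi g U}. (\<lambda>gg. \<Sum>cc\<in>root_colorings U [x] [fst p] \<times> root_colorings (S - U) r (map fst ps).
          w1 (fst gg) (fst cc) * w2 (snd gg) (snd cc)) (rG g))"
      by (intro sum.cong refl, subst sum.reindex_bij_betw[OF bC, symmetric]) (auto simp: WW)
    also have "\<dots> = (\<Sum>gg\<in>forests U {x} \<times> forests (S - U) (set r). \<Sum>cc\<in>root_colorings U [x] [fst p] \<times> root_colorings (S - U) r (map fst ps).
          w1 (fst gg) (fst cc) * w2 (snd gg) (snd cc))"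
      by (rule sum.reindex_bij_betw[OF bG])
    also have "\<dots> = rooted_forest_sum U [x] [p] * rooted_forest_sum (S - U) r ps"
      by (simp only: sum.cartesian_product' fst_conv snd_conv sum_product[symmetric]
          rooted_forest_sum_def w1_def w2_def list.map list.set)
    finally show "(\<Sum>g\<in>{g \<in> forests S R. bi g U}. \<Sum>c\<in>C. W g c) = rooted_forest_sum U [x] [p] * rooted_forest_sum (S - U) r ps" .
  qed
  finally show ?thesis by (simp only: \<U>_def)
qed

lemma forest_sum_single: "forest_sum U [p] = (\<Sum>x\<in>U. rooted_forest_sum U [x] [p])"
proof -
  have "root_lists U (length [p]) = (\<lambda>x. [x]) ` U"
    by (auto simp: root_lists_def length_Suc_conv)
  then show ?thesis
    by (simp add: forest_sum_def sum.reindex inj_on_def)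
qed

text \<open>Summing over the roots as well makes the two factors independent: for fixed
  \<open>U\<close> the first root runs over \<open>U\<close>, and the others over lists in
  \<open>S - U\<close>.\<close>

lemma forest_sum_Cons:
  assumes S: "finite S"
  shows "forest_sum S (p # ps) = (\<Sum>U\<in>Pow S. forest_sum U [p] * forest_sum (S - U) ps)"
proof -
  let ?n = "length ps"
  define Z where "Z = (SIGMA x : S. root_lists (S - {x}) ?n)"
  have fZ: "finite Z" unfolding Z_def using S by (intro finite_SigmaI finite_root_lists) auto
  have "root_lists S (length (p # ps)) = (\<lambda>(x, r). x # r) ` Z"
    by (force simp: root_lists_def Z_def length_Suc_conv image_iff)
  then have "forest_sum S (p # ps) = (\<Sum>(x, r)\<in>Z. rooted_forest_sum S (x # r) (p # ps))"
    unfolding forest_sum_def by (simp only:, subst sum.reindex) (auto simp: inj_on_def case_prod_unfold)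
  also have "\<dots> = (\<Sum>z\<in>Z. \<Sum>U\<in>{U \<in> Pow S. fst z \<in> U \<and> set (snd z) \<inter> U = {}}.
      rooted_forest_sum U [fst z] [p] * rooted_forest_sum (S - U) (snd z) ps)"
  proof (rule sum.cong[OF refl])
    fix z assume "z \<in> Z"
    then obtain x r where z: "z = (x, r)" "x \<in> S" "x \<notin> set r" "set r \<subseteq> S"
      by (auto simp: Z_def root_lists_def)
    show "(case z of (x, r) \<Rightarrow> rooted_forest_sum S (x # r) (p # ps)) =
        (\<Sum>U\<in>{U \<in> Pow S. fst z \<in> U \<and> set (snd z) \<inter> U = {}}.
          rooted_forest_sum U [fst z] [p] * rooted_forest_sum (S - U) (snd z) ps)"
      unfolding z(1) prod.case fst_conv snd_conv by (rule rooted_forest_sum_Cons[OF S z(2-4)])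
  qed
  also have "\<dots> = (\<Sum>U\<in>Pow S. \<Sum>z\<in>{z \<in> Z. fst z \<in> U \<and> set (snd z) \<inter> U = {}}.
      rooted_forest_sum U [fst z] [p] * rooted_forest_sum (S - U) (snd z) ps)"
    using S fZ by (intro sum.swap_restrict) auto
  also have "\<dots> = (\<Sum>U\<in>Pow S. forest_sum U [p] * forest_sum (S - U) ps)"
  proof (rule sum.cong[OF refl])
    fix U assume "U \<in> Pow S"
    then have "{z \<in> Z. fst z \<in> U \<and> set (snd z) \<inter> U = {}} = U \<times> root_lists (S - U) ?n"
      by (auto simp: Z_def root_lists_def)
    then show "(\<Sum>z\<in>{z \<in> Z. fst z \<in> U \<and> set (snd z) \<inter> U = {}}.
        rooted_forest_sum U [fst z] [p] * rooted_forest_sum (S - U) (snd z) ps) =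
        forest_sum U [p] * forest_sum (S - U) ps"
      by (simp only: sum.cartesian_product' fst_conv snd_conv sum_product[symmetric] forest_sum_single)
        (simp only: forest_sum_def)
  qed
  finally show ?thesis .
qed

section \<open>Products of exponential generating functions\<close>

lemma sum_Pow_card:
  fixes \<phi> :: "nat \<Rightarrow> 'a :: comm_semiring_1"
  assumes S: "finite S"
  shows "(\<Sum>U\<in>Pow S. \<phi> (card U)) = (\<Sum>k\<le>card S. of_nat (card S choose k) * \<phi> k)"
proof -
  have "(\<Sum>U\<in>Pow S. \<phi> (card U)) = (\<Sum>k\<le>card S. \<Sum>U\<in>{U \<in> Pow S. card U = k}. \<phi> (card U))"
    using S by (intro sum.group[symmetric]) (auto intro: card_mono)
  also have "\<dots> = (\<Sum>k\<le>card S. of_nat (card S choose k) * \<phi> k)"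
    using n_subsets[OF S] by (intro sum.cong refl) (simp add: Pow_def)
  finally show ?thesis .
qed

text \<open>\<open>forest_sum_Cons\<close> becomes a binomial convolution in the cardinality of
  \<open>U\<close>, which is the product rule for exponential generating functions.\<close>

lemma forest_sum_eq_fps_nth:
  fixes S :: "'v set" and T :: "nat \<times> nat \<Rightarrow> t_laurent fps"
  assumes single: "\<And>(U :: 'v set) p. finite U \<Longrightarrow> p \<in> set ps \<Longrightarrow> forest_sum U [p] = fact (card U) * fps_nth (T p) (card U)"
    and S: "finite S"
  shows "forest_sum S ps = fact (card S) * fps_nth (prod_list (map T ps)) (card S)"
  using assms
proof (induction ps arbitrary: S)
  case Nil
  have roots: "root_lists S 0 = {[]}" by (auto simp: root_lists_def)
  show ?case
  proof (cases "S = {}")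
    case True
    have "forests {} {} = {\<lambda>_::'v. undefined}" "root_colorings {} [] [] = {\<lambda>_::'v. undefined}"
      by (auto simp: forests_def acyclic_on_def root_colorings_def)
    then show ?thesis
      using True roots by (simp add: forest_sum_def rooted_forest_sum_def weight_def)
  next
    case False
    \<comment> \<open>Without roots, \<open>S\<close> itself is an invariant set; so the empty root
      list contributes only the constant term 1.\<close>
    have "forests S {} = {}"
      using False by (auto simp: forests_def acyclic_on_def image_subset_iff PiE_mem)
    then show ?thesis
      using False Nil.prems by (simp add: forest_sum_def roots rooted_forest_sum_def card_gt_0_iff)
  qed
next
  case (Cons p ps)
  let ?n = "card S" and ?T = "prod_list (map T ps)"
  have "forest_sum S (p # ps) = (\<Sum>U\<in>Pow S. forest_sum U [p] * forest_sum (S - U) ps)"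
    by (rule forest_sum_Cons[OF Cons.prems(2)])
  also have "\<dots> = (\<Sum>U\<in>Pow S. fact (card U) * fps_nth (T p) (card U) * (fact (?n - card U) * fps_nth ?T (?n - card U)))"
  proof (rule sum.cong[OF refl])
    fix U assume U: "U \<in> Pow S"
    then have "finite U" "card (S - U) = ?n - card U"
      using Cons.prems(2) by (auto intro: card_Diff_subset finite_subset)
    then show "forest_sum U [p] * forest_sum (S - U) ps =
        fact (card U) * fps_nth (T p) (card U) * (fact (?n - card U) * fps_nth ?T (?n - card U))"
      using Cons by simp
  qed
  also have "\<dots> = (\<Sum>k\<le>?n. of_nat (?n choose k) * (fact k * fps_nth (T p) k * (fact (?n - k) * fps_nth ?T (?n - k))))"
    by (rule sum_Pow_card[OF Cons.prems(2)])
  also have "\<dots> = (\<Sum>k\<le>?n. fact ?n * (fps_nth (T p) k * fps_nth ?T (?n - k)))"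
  proof (rule sum.cong[OF refl])
    fix k assume "k \<in> {..?n}"
    then have "(fact k * fact (?n - k) * of_nat (?n choose k) :: t_laurent) = fact ?n"
      using binomial_fact_lemma[of k ?n] by (metis atMost_iff of_nat_fact of_nat_mult)
    then show "of_nat (?n choose k) * (fact k * fps_nth (T p) k * (fact (?n - k) * fps_nth ?T (?n - k))) =
        fact ?n * (fps_nth (T p) k * fps_nth ?T (?n - k))"
      by (simp only: mult_ac flip: \<open>_ = fact ?n\<close>)
  qed
  finally show ?case
    by (simp add: fps_mult_nth sum_distrib_left atLeast0AtMost)
qed


section \<open>Branches and cycles\<close>

text \<open>Series of a tree hanging at a cycle vertex of color \<open>c\<close> with
  \<open>e\<close> black neighbours on the cycle. The factors \<open>inverse tvar\<close> and
  \<open>tvar\<close> correct the power of \<open>t\<close> at a white root whose parity is flipped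
  by an odd \<open>e\<close>.\<close>

definition branch_series :: "nat \<times> nat \<Rightarrow> t_laurent fps" where
  "branch_series = (\<lambda>(c, e). if c = 1 then T_b else if even e then T_wplus + T_wminus
     else fps_const (inverse tvar) * T_wplus + fps_const tvar * T_wminus)"

lemma sum_root_colorings:
  assumes "\<And>c. c \<in> root_colorings U [x] [col] \<Longrightarrow> F c =
      (if P (black_count K c x) then a else b) * tvar ^ card (white_even K c)"
    and "mverts K = U" "finite U"
  shows "(\<Sum>c\<in>root_colorings U [x] [col]. F c) =
    a * colored_sum (\<lambda>c n. c = col \<and> P n) K x + b * colored_sum (\<lambda>c n. c = col \<and> \<not> P n) K x"
proof -
  let ?C = "root_colorings U [x] [col]"
  have C: "?C = {c \<in> colorings K. c x = col}" using assms(2) by (simp add: root_colorings_def colorings_def)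
  have "(\<Sum>c\<in>?C. F c) = (\<Sum>c\<in>{c \<in> ?C. P (black_count K c x)}. F c) + (\<Sum>c\<in>{c \<in> ?C. \<not> P (black_count K c x)}. F c)"
    using finite_root_colorings[OF assms(3), of "[x]" "[col]"]
    by (subst sum.union_disjoint[symmetric]) (auto intro!: sum.cong)
  also have "(\<Sum>c\<in>{c \<in> ?C. P (black_count K c x)}. F c) =
      (\<Sum>c\<in>{c \<in> ?C. P (black_count K c x)}. a * tvar ^ card (white_even K c))"
    by (intro sum.cong refl) (simp add: assms(1))
  also have "\<dots> = a * colored_sum (\<lambda>c n. c = col \<and> P n) K x"
    unfolding colored_sum_def sum_distrib_left C by (intro sum.cong) auto
  also have "(\<Sum>c\<in>{c \<in> ?C. \<not> P (black_count K c x)}. F c) =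
      (\<Sum>c\<in>{c \<in> ?C. \<not> P (black_count K c x)}. b * tvar ^ card (white_even K c))"
    by (intro sum.cong refl) (simp add: assms(1))
  also have "\<dots> = b * colored_sum (\<lambda>c n. c = col \<and> \<not> P n) K x"
    unfolding colored_sum_def sum_distrib_left C by (intro sum.cong) auto
  finally show ?thesis .
qed

text \<open>Only the factor at \<open>x\<close> depends on \<open>e\<close>; for a white root and
  odd \<open>e\<close> it changes from \<open>tvar\<close> to 1 or from 1 to
  \<open>tvar\<close>.\<close>

lemma weight_root_extra:
  assumes U: "finite (mverts K)" "x \<in> mverts K"
  shows "weight K (root_extra [x] [e]) c =
    (if c x = 0 \<and> odd e then if even (black_count K c x) then inverse tvar else tvar else 1) * tvar ^ card (white_even K c)"
proof -
  define F where "F = (\<lambda>e v. if c v = 0 \<and> even (black_count K c v + e v) then tvar else 1)"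
  have F: "weight K e c = F e x * prod (F e) (mverts K - {x})" for e
    unfolding weight_def F_def using U by (rule prod.remove)
  have "prod (F (root_extra [x] [e])) (mverts K - {x}) = prod (F (\<lambda>_. 0)) (mverts K - {x})"
    by (intro prod.cong) (auto simp: F_def root_extra_def)
  moreover have "root_extra [x] [e] x = e" by (simp add: root_extra_def)
  ultimately show ?thesis
    unfolding power_card_white_even[OF U(1)] F by (simp add: F_def)
qed

lemma forest_sum_branch:
  fixes U :: "nat set"
  assumes U: "finite U" and c: "fst p \<in> {0, 1}"
  shows "forest_sum U [p] = fact (card U) * fps_nth (branch_series p) (card U)"
proof -
  obtain col e where p: "p = (col, e)" by (cases p)
  define S where "S = (\<lambda>P. \<Sum>(s, g)\<in>rooted_maps U. colored_sum P (fgraph U {s} g) s)"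
  have S: "S P = fact (card U) * fps_nth (tree_series P) (card U)" for P
    unfolding S_def tree_series_nth[OF U] by simp
  have forest: "forest_sum U [p] = (\<Sum>(x, g)\<in>rooted_maps U. \<Sum>c\<in>root_colorings U [x] [col].
      weight (fgraph U {x} g) (root_extra [x] [e]) c)"
    unfolding forest_sum_single rooted_forest_sum_def rooted_maps_eq_forests[OF U]
    using U by (subst sum.Sigma) (auto simp: finite_forests p)
  \<comment> \<open>\<open>a\<close> and \<open>b\<close> are the corrections for a root with an
    even and an odd number of black children.\<close>
  have sum: "forest_sum U [p] = a * S (\<lambda>c n. c = col \<and> even n) + b * S (\<lambda>c n. c = col \<and> \<not> even n)"
    if ab: "\<And>n :: nat. (if col = 0 \<and> odd e then if even n then inverse tvar else tvar else 1) = (if even n then a else b)" for a b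
  proof -
    have "(\<Sum>c\<in>root_colorings U [x] [col]. weight (fgraph U {x} g) (root_extra [x] [e]) c) =
        a * colored_sum (\<lambda>c n. c = col \<and> even n) (fgraph U {x} g) x +
        b * colored_sum (\<lambda>c n. c = col \<and> \<not> even n) (fgraph U {x} g) x" if "(x, g) \<in> rooted_maps U" for x g
    proof (rule sum_root_colorings)
      fix c assume "c \<in> root_colorings U [x] [col]"
      then have "c x = col" by (simp add: root_colorings_def)
      moreover have "x \<in> U" using that by (simp add: rooted_maps_def)
      ultimately show "weight (fgraph U {x} g) (root_extra [x] [e]) c =
          (if even (black_count (fgraph U {x} g) c x) then a else b) * tvar ^ card (white_even (fgraph U {x} g) c)"
        using weight_root_extra[of "fgraph U {x} g" x e c] U ab[of "black_count (fgraph U {x} g) c x"] by simp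
    qed (use U in simp_all)
    then show ?thesis
      unfolding forest S_def
      by (simp add: case_prod_unfold sum_distrib_left sum.distrib cong: sum.cong)
  qed
  show ?thesis
  proof (cases "col = 1")
    case True
    have "colored_sum (\<lambda>c n. c = 1) K x = colored_sum (\<lambda>c n. c = 1 \<and> even n) K x + colored_sum (\<lambda>c n. c = 1 \<and> \<not> even n) K x"
      if "finite (mverts K)" for K :: "(nat, nat \<times> bool) mgraph" and x
    proof -
      have "colored_sum (\<lambda>c n. c = 1) K x = (\<Sum>c\<in>root_colorings (mverts K) [x] [1]. tvar ^ card (white_even K c))"
        by (simp add: colored_sum_def root_colorings_def colorings_def)
      then show ?thesis
        using sum_root_colorings[of "mverts K" x 1 "\<lambda>c. tvar ^ card (white_even K c)" even K 1 1] that by simp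
    qed
    then have "S (\<lambda>c n. c = 1) = S (\<lambda>c n. c = 1 \<and> even n) + S (\<lambda>c n. c = 1 \<and> \<not> even n)"
      unfolding S_def sum.distrib[symmetric] using U by (intro sum.cong) auto
    then show ?thesis
      using sum[of 1 1] True S[of "\<lambda>c n. c = 1"] by (simp add: p branch_series_def T_b_def)
  next
    case False
    then have col: "col = 0" using c by (simp add: p)
    show ?thesis
    proof (cases "even e")
      case True
      then show ?thesis
        using sum[of 1 1] col S[of "\<lambda>c n. c = 0 \<and> even n"] S[of "\<lambda>c n. c = 0 \<and> odd n"]
        by (simp add: p branch_series_def T_wplus_def T_wminus_def algebra_simps)
    next
      case False
      then show ?thesis
        using sum[of "inverse tvar" tvar] col S[of "\<lambda>c n. c = 0 \<and> even n"] S[of "\<lambda>c n. c = 0 \<and> odd n"]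
        by (simp add: p branch_series_def T_wplus_def T_wminus_def algebra_simps)
    qed
  qed
qed

section \<open>Cycles of a self-map, listed from a starting point\<close>

definition cycle_lists :: "'v set \<Rightarrow> ('v \<Rightarrow> 'v) \<Rightarrow> 'v list set" where
  "cycle_lists S f = {r. r \<noteq> [] \<and> distinct r \<and> set r \<subseteq> S \<and> (\<forall>i<length r. f (r ! i) = r ! (Suc i mod length r))}"

lemma cycle_lists_nth:
  assumes "r \<in> cycle_lists S f" "i < length r"
  shows "(f ^^ k) (r ! i) = r ! ((i + k) mod length r)"
proof (induction k)
  case (Suc k)
  have "(i + k) mod length r < length r" using assms(2) by (intro mod_less_divisor) auto
  then have "f (r ! ((i + k) mod length r)) = r ! (Suc ((i + k) mod length r) mod length r)"
    using assms(1) by (simp add: cycle_lists_def)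
  then show ?case using Suc by (simp add: mod_Suc_eq)
qed (use assms in simp)

lemma cycle_lists_reach:
  assumes r: "r \<in> cycle_lists S f" and uv: "u \<in> set r" "v \<in> set r"
  obtains k where "(f ^^ k) u = v"
proof -
  obtain i j where ij: "i < length r" "u = r ! i" "j < length r" "v = r ! j"
    using uv by (auto simp: in_set_conv_nth)
  \<comment> \<open>\<open>length r - i\<close> steps return to index 0, and \<open>j\<close> more
    steps reach \<open>v\<close>.\<close>
  have "(f ^^ (length r - i + j)) u = r ! ((i + (length r - i + j)) mod length r)"
    unfolding ij(2) by (rule cycle_lists_nth[OF r ij(1)])
  also have "(i + (length r - i + j)) mod length r = j"
    using ij by simp
  finally show ?thesis using that ij by blast
qed

text \<open>The entries are the iterates of the head, and the length is its period: a longer list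
  would have to repeat the head.\<close>

lemma cycle_lists_hd_eqI:
  assumes r: "r \<in> cycle_lists S f" and r': "r' \<in> cycle_lists S f" and hd: "hd r = hd r'"
  shows "r = r'"
proof -
  have ne: "length r > 0" "length r' > 0" and dist: "distinct r" "distinct r'"
    using r r' by (auto simp: cycle_lists_def)
  have nth: "r ! i = (f ^^ i) (hd r)" if "i < length r" for i
    using cycle_lists_nth[OF r ne(1), of i] that ne by (simp add: hd_conv_nth)
  have nth': "r' ! i = (f ^^ i) (hd r)" if "i < length r'" for i
    using cycle_lists_nth[OF r' ne(2), of i] that ne by (simp add: hd_conv_nth hd)
  have per: "(f ^^ length r) (hd r) = hd r"
    using cycle_lists_nth[OF r ne(1), of "length r"] ne by (simp add: hd_conv_nth)
  have per': "(f ^^ length r') (hd r) = hd r"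
    unfolding hd using cycle_lists_nth[OF r' ne(2), of "length r'"] ne by (simp add: hd_conv_nth)
  have "\<not> length r < length r'"
  proof
    assume l: "length r < length r'"
    then have "r' ! length r = r' ! 0" using nth'[of "length r"] nth'[of 0] per ne by simp
    then show False using dist(2) l ne by (simp add: nth_eq_iff_index_eq)
  qed
  moreover have "\<not> length r' < length r"
  proof
    assume l: "length r' < length r"
    then have "r ! length r' = r ! 0" using nth[of "length r'"] nth[of 0] per' ne by simp
    then show False using dist(1) l ne by (simp add: nth_eq_iff_index_eq)
  qed
  ultimately show ?thesis using nth nth' by (intro nth_equalityI) auto
qed

lemma cycle_lists_rotate:
  assumes r: "r \<in> cycle_lists S f"
  shows "rotate k r \<in> cycle_lists S f"
proof -
  have ne: "length r > 0" using r by (auto simp: cycle_lists_def)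
  have "f (rotate k r ! i) = rotate k r ! (Suc i mod length r)" if i: "i < length r" for i
  proof -
    have *: "(k + i) mod length r < length r" "Suc i mod length r < length r" using ne by simp_all
    have "f (rotate k r ! i) = r ! (Suc ((k + i) mod length r) mod length r)"
      using r * i by (simp add: nth_rotate cycle_lists_def)
    also have "Suc ((k + i) mod length r) mod length r = (k + Suc i mod length r) mod length r"
      by (simp add: mod_Suc_eq mod_add_right_eq)
    finally show ?thesis using * by (simp add: nth_rotate)
  qed
  then show ?thesis using r by (simp add: cycle_lists_def)
qed

text \<open>The iteration starts inside a set permuted by \<open>f\<close>, where injectivity of the
  iterates turns a repetition into a return to the starting point. Taking the least period makes the
  entries distinct.\<close>

lemma ex_cycle_list:
  assumes S: "finite S" "S \<noteq> {}" and f: "f \<in> S \<rightarrow> S"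
  shows "cycle_lists S f \<noteq> {}"
proof -
  have "f ` S \<subseteq> S" using f by auto
  then obtain C where C: "C \<subseteq> S" "C \<noteq> {}" "f ` C = C" "inj_on f C"
    using ex_invariant_subset[OF S] by blast
  obtain x where x: "x \<in> C" using C(2) by blast
  have itC: "(f ^^ n) y \<in> C" if "y \<in> C" for n y
    using that C(3) by (induction n) auto
  have inj: "inj_on (f ^^ n) C" for n
  proof (induction n)
    case (Suc n)
    have "inj_on (f \<circ> f ^^ n) C"
      using Suc C(4) itC by (intro comp_inj_on) (auto intro: inj_on_subset)
    then show ?case by (simp add: comp_def)
  qed simp
  have "\<not> inj (\<lambda>n. (f ^^ n) x)"
  proof
    assume "inj (\<lambda>n. (f ^^ n) x)"
    moreover have "range (\<lambda>n. (f ^^ n) x) \<subseteq> S" using itC[OF x] C(1) by auto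
    ultimately show False using S finite_subset finite_imageD infinite_UNIV_nat by metis
  qed
  then obtain a b where ab: "a < b" "(f ^^ a) x = (f ^^ b) x"
    unfolding inj_def by (metis nat_neq_iff)
  have per: "(f ^^ (b - a)) x = x" if "a < b" "(f ^^ a) x = (f ^^ b) x" for a b
  proof -
    have "(f ^^ a) ((f ^^ (b - a)) x) = (f ^^ a) x"
    proof -
      have "(f ^^ a) ((f ^^ (b - a)) x) = (f ^^ (a + (b - a))) x" by (simp only: funpow_add comp_apply)
      then show ?thesis using that by simp
    qed
    then show ?thesis using inj[of a] itC[OF x] x by (auto dest: inj_onD)
  qed
  define p where "p = (LEAST p. p > 0 \<and> (f ^^ p) x = x)"
  have p: "p > 0" "(f ^^ p) x = x"
    using LeastI[of "\<lambda>p. p > 0 \<and> (f ^^ p) x = x" "b - a"] per[OF ab] ab(1) by (auto simp: p_def)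
  have min: "p \<le> q" if "q > 0" "(f ^^ q) x = x" for q
    unfolding p_def using that by (intro Least_le) auto
  define r where "r = map (\<lambda>n. (f ^^ n) x) [0..<p]"
  have "inj_on (\<lambda>n. (f ^^ n) x) {0..<p}"
  proof (rule linorder_inj_onI')
    fix i j assume "i \<in> {0..<p}" "j \<in> {0..<p}" "i < j"
    then show "(f ^^ i) x \<noteq> (f ^^ j) x" using per[of i j] min[of "j - i"] by auto
  qed
  then have "distinct r" by (simp add: r_def distinct_map)
  moreover have "set r \<subseteq> S" using itC[OF x] C(1) by (auto simp: r_def)
  moreover have "f (r ! i) = r ! (Suc i mod length r)" if "i < length r" for i
    using that p by (cases "Suc i = p") (auto simp: r_def)
  ultimately have "r \<in> cycle_lists S f" using p(1) by (auto simp: cycle_lists_def r_def)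
  then show ?thesis by blast
qed

lemma connected_mapsD:
  assumes "f \<in> connected_maps S" "finite S"
  shows "f \<in> S \<rightarrow> S" "f \<in> extensional S" "S \<noteq> {}" "weakly_connected S {} f"
  using assms connected_fgraph_iff[of S f "{}"] by (auto simp: connected_maps_def PiE_def)

lemma cycle_list_acyclic:
  assumes f: "f \<in> connected_maps S" "finite S" and r: "r \<in> cycle_lists S f"
  shows "acyclic_on (S - set r) f"
proof (rule weakly_connected_imp_acyclic_on)
  show "weakly_connected S {} f" by (rule connected_mapsD[OF f])
  show "set r \<subseteq> S" "set r \<noteq> {}" using r by (auto simp: cycle_lists_def)
  show "f v \<in> set r" if "v \<in> set r" for v
  proof -
    obtain i where i: "i < length r" "v = r ! i" using \<open>v \<in> set r\<close> by (auto simp: in_set_conv_nth)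
    then have "f v = r ! (Suc i mod length r)" "Suc i mod length r < length r"
      using r by (auto simp: cycle_lists_def)
    then show ?thesis by simp
  qed
qed simp

text \<open>A connected self-map has one cycle, and its cycle lists are the rotations of a single
  list, as many as its length. The identity serves to insert a choice of starting point into sums
  over connected maps.\<close>

lemma sum_cycle_lists:
  assumes f: "f \<in> connected_maps S" and S: "finite S"
  shows "(\<Sum>r\<in>cycle_lists S f. 1 / of_nat (length r)) = (1 :: 'r :: field_char_0)"
proof -
  note f' = connected_mapsD[OF f S]
  obtain r0 where r0: "r0 \<in> cycle_lists S f" using ex_cycle_list[OF S f'(3,1)] by blast
  define n where "n = length r0"
  have n: "n > 0" "r0 \<noteq> []" "distinct r0" using r0 by (auto simp: cycle_lists_def n_def)
  have acyc: "acyclic_on (S - set r0) f" by (rule cycle_list_acyclic[OF f S r0])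
  have closed: "f v \<in> set r" if r: "r \<in> cycle_lists S f" and "v \<in> set r" for v r
  proof -
    obtain i where i: "i < length r" "v = r ! i" using \<open>v \<in> set r\<close> by (auto simp: in_set_conv_nth)
    then have "f v = r ! (Suc i mod length r)" "Suc i mod length r < length r"
      using r by (auto simp: cycle_lists_def)
    then show ?thesis by simp
  qed
  have hd_rot: "hd (rotate i r0) = r0 ! i" if "i < n" for i
    using that n by (simp add: hd_rotate_conv_nth n_def)
  have "r \<in> (\<lambda>i. rotate i r0) ` {..<n}" if r: "r \<in> cycle_lists S f" for r
  proof -
    have r': "r \<noteq> []" "set r \<subseteq> S" using r by (auto simp: cycle_lists_def)
    \<comment> \<open>Outside \<open>r0\<close> there is no nonempty invariant set, so
      \<open>r\<close> meets \<open>r0\<close>. Its head then lies on \<open>r0\<close> and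
      identifies \<open>r\<close> as a rotation.\<close>
    have "set r \<inter> set r0 \<noteq> {}"
    proof
      assume "set r \<inter> set r0 = {}"
      then have "set r = {}" using r'(2) closed[OF r] by (intro acyclic_onD[OF acyc]) auto
      then show False using r' by simp
    qed
    then obtain u where u: "u \<in> set r" "u \<in> set r0" by blast
    obtain k where k: "(f ^^ k) u = hd r"
      using cycle_lists_reach[OF r u(1)] r'(1) by (metis list.set_sel(1))
    have "(f ^^ j) u \<in> set r0" for j
      using u(2) closed[OF r0] by (induction j) auto
    then have "hd r \<in> set r0" using k by metis
    then obtain i where i: "i < n" "hd r = r0 ! i" by (auto simp: in_set_conv_nth n_def)
    then have "r = rotate i r0"
      using hd_rot by (intro cycle_lists_hd_eqI[OF r cycle_lists_rotate[OF r0]]) simp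
    then show ?thesis using i by blast
  qed
  then have eq: "cycle_lists S f = (\<lambda>i. rotate i r0) ` {..<n}"
    using cycle_lists_rotate[OF r0] by blast
  have inj: "inj_on (\<lambda>i. rotate i r0) {..<n}"
  proof (rule inj_onI)
    fix i j assume "i \<in> {..<n}" "j \<in> {..<n}" "rotate i r0 = rotate j r0"
    then have "r0 ! i = r0 ! j" "i < n" "j < n" using hd_rot[of i] hd_rot[of j] by auto
    then show "i = j" using n(3) by (simp add: nth_eq_iff_index_eq n_def)
  qed
  show ?thesis
    unfolding eq sum.reindex[OF inj] using n(1) by (simp add: n_def[symmetric])
qed

text \<open>The lookup in \<open>zip r (rotate1 r)\<close> gives the cyclic successor, so the roots
  of the forest become one directed cycle; a single root becomes a fixed point.\<close>

definition close_cycle :: "'v set \<Rightarrow> 'v list \<Rightarrow> ('v \<Rightarrow> 'v) \<Rightarrow> 'v \<Rightarrow> 'v" where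
  "close_cycle S r g = (\<lambda>v\<in>S. if v \<in> set r then the (map_of (zip r (rotate1 r)) v) else g v)"

lemma close_cycle_nth:
  assumes "distinct r" "set r \<subseteq> S" "i < length r"
  shows "close_cycle S r g (r ! i) = r ! (Suc i mod length r)"
proof -
  have "r ! i \<in> set r" "r ! i \<in> S" using assms by auto
  then show ?thesis using assms by (simp add: close_cycle_def map_of_zip_nth nth_rotate1)
qed

lemma close_cycle_notin: "v \<in> S \<Longrightarrow> v \<notin> set r \<Longrightarrow> close_cycle S r g v = g v"
  by (simp add: close_cycle_def)

text \<open>Opening and closing the cycle are inverse to each other: a connected map with cycle list
  \<open>r\<close> restricts to a forest with root list \<open>r\<close>, and
  \<open>close_cycle\<close> restores the map. The factor \<open>1 / of_nat n\<close> is the weight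
  of one starting point.\<close>

lemma sum_connected_maps:
  fixes \<phi> :: "('v \<Rightarrow> 'v) \<Rightarrow> 'r :: field_char_0"
  assumes S: "finite S"
  shows "(\<Sum>f\<in>connected_maps S. \<phi> f) =
    (\<Sum>n=1..card S. \<Sum>r\<in>root_lists S n. \<Sum>g\<in>forests S (set r). \<phi> (close_cycle S r g) / of_nat n)"
proof -
  have fin: "finite (cycle_lists S f)" for f
    by (rule finite_subset[OF _ finite_subset_distinct[OF S]]) (auto simp: cycle_lists_def)
  define Z where "Z = (SIGMA n : {1..card S}. root_lists S n)"
  have "(\<Sum>f\<in>connected_maps S. \<phi> f) = (\<Sum>f\<in>connected_maps S. \<phi> f * (\<Sum>r\<in>cycle_lists S f. 1 / of_nat (length r)))"
    by (intro sum.cong refl) (simp add: sum_cycle_lists[OF _ S])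
  also have "\<dots> = (\<Sum>(f, r)\<in>(SIGMA f : connected_maps S. cycle_lists S f). \<phi> f / of_nat (length r))"
    unfolding sum_distrib_left using finite_connected_maps[OF S] fin by (subst sum.Sigma) auto
  also have "\<dots> = (\<Sum>(z, g)\<in>(SIGMA z : Z. forests S (set (snd z))). \<phi> (close_cycle S (snd z) g) / of_nat (fst z))"
  proof (rule sum.reindex_bij_witness[where j = "\<lambda>(f, r). ((length r, r), restrict f (S - set r))"
        and i = "\<lambda>(z, g). (close_cycle S (snd z) g, snd z)"])
    fix a assume a: "a \<in> (SIGMA f : connected_maps S. cycle_lists S f)"
    obtain f r where fr: "a = (f, r)" by (cases a)
    have f: "f \<in> connected_maps S" and r: "r \<in> cycle_lists S f" using a by (auto simp: fr)
    note f' = connected_mapsD[OF f S]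
    have r': "distinct r" "set r \<subseteq> S" "r \<noteq> []" using r by (auto simp: cycle_lists_def)
    have cl: "close_cycle S r (restrict f (S - set r)) = f"
    proof (rule ext)
      fix v
      show "close_cycle S r (restrict f (S - set r)) v = f v"
      proof (cases "v \<in> set r")
        case True
        then obtain i where "i < length r" "v = r ! i" by (auto simp: in_set_conv_nth)
        then show ?thesis using close_cycle_nth[OF r'(1,2)] r by (simp add: cycle_lists_def)
      next
        case False
        then show ?thesis using extensional_arb[OF f'(2)] by (cases "v \<in> S") (auto simp: close_cycle_def)
      qed
    qed
    show "(case (case a of (f, r) \<Rightarrow> ((length r, r), restrict f (S - set r))) of (z, g) \<Rightarrow> (close_cycle S (snd z) g, snd z)) = a"
      by (simp add: fr cl)
    have "restrict f (S - set r) ` A = f ` A" if "A \<subseteq> S - set r" for A using that by (intro image_cong) auto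
    then have "acyclic_on (S - set r) (restrict f (S - set r))"
      using cycle_list_acyclic[OF f S r] unfolding acyclic_on_def by simp
    then have "restrict f (S - set r) \<in> forests S (set r)"
      using f'(1) by (auto simp: forests_def)
    moreover have "length r \<le> card S"
      using card_mono[OF S r'(2)] distinct_card[OF r'(1)] by simp
    then have "(length r, r) \<in> Z"
      using r' by (auto simp: Z_def root_lists_def Suc_le_eq)
    ultimately show "(case a of (f, r) \<Rightarrow> ((length r, r), restrict f (S - set r))) \<in> (SIGMA z : Z. forests S (set (snd z)))"
      by (simp add: fr)
    show "(case (case a of (f, r) \<Rightarrow> ((length r, r), restrict f (S - set r))) of (z, g) \<Rightarrow> \<phi> (close_cycle S (snd z) g) / of_nat (fst z))
        = (case a of (f, r) \<Rightarrow> \<phi> f / of_nat (length r))"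
      by (simp add: fr cl)
  next
    fix b assume b: "b \<in> (SIGMA z : Z. forests S (set (snd z)))"
    obtain n r g where ng: "b = ((n, r), g)" by (metis surj_pair)
    have n: "1 \<le> n" "length r = n" and r: "distinct r" "set r \<subseteq> S" "r \<noteq> []"
      and g: "g \<in> (S - set r) \<rightarrow>\<^sub>E S" and acyc: "acyclic_on (S - set r) g"
      using b by (auto simp: ng Z_def root_lists_def forests_def)
    let ?f = "close_cycle S r g"
    have res: "restrict ?f (S - set r) = g"
    proof (rule ext)
      show "restrict ?f (S - set r) v = g v" for v
        using PiE_arb[OF g, of v] by (auto simp: close_cycle_def)
    qed
    then show "(case (case b of (z, g) \<Rightarrow> (close_cycle S (snd z) g, snd z)) of (f, r) \<Rightarrow> ((length r, r), restrict f (S - set r))) = b"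
      by (simp add: ng n)
    have fr: "?f v \<in> set r" if "v \<in> set r" for v
    proof -
      obtain i where "i < length r" "v = r ! i" using \<open>v \<in> set r\<close> by (auto simp: in_set_conv_nth)
      then show ?thesis using close_cycle_nth[OF r(1,2)] by (simp add: r)
    qed
    have fS: "?f v \<in> S" if "v \<in> S" for v
      using that fr[of v] r(2) g by (cases "v \<in> set r") (auto simp: close_cycle_notin)
    have cyc: "r \<in> cycle_lists S ?f"
      using r close_cycle_nth[OF r(1,2)] by (simp add: cycle_lists_def)
    have "acyclic_on (S - set r) ?f"
    proof -
      have "?f ` A = g ` A" if "A \<subseteq> S - set r" for A
        using that by (intro image_cong) (auto simp: close_cycle_def)
      then show ?thesis using acyc unfolding acyclic_on_def by simp
    qed
    then have "weakly_connected S {} ?f"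
    proof (rule acyclic_on_imp_weakly_connected)
      show "?f \<in> S - {} \<rightarrow> S" using fS by auto
      fix A assume A: "A \<subseteq> S" "A \<inter> set r \<noteq> {}" and bi: "\<And>v. v \<in> S \<Longrightarrow> v \<notin> {} \<Longrightarrow> v \<in> A \<longleftrightarrow> ?f v \<in> A"
      obtain u where u: "u \<in> A" "u \<in> set r" using A(2) by blast
      \<comment> \<open>The forward orbit of one cycle vertex stays in \<open>A\<close> and covers
        the whole cycle.\<close>
      show "set r \<subseteq> A"
      proof
        fix v assume v: "v \<in> set r"
        obtain k where k: "(?f ^^ k) u = v" using cycle_lists_reach[OF cyc u(2) v] by blast
        have "(?f ^^ j) u \<in> A" for j
          using u(1) bi A(1) by (induction j) auto
        then show "v \<in> A" using k by metis
      qed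
    qed simp
    then have "?f \<in> connected_maps S"
      using connected_fgraph_iff[OF S, of ?f "{}"] fS r by (auto simp: connected_maps_def close_cycle_def)
    then show "(case b of (z, g) \<Rightarrow> (close_cycle S (snd z) g, snd z)) \<in> (SIGMA f : connected_maps S. cycle_lists S f)"
      using cyc by (simp add: ng)
  qed
  also have "\<dots> = (\<Sum>z\<in>Z. \<Sum>g\<in>forests S (set (snd z)). \<phi> (close_cycle S (snd z) g) / of_nat (fst z))"
    using S by (subst sum.Sigma) (auto simp: Z_def finite_root_lists finite_forests)
  also have "\<dots> = (\<Sum>n=1..card S. \<Sum>r\<in>root_lists S n. \<Sum>g\<in>forests S (set r). \<phi> (close_cycle S r g) / of_nat n)"
    unfolding Z_def using S by (subst sum.Sigma) (auto simp: finite_root_lists case_prod_unfold)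
  finally show ?thesis .
qed

text \<open>The arcs of the closed map are those of the forest and those named by the roots. The
  latter form a copy of \<open>cycle_graph\<close> along \<open>r\<close>, colored by
  \<open>d\<close>, and its black counts are the extra counts of the roots.\<close>

lemma black_count_close_cycle:
  assumes S: "finite S" and r: "distinct r" "set r \<subseteq> S" "r \<noteq> []" and v: "v \<in> S"
    and c: "\<And>i. i < length r \<Longrightarrow> c (r ! i) = d i"
  shows "black_count (fgraph S {} (close_cycle S r g)) c v = black_count (fgraph S (set r) g) c v +
    root_extra r (map (black_count (cycle_graph (length r)) d) [0..<length r]) v"
proof -
  let ?f = "close_cycle S r g" and ?n = "length r"
  define A where "A = (\<lambda>K :: ('a, 'a \<times> bool) mgraph.
    {a \<in> marcs K. mtail K a = v \<and> mhead K a \<noteq> v \<and> c (mhead K a) = 1})"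
  have fr: "?f (r ! i) = r ! (Suc i mod ?n)" if "i < ?n" for i
    by (rule close_cycle_nth[OF r(1,2) that])
  have bc: "black_count K c v = card (A K)" for K :: "('a, 'a \<times> bool) mgraph"
    by (simp add: black_count_def A_def)
  have "A (fgraph S {} ?f) = A (fgraph S (set r) g) \<union> A (fgraph (set r) {} ?f)"
  proof (rule set_eqI)
    fix a :: "'a \<times> bool"
    obtain w b where a: "a = (w, b)" by (cases a)
    show "a \<in> A (fgraph S {} ?f) \<longleftrightarrow> a \<in> A (fgraph S (set r) g) \<union> A (fgraph (set r) {} ?f)"
      using r(2) by (cases "w \<in> S"; cases "w \<in> set r"; cases b) (auto simp: a A_def close_cycle_notin)
  qed
  moreover have "A (fgraph S (set r) g) \<inter> A (fgraph (set r) {} ?f) = {}"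
    by (auto simp: A_def)
  moreover have "finite (A (fgraph S (set r) g))" "finite (A (fgraph (set r) {} ?f))"
    using S by (auto simp: A_def)
  ultimately have split: "black_count (fgraph S {} ?f) c v =
      black_count (fgraph S (set r) g) c v + black_count (fgraph (set r) {} ?f) c v"
    by (simp add: bc card_Un_disjoint)
  have "black_count (fgraph (set r) {} ?f) c v =
    root_extra r (map (black_count (cycle_graph ?n) d) [0..<?n]) v"
  proof (cases "v \<in> set r")
    case True
    then obtain i where i: "i < ?n" "v = r ! i" by (auto simp: in_set_conv_nth)
    have n: "?n > 0" using r(3) by simp
    have bij: "bij_betw ((!) r) {0..<?n} (set r)"
      using r(1) by (intro bij_betw_nth) auto
    have "bij_betw (\<lambda>(j, b). (r ! j, b)) ({0..<?n} \<times> UNIV) (set r \<times> (UNIV :: bool set))"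
      using bij_betw_map_prod[OF bij bij_betw_id[of UNIV]] by (simp add: map_prod_def)
    then have iso: "is_iso (cycle_graph ?n) (fgraph (set r) {} ?f) ((!) r) (\<lambda>(j, b). (r ! j, b))"
      using bij fr unfolding is_iso_def cycle_graph_eq_fgraph by auto
    have "multigraph (cycle_graph ?n)"
      unfolding cycle_graph_eq_fgraph using n by (intro multigraph_fgraph) auto
    from black_count_iso[OF this iso, of i d c] have "black_count (cycle_graph ?n) d i = black_count (fgraph (set r) {} ?f) c v"
      using i c by (simp add: cycle_graph_eq_fgraph)
    moreover have "map_of (zip r (map (black_count (cycle_graph ?n) d) [0..<?n])) v =
        Some (map (black_count (cycle_graph ?n) d) [0..<?n] ! i)"
      unfolding i(2) using r(1) i by (intro map_of_zip_nth) auto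
    ultimately show ?thesis using i(1) by (simp add: root_extra_def)
  next
    case False
    then have "A (fgraph (set r) {} ?f) = {}"
    proof -
      have "?f w \<in> set r" if "w \<in> set r" for w
      proof -
        obtain i where "i < ?n" "w = r ! i" using \<open>w \<in> set r\<close> by (auto simp: in_set_conv_nth)
        then show ?thesis using fr by (simp add: r)
      qed
      then show ?thesis using False by (auto simp: A_def split: if_splits)
    qed
    then show ?thesis using False by (simp add: bc root_extra_notin)
  qed
  then show ?thesis using split by simp
qed


section \<open>Automorphisms of cycles\<close>

lemma multigraph_cycle_graph: "multigraph (cycle_graph n)"
  unfolding cycle_graph_eq_fgraph by (intro multigraph_fgraph) auto

text \<open>Each vertex is the tail of exactly two arcs, distinguished by their flags. This covers
  the loop and the two parallel edges as well.\<close>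

lemma cycle_graph_arc_unique:
  assumes "a \<in> marcs (cycle_graph n)" "b \<in> marcs (cycle_graph n)" "c \<in> marcs (cycle_graph n)"
    and "mtail (cycle_graph n) a = mtail (cycle_graph n) c" "mtail (cycle_graph n) b = mtail (cycle_graph n) c"
    and "a \<noteq> c" "b \<noteq> c"
  shows "a = b"
proof -
  have det: "x = y" if xy': "x \<in> marcs (cycle_graph n)" "y \<in> marcs (cycle_graph n)"
    "mtail (cycle_graph n) x = mtail (cycle_graph n) y" "snd x = snd y" for x y
  proof -
    obtain i d where x: "x = (i, d)" by (cases x)
    obtain j where y: "y = (j, d)" using xy'(4) x by (cases y) simp
    note xy = x y
    have ij: "i < n" "j < n" using xy'(1,2) by (auto simp: xy cycle_graph_eq_fgraph)
    have "i = j"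
    proof (cases d)
      case True
      then show ?thesis using xy'(3) by (simp add: xy cycle_graph_eq_fgraph)
    next
      case False
      then have "Suc i mod n = Suc j mod n" using xy'(3) by (simp add: xy cycle_graph_eq_fgraph)
      then show ?thesis using ij by (auto simp: mod_Suc split: if_splits)
    qed
    then show ?thesis by (simp add: xy)
  qed
  have "snd a \<noteq> snd c" "snd b \<noteq> snd c" using det[of a c] det[of b c] assms by auto
  then have "snd a = snd b" by auto
  then show ?thesis using det[of a b] assms by simp
qed

lemma cycle_list_is_iso:
  assumes r: "r \<in> cycle_lists {0..<n} (\<lambda>i. Suc i mod n)" "length r = n"
  shows "is_iso (cycle_graph n) (cycle_graph n) ((!) r) (\<lambda>(i, b). (r ! i, b))"
proof -
  have d: "distinct r" "set r \<subseteq> {0..<n}" and nx: "\<And>i. i < n \<Longrightarrow> Suc (r ! i) mod n = r ! (Suc i mod n)"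
    using r by (auto simp: cycle_lists_def)
  have "set r = {0..<n}"
    using d r(2) distinct_card[OF d(1)] by (intro card_subset_eq) auto
  then have bij: "bij_betw ((!) r) {0..<n} {0..<n}"
    using bij_betw_nth[OF d(1), of "{0..<n}" "{0..<n}"] r(2) by (simp add: atLeast0LessThan)
  have "bij_betw (\<lambda>(j, b). (r ! j, b)) ({0..<n} \<times> UNIV) ({0..<n} \<times> (UNIV :: bool set))"
    using bij_betw_map_prod[OF bij bij_betw_id[of UNIV]] by (simp add: map_prod_def)
  then show ?thesis
    unfolding is_iso_def cycle_graph_eq_fgraph using bij nx bij_betwE[OF bij] by auto
qed

text \<open>The edge named by a vertex joins it to its successor. Hence the edge from
  \<open>r ! i\<close> to \<open>r ! (Suc i mod n)\<close> is named by the latter and is traversed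
  backwards.\<close>

lemma reverse_cycle_list_is_iso:
  assumes r: "r \<in> cycle_lists {0..<n} (\<lambda>i. if i = 0 then n - 1 else i - 1)" "length r = n"
  shows "is_iso (cycle_graph n) (cycle_graph n) ((!) r) (\<lambda>(i, b). (r ! (Suc i mod n), \<not> b))"
proof -
  have d: "distinct r" "set r \<subseteq> {0..<n}" "r \<noteq> []"
    and pr: "\<And>i. i < n \<Longrightarrow> (if r ! i = 0 then n - 1 else r ! i - 1) = r ! (Suc i mod n)"
    using r by (auto simp: cycle_lists_def)
  have set: "set r = {0..<n}"
    using d r(2) distinct_card[OF d(1)] by (intro card_subset_eq) auto
  then have bij: "bij_betw ((!) r) {0..<n} {0..<n}"
    using bij_betw_nth[OF d(1), of "{0..<n}" "{0..<n}"] r(2) by (simp add: atLeast0LessThan)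
  have n: "n > 0" using d(3) r(2) by auto
  have rn: "r ! i < n" if "i < n" for i using bij_betwE[OF bij] that by auto
  have nx: "Suc (r ! (Suc i mod n)) mod n = r ! i" if "i < n" for i
    using pr[OF that, symmetric] rn[OF that] by auto
  have "bij_betw ((!) (rotate1 r)) {0..<n} {0..<n}"
    using bij_betw_nth[of "rotate1 r" "{0..<n}" "{0..<n}"] d(1) r(2) set by (simp add: atLeast0LessThan)
  then have bij1: "bij_betw (\<lambda>i. r ! (Suc i mod n)) {0..<n} {0..<n}"
    by (rule bij_betw_cong[THEN iffD1, rotated]) (simp add: nth_rotate1 r(2))
  have "bij Not" by (rule involuntory_imp_bij) simp
  then have "bij_betw (\<lambda>(j, b). (r ! (Suc j mod n), \<not> b)) ({0..<n} \<times> UNIV) ({0..<n} \<times> UNIV)"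
    using bij_betw_map_prod[OF bij1, of Not UNIV UNIV] by (simp add: map_prod_def)
  then show ?thesis
    unfolding is_iso_def cycle_graph_eq_fgraph using bij nx rn n by auto
qed

text \<open>An automorphism is determined by the image of the arc \<open>(0, True)\<close>, and
  rotations and reflections reach all \<open>2 * n\<close> arcs. Arguing with arcs instead of
  vertices makes this valid for \<open>n = 1\<close> and \<open>n = 2\<close> too.\<close>

lemma card_Aut_cycle_graph:
  assumes n: "n \<ge> 1"
  shows "card (Aut (cycle_graph n)) = 2 * n"
proof -
  let ?K = "cycle_graph n"
  let ?I = "isos_on ?K {} ?K {}"
  note mK = multigraph_cycle_graph[of n]
  note K' = multigraphD[OF mK]
  have arcs: "marcs ?K = {0..<n} \<times> UNIV" and verts: "mverts ?K = {0..<n}"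
    by (simp_all add: cycle_graph_eq_fgraph)
  have tailT: "mtail ?K (i, True) = i" and headT: "mhead ?K (i, True) = Suc i mod n" for i
    by (simp_all add: cycle_graph_eq_fgraph)
  have revT: "snd ?K (i, True) = (i, False)" if "i < n" for i
    using that by (simp add: cycle_graph_eq_fgraph)
  have iff: "?I \<noteq> {} \<longleftrightarrow> (\<exists>f k. is_iso ?K ?K f k)"
    using isos_on_nonempty_iff[OF mK, of "{}" ?K "{}"] by simp
  have restrI: "(restrict f (mverts ?K), restrict k (marcs ?K)) \<in> ?I" if "is_iso ?K ?K f k" for f k
  proof -
    have "is_iso ?K ?K (restrict f (mverts ?K)) (restrict k (marcs ?K))"
      using that by (subst is_iso_cong[OF mK, of _ f _ k]) auto
    then show ?thesis by (simp add: isos_on_def)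
  qed
  have "card (Aut ?K) = card ?I"
  proof -
    have "?I \<noteq> {}" using iff is_iso_refl[of ?K] by blast
    moreover have "Aut_on ?K {} = Aut ?K" by (auto simp: Aut_on_def)
    ultimately show ?thesis using card_isos_on[OF mK mK, of "{}" "{}"] by simp
  qed
  also have "bij_betw (\<lambda>(f, k). k (0, True)) ?I (marcs ?K)"
  proof (rule bij_betw_imageI)
    show "inj_on (\<lambda>(f, k). k (0, True)) ?I"
    proof (rule inj_onI, clarify)
      fix f k f' k' assume I: "(f, k) \<in> ?I" "(f', k') \<in> ?I" and k0: "k (0, True) = k' (0, True)"
      have iso: "is_iso ?K ?K f k" "is_iso ?K ?K f' k'"
        and extn: "f \<in> extensional (mverts ?K)" "f' \<in> extensional (mverts ?K)"
          "k \<in> extensional (marcs ?K)" "k' \<in> extensional (marcs ?K)"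
        using I by (auto simp: isos_on_def)
      \<comment> \<open>The image of the next arc starts where the image of the present one ends and
        differs from its reversal; only two arcs start there, so it is determined.\<close>
      have next_arc: "k (Suc i, True) \<in> marcs ?K \<and> mtail ?K (k (Suc i, True)) = mtail ?K (snd ?K (k (i, True)))
          \<and> k (Suc i, True) \<noteq> snd ?K (k (i, True)) \<and> snd ?K (k (i, True)) \<in> marcs ?K"
        if iso: "is_iso ?K ?K f k" and i: "Suc i < n" for f k i
      proof -
        note iso' = is_isoD[OF iso]
        have a: "(i, True) \<in> marcs ?K" "(Suc i, True) \<in> marcs ?K" "(i, False) \<in> marcs ?K" using i by (auto simp: arcs)
        have "mtail ?K (k (Suc i, True)) = f (Suc i)" using iso'(3)[OF a(2)] by (simp add: tailT)
        moreover have "mtail ?K (snd ?K (k (i, True))) = f (Suc i)"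
          using iso'(4)[OF a(1)] K'(8)[OF iso'(7)[OF a(1)]] i by (simp add: headT)
        moreover have "snd ?K (k (i, True)) = k (i, False)"
          using iso'(5)[OF a(1)] i by (simp add: revT)
        moreover have "k (Suc i, True) \<noteq> k (i, False)"
          using bij_betw_imp_inj_on[OF iso'(2)] a by (simp add: inj_on_eq_iff)
        ultimately show ?thesis using iso'(7) a by simp
      qed
      have T: "k (i, True) = k' (i, True)" if "i < n" for i
        using that
      proof (induction i)
        case (Suc i)
        then have eq: "k (i, True) = k' (i, True)" by simp
        show ?case
          using cycle_graph_arc_unique[of "k (Suc i, True)" n "k' (Suc i, True)" "snd ?K (k (i, True))"]
            next_arc[OF iso(1) Suc.prems] next_arc[OF iso(2) Suc.prems] eq by auto
      qed (rule k0)
      have F: "k (i, False) = k' (i, False)" if "i < n" for i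
        using is_isoD(5)[OF iso(1), of "(i, True)"] is_isoD(5)[OF iso(2), of "(i, True)"] T[OF that] revT[OF that] that
        by (simp add: arcs)
      have "k a = k' a" for a
      proof (cases "a \<in> marcs ?K")
        case True
        then obtain i d where "a = (i, d)" "i < n" by (auto simp: arcs)
        then show ?thesis using T F by (cases d) auto
      next
        case False
        then show ?thesis using extensional_arb[OF extn(3)] extensional_arb[OF extn(4)] by simp
      qed
      moreover have "f v = f' v" for v
      proof (cases "v \<in> mverts ?K")
        case True
        then have "v < n" by (simp add: verts)
        then show ?thesis
          using is_isoD(3)[OF iso(1), of "(v, True)"] is_isoD(3)[OF iso(2), of "(v, True)"] T[of v]
          by (simp add: arcs tailT)
      next
        case False
        then show ?thesis using extensional_arb[OF extn(1)] extensional_arb[OF extn(2)] by simp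
      qed
      ultimately show "f = f' \<and> k = k'" by blast
    qed
    show "(\<lambda>(f, k). k (0, True)) ` ?I = marcs ?K"
    proof (intro equalityI subsetI)
      fix a assume "a \<in> (\<lambda>(f, k). k (0, True)) ` ?I"
      then obtain f k where "a = k (0, True)" "is_iso ?K ?K f k" by (auto simp: isos_on_def)
      then show "a \<in> marcs ?K" using is_isoD(7)[of ?K ?K f k "(0, True)"] n by (simp add: arcs)
    next
      fix a assume "a \<in> marcs ?K"
      then obtain j d where a: "a = (j, d)" "j < n" by (auto simp: arcs)
      have 0: "(0, True) \<in> marcs ?K" using n by (simp add: arcs)
      have "\<exists>f k. is_iso ?K ?K f k \<and> k (0, True) = a"
      proof (cases d)
        case True
        define r where "r = rotate j [0..<n]"
        have "[0..<n] \<in> cycle_lists {0..<n} (\<lambda>i. Suc i mod n)"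
          using n by (auto simp: cycle_lists_def)
        then have "is_iso ?K ?K ((!) r) (\<lambda>(i, b). (r ! i, b))"
          unfolding r_def by (intro cycle_list_is_iso cycle_lists_rotate) auto
        moreover have "r ! 0 = j" using a(2) by (simp add: r_def nth_rotate)
        ultimately show ?thesis using True a(1) by (intro exI[of _ "(!) r"] exI[of _ "\<lambda>(i, b). (r ! i, b)"]) simp
      next
        case False
        define p where "p = (\<lambda>i. if i = 0 then n - 1 else i - 1)"
        define r0 where "r0 = rev [0..<n]"
        \<comment> \<open>The reflection needs \<open>j\<close> at index 1 (index 0 if
          \<open>n = 1\<close>). For \<open>n > 1\<close> this means
          \<open>(m + 1) mod n = n - 1 - j\<close>; the summand \<open>n - 1\<close> is a shift by
          -1 modulo \<open>n\<close> that avoids truncated subtraction.\<close>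
        define m where "m = (n - 1 - j) + (n - 1)"
        define r where "r = rotate m r0"
        have r0: "r0 ! i = n - 1 - i" if "i < n" for i using that by (simp add: r0_def rev_nth)
        have "p (r0 ! i) = r0 ! (Suc i mod n)" if "i < n" for i
          using that n by (cases "Suc i = n") (auto simp: r0 p_def)
        then have "r0 \<in> cycle_lists {0..<n} p"
          using n by (auto simp: cycle_lists_def r0_def)
        then have "is_iso ?K ?K ((!) r) (\<lambda>(i, b). (r ! (Suc i mod n), \<not> b))"
          unfolding r_def p_def by (intro reverse_cycle_list_is_iso cycle_lists_rotate) (auto simp: r0_def)
        moreover have "r ! (Suc 0 mod n) = j"
        proof (cases "n = 1")
          case True
          then show ?thesis using a(2) by (simp add: r_def r0_def m_def)
        next
          case False
          then have "Suc 0 mod n = 1" using n by simp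
          moreover have "r ! 1 = r0 ! ((m + 1) mod n)"
            unfolding r_def using False n by (subst nth_rotate) (auto simp: r0_def)
          moreover have "(m + 1) mod n = n - 1 - j"
          proof -
            have "m + 1 = (n - 1 - j) + n" using n by (simp add: m_def)
            then have "(m + 1) mod n = (n - 1 - j) mod n" by (simp only: mod_add_self2)
            then show ?thesis using n by simp
          qed
          ultimately show ?thesis using r0[of "n - 1 - j"] a(2) by simp
        qed
        ultimately show ?thesis using False a(1) by (intro exI[of _ "(!) r"] exI[of _ "\<lambda>(i, b). (r ! (Suc i mod n), \<not> b)"]) simp
      qed
      then obtain f k where "is_iso ?K ?K f k" "k (0, True) = a" by blast
      then show "a \<in> (\<lambda>(f, k). k (0, True)) ` ?I"
        using restrI 0 by (intro image_eqI[of _ _ "(restrict f (mverts ?K), restrict k (marcs ?K))"]) auto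
    qed
  qed
  then have "card ?I = card (marcs ?K)" by (rule bij_betw_same_card)
  finally show ?thesis by (simp add: arcs card_cartesian_product)
qed


section \<open>Substitution into the cycle series\<close>

lemma UNIV_wvar: "(UNIV :: wvar set) = {Var_b, Var_wplus, Var_wminus}"
  using wvar.exhaust by auto

instance wvar :: finite
  by standard (simp add: UNIV_wvar)

definition monom_degree :: "(wvar \<Rightarrow>\<^sub>0 nat) \<Rightarrow> nat" where
  "monom_degree m = (\<Sum>v\<in>UNIV. Poly_Mapping.lookup m v)"

definition coloring_monom :: "('v, 'a) mgraph \<Rightarrow> ('v \<Rightarrow> nat) \<Rightarrow> wvar \<Rightarrow>\<^sub>0 nat" where
  "coloring_monom K c = Poly_Mapping.single Var_b (card (black K c)) +
     Poly_Mapping.single Var_wplus (card (white_even K c)) + Poly_Mapping.single Var_wminus (card (white_odd K c))"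

lemma lookup_coloring_monom:
  "Poly_Mapping.lookup (coloring_monom K c) v =
    (case v of Var_b \<Rightarrow> card (black K c) | Var_wplus \<Rightarrow> card (white_even K c) | Var_wminus \<Rightarrow> card (white_odd K c))"
  by (cases v) (simp_all add: coloring_monom_def lookup_add lookup_single)

lemma finite_colorings: "finite (mverts K) \<Longrightarrow> finite (colorings K)"
  unfolding colorings_def by (auto intro!: finite_PiE)

lemma mvar_power: "mvar v ^ n = Poly_Mapping.single (Poly_Mapping.single v n) 1"
proof (induction n)
  case (Suc n)
  then show ?case by (simp add: mvar_def mult_single single_add[symmetric])
qed simp

lemma full_W_eq: "full_W K = (\<Sum>c\<in>colorings K. Poly_Mapping.single (coloring_monom K c) 1)"
  unfolding full_W_def coloring_monom_def by (simp add: mvar_power mult_single)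

lemma lookup_full_W:
  assumes "finite (mverts K)"
  shows "Poly_Mapping.lookup (full_W K) m = of_nat (card {c \<in> colorings K. coloring_monom K c = m})"
  unfolding full_W_eq lookup_sum using finite_colorings[OF assms]
  by (simp add: lookup_single when_def sum.If_cases Int_def conj_commute)

lemma coloring_cases:
  assumes "c \<in> colorings K"
  shows "mverts K = black K c \<union> white_even K c \<union> white_odd K c"
proof -
  have "c v \<in> {0, 1}" if "v \<in> mverts K" for v
    using assms that by (intro PiE_mem[of c "mverts K"]) (auto simp: colorings_def)
  then have "v \<in> mverts K \<longleftrightarrow> v \<in> black K c \<union> white_even K c \<union> white_odd K c" for v
    by (cases "v \<in> mverts K") (fastforce simp: black_def white_even_def white_odd_def)+
  then show ?thesis by blast
qed

lemma prod_coloring_classes: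
  fixes A B C :: "'r :: comm_monoid_mult"
  assumes c: "c \<in> colorings K" and fin: "finite (mverts K)"
  shows "(\<Prod>v\<in>mverts K. if c v = 1 then A else if even (black_count K c v) then B else C) =
    A ^ card (black K c) * B ^ card (white_even K c) * C ^ card (white_odd K c)" (is "prod ?F _ = _")
proof -
  have f: "finite (black K c)" "finite (white_even K c)" "finite (white_odd K c)"
    using fin by (auto simp: black_def white_even_def white_odd_def)
  have "prod ?F (mverts K) = prod ?F (black K c) * prod ?F (white_even K c) * prod ?F (white_odd K c)"
    unfolding coloring_cases[OF c] using f
    by (subst prod.union_disjoint; (subst prod.union_disjoint)?) (auto simp: black_def white_even_def white_odd_def)
  also have "prod ?F (black K c) = A ^ card (black K c)"
    by (simp add: black_def)
  also have "prod ?F (white_even K c) = (\<Prod>v\<in>white_even K c. B)"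
    by (intro prod.cong) (auto simp: white_even_def)
  also have "prod ?F (white_odd K c) = (\<Prod>v\<in>white_odd K c. C)"
    by (intro prod.cong) (auto simp: white_odd_def)
  finally show ?thesis by simp
qed

text \<open>This is the homogeneity by which a monomial occurs for one cycle length only.\<close>

lemma monom_degree_coloring:
  assumes c: "c \<in> colorings K" and fin: "finite (mverts K)"
  shows "monom_degree (coloring_monom K c) = card (mverts K)"
proof -
  have f: "finite (black K c)" "finite (white_even K c)" "finite (white_odd K c)"
    using fin by (auto simp: black_def white_even_def white_odd_def)
  have "card (mverts K) = card (black K c) + card (white_even K c) + card (white_odd K c)"
    unfolding coloring_cases[OF c] using f
    by (subst card_Un_disjoint; (subst card_Un_disjoint)?) (auto simp: black_def white_even_def white_odd_def)
  then show ?thesis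
    by (simp add: monom_degree_def UNIV_wvar lookup_coloring_monom)
qed

lemma mverts_cycle_graph: "mverts (cycle_graph n) = {0..<n}"
  by (simp add: cycle_graph_def)

lemma cycle_series_eq:
  "cycle_series m = (if monom_degree m = 0 then 0
     else Poly_Mapping.lookup (full_W (cycle_graph (monom_degree m))) m / of_nat (2 * monom_degree m))"
proof -
  let ?L = "\<lambda>n. Poly_Mapping.lookup (full_W (cycle_graph n)) m"
  have zero: "?L n = 0" if "n \<noteq> monom_degree m" for n
  proof -
    have none: "{c \<in> colorings (cycle_graph n). coloring_monom (cycle_graph n) c = m} = {}"
      using that monom_degree_coloring[of _ "cycle_graph n"] by (auto simp: mverts_cycle_graph)
    have "finite (mverts (cycle_graph n))" by (simp add: mverts_cycle_graph)
    from lookup_full_W[OF this] show ?thesis by (simp only: none card.empty of_nat_0)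
  qed
  then have sub: "{n. 1 \<le> n \<and> ?L n \<noteq> 0} \<subseteq> {monom_degree m}" by auto
  \<comment> \<open>The index set in \<open>cycle_series\<close> is empty if the coefficient
    vanishes; enlarging it to a singleton then adds a zero term. Degree 0 is excluded by
    \<open>1 \<le> n\<close>.\<close>
  have "cycle_series m = (\<Sum>n\<in>(if monom_degree m = 0 then {} else {monom_degree m}). ?L n / of_nat (card (Aut (cycle_graph n))))"
    unfolding cycle_series_def using sub
    by (intro sum.mono_neutral_left) (auto split: if_splits)
  then show ?thesis using card_Aut_cycle_graph[of "monom_degree m"] by simp
qed

section \<open>Monomials in the substituted series\<close>

definition eval_monom :: "(wvar \<Rightarrow> t_laurent fps) \<Rightarrow> (wvar \<Rightarrow>\<^sub>0 nat) \<Rightarrow> t_laurent fps" where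
  "eval_monom s m = (\<Prod>v\<in>Poly_Mapping.keys m. s v ^ Poly_Mapping.lookup m v)"

lemma eval_monom_UNIV: "eval_monom s m = (\<Prod>v\<in>UNIV. s v ^ Poly_Mapping.lookup m v)"
  unfolding eval_monom_def by (intro prod.mono_neutral_left) (auto simp: in_keys_iff)

text \<open>Each substituted series is divisible by \<open>fps_X\<close>, so the product is
  divisible by \<open>fps_X\<close> to the degree of the monomial. Together with
  \<open>finite_monoms_of_degree_le\<close> this leaves finitely many monomials for each
  coefficient.\<close>

lemma eval_monom_nth_eq_0:
  assumes s: "\<And>v. fps_nth (s v) 0 = 0" and k: "k < monom_degree m"
  shows "fps_nth (eval_monom s m) k = 0"
proof -
  have "s v = fps_X * fps_shift 1 (s v)" for v
    using s[of v] by (intro fps_ext) (simp add: fps_X_mult_nth)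
  then have "eval_monom s m = (\<Prod>v\<in>UNIV. (fps_X * fps_shift 1 (s v)) ^ Poly_Mapping.lookup m v)"
    by (simp add: eval_monom_UNIV)
  also have "\<dots> = fps_X ^ monom_degree m * (\<Prod>v\<in>UNIV. fps_shift 1 (s v) ^ Poly_Mapping.lookup m v)"
    by (simp add: power_mult_distrib prod.distrib power_sum monom_degree_def)
  finally show ?thesis using k by (simp add: fps_X_power_mult_nth)
qed

lemma finite_monoms_of_degree_le: "finite {m. monom_degree m \<le> N}"
proof -
  have "Poly_Mapping.lookup ` {m. monom_degree m \<le> N} \<subseteq> UNIV \<rightarrow>\<^sub>E {..N}"
  proof (rule image_subsetI)
    fix m assume "m \<in> {m. monom_degree m \<le> N}"
    moreover have "Poly_Mapping.lookup m v \<le> monom_degree m" for v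
      unfolding monom_degree_def by (rule member_le_sum) auto
    ultimately show "Poly_Mapping.lookup m \<in> UNIV \<rightarrow>\<^sub>E {..N}"
      by (auto intro: order_trans)
  qed
  moreover have "finite ((UNIV :: wvar set) \<rightarrow>\<^sub>E {..N})" by (intro finite_PiE) auto
  ultimately have "finite (Poly_Mapping.lookup ` {m. monom_degree m \<le> N})" by (rule finite_subset)
  then show ?thesis by (rule finite_imageD) (simp add: inj_on_def poly_mapping_eqI)
qed

text \<open>Colorings of \<open>S\<close> are grouped by the coloring \<open>d\<close> that they
  induce on the cycle through \<open>r\<close>. Once \<open>d\<close> is fixed, the cycle edges
  enter only through the black counts in \<open>cycle_graph n\<close>, and a forest sum with
  prescribed root data remains.\<close>

lemma sum_black_white_W_connected_maps:
  fixes S :: "nat set"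
  assumes S: "finite S"
  shows "(\<Sum>f\<in>connected_maps S. black_white_W (fgraph S {} f)) =
    (\<Sum>n=1..card S. \<Sum>d\<in>colorings (cycle_graph n).
       forest_sum S (map (\<lambda>i. (d i, black_count (cycle_graph n) d i)) [0..<n]) / of_nat n)"
proof -
  have "(\<Sum>r\<in>root_lists S n. \<Sum>g\<in>forests S (set r). black_white_W (fgraph S {} (close_cycle S r g)) / of_nat n) =
     (\<Sum>d\<in>colorings (cycle_graph n). forest_sum S (map (\<lambda>i. (d i, black_count (cycle_graph n) d i)) [0..<n]) / of_nat n)"
    if n: "n \<in> {1..card S}" for n
  proof -
    let ?D = "colorings (cycle_graph n)"
    define ps where "ps = (\<lambda>d. map (\<lambda>i. (d i, black_count (cycle_graph n) d i)) [0..<n])"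
    have ps: "map fst (ps d) = map d [0..<n]" "map snd (ps d) = map (black_count (cycle_graph n) d) [0..<n]" "length (ps d) = n" for d
      by (simp_all add: ps_def)
    have W: "black_white_W (fgraph S {} (close_cycle S r g)) =
        (\<Sum>d\<in>?D. \<Sum>c\<in>root_colorings S r (map fst (ps d)). weight (fgraph S (set r) g) (root_extra r (map snd (ps d))) c)"
      if r: "r \<in> root_lists S n" for r g
    proof -
      have r': "distinct r" "set r \<subseteq> S" "r \<noteq> []" "length r = n" using r n by (auto simp: root_lists_def)
      let ?C = "S \<rightarrow>\<^sub>E {0, 1 :: nat}" and ?res = "\<lambda>c. \<lambda>i\<in>{0..<n}. c (r ! i) :: nat"
      have finC: "finite ?C" using S by (intro finite_PiE) auto
      have finD: "finite ?D" by (intro finite_colorings) (simp add: mverts_cycle_graph)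
      have "black_white_W (fgraph S {} (close_cycle S r g)) =
          (\<Sum>c\<in>?C. weight (fgraph S {} (close_cycle S r g)) (\<lambda>_. 0) c)"
        unfolding black_white_W_def colorings_def using S by (simp add: power_card_white_even)
      \<comment> \<open>\<open>?res c\<close> is the coloring of the standard cycle obtained by
        reading \<open>c\<close> along the list \<open>r\<close>.\<close>
      also have "\<dots> = (\<Sum>d\<in>?D. \<Sum>c\<in>{c \<in> ?C. ?res c = d}. weight (fgraph S {} (close_cycle S r g)) (\<lambda>_. 0) c)"
      proof (rule sum.group[symmetric, OF finC finD])
        show "?res ` ?C \<subseteq> ?D"
        proof
          fix d assume "d \<in> ?res ` ?C"
          then obtain c where c: "c \<in> ?C" "d = ?res c" by blast
          have "c (r ! i) \<in> {0, 1}" if "i < n" for i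
            using c(1) r' that by (intro PiE_mem[OF c(1)]) auto
          then show "d \<in> ?D" unfolding c(2) colorings_def mverts_cycle_graph restrict_PiE_iff by simp
        qed
      qed
      also have "\<dots> = (\<Sum>d\<in>?D. \<Sum>c\<in>root_colorings S r (map fst (ps d)). weight (fgraph S (set r) g) (root_extra r (map snd (ps d))) c)"
      proof (rule sum.cong[OF refl], rule sum.cong)
        fix d assume d: "d \<in> ?D"
        have "?res c = d \<longleftrightarrow> map c r = map fst (ps d)" for c
        proof -
          have "map c r = map fst (ps d) \<longleftrightarrow> (\<forall>i<n. c (r ! i) = d i)"
            unfolding ps list_eq_iff_nth_eq using r'(4) by simp
          also have "\<dots> \<longleftrightarrow> ?res c = d"
          proof
            assume *: "\<forall>i<n. c (r ! i) = d i"
            show "?res c = d"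
            proof (rule ext)
              show "?res c i = d i" for i
                using * d PiE_arb[of d "{0..<n}" _ i] by (cases "i < n") (auto simp: colorings_def mverts_cycle_graph)
            qed
          next
            assume "?res c = d"
            then show "\<forall>i<n. c (r ! i) = d i" by auto
          qed
          finally show ?thesis by blast
        qed
        then show eq: "{c \<in> ?C. ?res c = d} = root_colorings S r (map fst (ps d))"
          by (simp add: root_colorings_def)
        fix c assume "c \<in> root_colorings S r (map fst (ps d))"
        then have "?res c = d" using eq by blast
        then have cd: "c (r ! i) = d i" if "i < length r" for i using that r'(4) by auto
        show "weight (fgraph S {} (close_cycle S r g)) (\<lambda>_. 0) c = weight (fgraph S (set r) g) (root_extra r (map snd (ps d))) c"
          unfolding weight_def fgraph_simps
        proof (rule prod.cong[OF refl])
          fix v assume "v \<in> S"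
          then show "(if c v = 0 \<and> even (black_count (fgraph S {} (close_cycle S r g)) c v + 0) then tvar else 1) =
              (if c v = 0 \<and> even (black_count (fgraph S (set r) g) c v + root_extra r (map snd (ps d)) v) then tvar else 1)"
            using black_count_close_cycle[OF S r'(1-3), of v c d g] cd by (simp add: ps r'(4))
        qed
      qed
      finally show ?thesis .
    qed
    have "(\<Sum>r\<in>root_lists S n. \<Sum>g\<in>forests S (set r). black_white_W (fgraph S {} (close_cycle S r g)) / of_nat n) =
       (\<Sum>r\<in>root_lists S n. \<Sum>g\<in>forests S (set r). \<Sum>d\<in>?D. (\<Sum>c\<in>root_colorings S r (map fst (ps d)). weight (fgraph S (set r) g) (root_extra r (map snd (ps d))) c) / of_nat n)"
      by (intro sum.cong refl) (simp add: W sum_divide_distrib)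
    also have "\<dots> = (\<Sum>r\<in>root_lists S n. \<Sum>d\<in>?D. rooted_forest_sum S r (ps d) / of_nat n)"
    proof (rule sum.cong[OF refl])
      fix r
      show "(\<Sum>g\<in>forests S (set r). \<Sum>d\<in>?D. (\<Sum>c\<in>root_colorings S r (map fst (ps d)). weight (fgraph S (set r) g) (root_extra r (map snd (ps d))) c) / of_nat n) =
          (\<Sum>d\<in>?D. rooted_forest_sum S r (ps d) / of_nat n)"
        by (subst sum.swap) (simp only: rooted_forest_sum_def sum_divide_distrib)
    qed
    also have "\<dots> = (\<Sum>d\<in>?D. forest_sum S (ps d) / of_nat n)"
      by (subst sum.swap) (simp add: forest_sum_def sum_divide_distrib ps)
    finally show ?thesis by (simp add: ps_def)
  qed
  then show ?thesis
    unfolding sum_connected_maps[OF S] by (intro sum.cong refl) blast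
qed

definition tree_subst :: "wvar \<Rightarrow> t_laurent fps" where
  "tree_subst = (\<lambda>v. case v of
       Var_b \<Rightarrow> T_b
     | Var_wplus \<Rightarrow> T_wplus + T_wminus
     | Var_wminus \<Rightarrow> fps_const (inverse tvar) * T_wplus + fps_const tvar * T_wminus)"

text \<open>The factor \<open>fact N\<close> of the exponential generating functions cancels the one
  from the labellings; \<open>2 * n\<close> combines the two orientations with the \<open>n\<close>
  starting points.\<close>

lemma W_series_1_nth_eq:
  "fps_nth (W_series 1) N = (\<Sum>n=1..N. \<Sum>d\<in>colorings (cycle_graph n).
     fps_nth (eval_monom tree_subst (coloring_monom (cycle_graph n) d)) N / of_nat (2 * n))"
proof -
  let ?S = "{..<N}"
  have forest: "forest_sum ?S (map (\<lambda>i. (d i, black_count (cycle_graph n) d i)) [0..<n]) =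
      fact N * fps_nth (eval_monom tree_subst (coloring_monom (cycle_graph n) d)) N"
    if d: "d \<in> colorings (cycle_graph n)" for n d
  proof -
    let ?ps = "map (\<lambda>i. (d i, black_count (cycle_graph n) d i)) [0..<n]"
    have d01: "d i \<in> {0, 1}" if "i < n" for i
      using d that by (intro PiE_mem[of d "{0..<n}"]) (auto simp: colorings_def mverts_cycle_graph)
    have "forest_sum ?S ?ps = fact (card ?S) * fps_nth (prod_list (map branch_series ?ps)) (card ?S)"
    proof (intro forest_sum_eq_fps_nth forest_sum_branch)
      fix p assume "p \<in> set ?ps"
      then obtain i where "i < n" "fst p = d i" by auto
      then show "fst p \<in> {0, 1}" using d01 by simp
    qed auto
    also have "prod_list (map branch_series ?ps) = (\<Prod>i\<in>{0..<n}. branch_series (d i, black_count (cycle_graph n) d i))"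
      using prod.distinct_set_conv_list[of "[0..<n]" "\<lambda>i. branch_series (d i, black_count (cycle_graph n) d i)"]
      by (simp add: comp_def)
    also have "\<dots> = (\<Prod>i\<in>mverts (cycle_graph n). if d i = 1 then T_b
        else if even (black_count (cycle_graph n) d i) then T_wplus + T_wminus
        else fps_const (inverse tvar) * T_wplus + fps_const tvar * T_wminus)"
      by (simp add: mverts_cycle_graph branch_series_def)
    also have "\<dots> = eval_monom tree_subst (coloring_monom (cycle_graph n) d)"
      by (subst prod_coloring_classes[OF d])
        (simp_all add: mverts_cycle_graph eval_monom_UNIV UNIV_wvar lookup_coloring_monom tree_subst_def mult.assoc)
    finally show ?thesis by simp
  qed
  have "fps_nth (W_series 1) N = (\<Sum>f\<in>connected_maps ?S. black_white_W (fgraph ?S {} f)) / of_nat (2 * fact N)"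
    using W_series_1_nth[of ?S] by simp
  also have "\<dots> = (\<Sum>n=1..N. \<Sum>d\<in>colorings (cycle_graph n).
      fact N * fps_nth (eval_monom tree_subst (coloring_monom (cycle_graph n) d)) N / of_nat n / of_nat (2 * fact N))"
    unfolding sum_black_white_W_connected_maps[OF finite_lessThan] card_lessThan sum_divide_distrib
    by (intro sum.cong refl) (simp only: forest)
  also have "\<dots> = (\<Sum>n=1..N. \<Sum>d\<in>colorings (cycle_graph n).
      fps_nth (eval_monom tree_subst (coloring_monom (cycle_graph n) d)) N / of_nat (2 * n))"
    by (intro sum.cong refl) (simp add: field_simps)
  finally show ?thesis .
qed

lemma tree_series_nth_0: "fps_nth (tree_series P) 0 = 0"
  using tree_series_nth[of "{}" P] by (simp add: rooted_maps_def)

lemma tree_subst_nth_0: "fps_nth (tree_subst v) 0 = 0"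
  by (cases v) (simp_all add: tree_subst_def T_b_def T_wplus_def T_wminus_def tree_series_nth_0)

text \<open>Colorings are collected by their monomial; the bound \<open>N\<close> loses none of
  them, since the degree is the number of vertices.\<close>

lemma sum_eval_monom_full_W:
  assumes K: "finite (mverts K)" and N: "card (mverts K) \<le> N"
  shows "(\<Sum>m\<in>{m. monom_degree m \<le> N}. of_nat (card {c \<in> colorings K. coloring_monom K c = m}) * h m) =
    (\<Sum>c\<in>colorings K. h (coloring_monom K c) :: 'r :: comm_semiring_1)"
proof -
  have "(\<Sum>c\<in>colorings K. h (coloring_monom K c)) =
      (\<Sum>m\<in>{m. monom_degree m \<le> N}. \<Sum>c\<in>{c \<in> colorings K. coloring_monom K c = m}. h (coloring_monom K c))"
    using N monom_degree_coloring[OF _ K] K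
    by (intro sum.group[symmetric] finite_colorings finite_monoms_of_degree_le) auto
  also have "\<dots> = (\<Sum>m\<in>{m. monom_degree m \<le> N}. of_nat (card {c \<in> colorings K. coloring_monom K c = m}) * h m)"
    by (intro sum.cong refl) simp
  finally show ?thesis ..
qed

theorem theorem4p14:
  shows "has_substitution cycle_series
    (\<lambda>v. case v of
       Var_b \<Rightarrow> T_b
     | Var_wplus \<Rightarrow> T_wplus + T_wminus
     | Var_wminus \<Rightarrow> fps_const (inverse tvar) * T_wplus + fps_const tvar * T_wminus)
    (W_series 1)"
proof -
  define a where "a = (\<lambda>m. fps_const (of_rat (cycle_series m)) * eval_monom tree_subst m)"
  have a0: "fps_nth (a m) N = 0" if "N < monom_degree m" for m N
    using eval_monom_nth_eq_0[OF tree_subst_nth_0 that] by (simp add: a_def)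
  have aN: "(\<Sum>m\<in>{m. monom_degree m \<le> N}. fps_nth (a m) N) = fps_nth (W_series 1) N" for N
  proof -
    let ?M = "{m. monom_degree m \<le> N}"
    let ?k = "\<lambda>n m. card {c \<in> colorings (cycle_graph n). coloring_monom (cycle_graph n) c = m}"
    \<comment> \<open>Only \<open>n = monom_degree m\<close> contributes. Writing the coefficient as
      a sum over all lengths allows the sums over \<open>m\<close> and \<open>n\<close> to be
      exchanged.\<close>
    have am: "fps_nth (a m) N = (\<Sum>n=1..N. of_nat (?k n m) * (fps_nth (eval_monom tree_subst m) N / of_nat (2 * n)))"
      if m: "m \<in> ?M" for m
    proof -
      have "?k n m = 0" if "n \<noteq> monom_degree m" for n
      proof -
        have "{c \<in> colorings (cycle_graph n). coloring_monom (cycle_graph n) c = m} = {}"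
          using that monom_degree_coloring[of _ "cycle_graph n"] by (auto simp: mverts_cycle_graph)
        then show ?thesis by (simp only: card.empty)
      qed
      then have "(\<Sum>n=1..N. of_nat (?k n m) * (fps_nth (eval_monom tree_subst m) N / of_nat (2 * n))) =
          (\<Sum>n\<in>{1..N} \<inter> {monom_degree m}. of_nat (?k n m) * (fps_nth (eval_monom tree_subst m) N / of_nat (2 * n)))"
        by (intro sum.mono_neutral_right) auto
      also have "\<dots> = fps_nth (a m) N"
        using m by (cases "monom_degree m = 0")
          (simp_all add: a_def cycle_series_eq lookup_full_W mverts_cycle_graph of_rat_divide of_rat_mult Suc_le_eq)
      finally show ?thesis ..
    qed
    have "(\<Sum>m\<in>?M. fps_nth (a m) N) =
        (\<Sum>n=1..N. \<Sum>m\<in>?M. of_nat (?k n m) * (fps_nth (eval_monom tree_subst m) N / of_nat (2 * n)))"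
      by (subst sum.swap) (intro sum.cong refl am)
    also have "\<dots> = fps_nth (W_series 1) N"
      unfolding W_series_1_nth_eq
      by (intro sum.cong refl sum_eval_monom_full_W) (auto simp: mverts_cycle_graph)
    finally show ?thesis .
  qed
  \<comment> \<open>Convergence is checked coefficientwise: every finite set that contains all
    monomials of degree at most \<open>N\<close> already yields the exact coefficient of order
    \<open>N\<close>.\<close>
  have "(a has_sum W_series 1) UNIV"
    unfolding has_sum_def
  proof (rule tendsto_fpsI)
    fix N
    have "sum a M $ N = W_series 1 $ N" if M: "finite M" "{m. monom_degree m \<le> N} \<subseteq> M" for M
    proof -
      have "sum a M $ N = (\<Sum>m\<in>M. fps_nth (a m) N)" by (simp add: fps_sum_nth)
      also have "\<dots> = (\<Sum>m\<in>{m. monom_degree m \<le> N}. fps_nth (a m) N)"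
        using M a0 by (intro sum.mono_neutral_right) auto
      finally show ?thesis by (simp add: aN)
    qed
    then show "\<forall>\<^sub>F M in finite_subsets_at_top UNIV. sum a M $ N = W_series 1 $ N"
      unfolding eventually_finite_subsets_at_top
      using finite_monoms_of_degree_le[of N] by (intro exI[of _ "{m. monom_degree m \<le> N}"]) auto
  qed
  then show ?thesis
    by (simp add: has_substitution_def a_def eval_monom_def tree_subst_def)
qed

end
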